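(* Let $\mathcal{B}\in\mathcal{A}^{q+k}$. The following are equivalent: (i) $\mathcal{B}$ is detectable and $\pi_w(\mathcal{B})$ is offset stabilizable; (ii) there exists a regularly $\mathcal{L}^k$-implementable, offset stable reference $\mathcal{R}\in\mathcal{A}^q$. Moreover, if (i) holds and $(\bar w,\bar c)\in\mathcal{B}$ is a constant trajectory, then there exists a regularly $\mathcal{A}^k$-implementable, $\bar w$-stable $\mathcal{R}\in\mathcal{A}^q$.
   Context: $(\mathbb{R}^q)^{\mathbb{Z}}$ is the set of all maps $\mathbb{Z}\to\mathbb{R}^q$, and $(\sigma^\tau w)(t)=w(t+\tau)$ for $\tau\in\mathbb{Z}$. A trajectory $w$ is constant if $\sigma^\tau w=w$ for all $\tau\in\mathbb{Z}$ (it is then identified with its value). For $t_0\le t_1$, $w_{[t_0,t_1]}$ is the stacked vector of $w(t_0),\dots,w(t_1)$, and $\mathcal{B}_{[t_0,t_1]}=\{w_{[t_0,t_1]}:w\in\mathcal{B}\}$. A behavior is a nonempty set $\mathcal{B}\subseteq(\mathbb{R}^q)^{\mathbb{Z}}$. It is time-invariant if $w\in\mathcal{B}$ implies $\sigma^t w\in\mathcal{B}$ for all $t\in\mathbb{Z}$. It is complete if there is an integer $L\ge 0$ such that every $w\in(\mathbb{R}^q)^{\mathbb{Z}}$ with $w_{[t,t+L]}\in\mathcal{B}_{[t,t+L]}$ for all $t\in\mathbb{Z}$ belongs to $\mathcal{B}$. $\mathcal{A}^q$ (resp. $\mathcal{L}^q$) is the set of nonempty, time-invariant, complete behaviors in $(\mathbb{R}^q)^{\mathbb{Z}}$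 that are affine, i.e. $\alpha w_1+(1-\alpha)w_2\in\mathcal{B}$ for all $w_1,w_2\in\mathcal{B}$, $\alpha\in\mathbb{R}$ (resp. linear subspaces). A behavior $\mathcal{R}\in\mathcal{A}^q$ is $\bar w$-stable, for a constant trajectory $\bar w\in\mathcal{R}$, if $\lim_{t\to\infty}w(t)=\bar w$ for all $w\in\mathcal{R}$; it is offset stable if it is $\bar w$-stable for some constant trajectory $\bar w\in\mathcal{R}$. A behavior $\mathcal{B}\in\mathcal{A}^q$ is $\bar w$-stabilizable, for a constant trajectory $\bar w\in(\mathbb{R}^q)^{\mathbb{Z}}$, if for every $w\in\mathcal{B}$ there is $\tilde w\in\mathcal{B}$ with $\tilde w(t)=w(t)$ for $t\le0$ and $\lim_{t\to\infty}\tilde w(t)=\bar w$; it is offset stabilizable if it is $\bar w$-stabilizable for some constant trajectory $\bar w\in\mathcal{B}$. Let $q,k$ be nonnegative integers. Trajectories of $\mathcal{B}\in\mathcal{A}^{q+k}$ are written as pairs $(w,c)$ with $w\in(\mathbb{R}^q)^{\mathbb{Z}}$ (to-be-controlled variables) and $c\in(\mathbb{R}^k)^{\mathbb{Z}}$ (control variables); $\pi_w$ is the projection $(w,c)\mapsto w$. $\mathcal{B}\in\mathcal{A}^{q+k}$ is detectable if $(w_1,c),(w_2,c)\in\mathcal{B}$ implies $\lim_{t\to\infty}(w_1(t)-w_2(t))=0$. For $\mathcal{C}\subseteq(\mathbb{R}^k)^{\mathbb{Z}}$, $\mathcal{B}\Join\mathcal{C}:=\{(w,c)\in\mathcal{B}:c\in\mathcal{C}\}$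 and $\mathcal{B}\Vert\mathcal{C}:=\pi_w(\mathcal{B}\Join\mathcal{C})$. For a behavior $\mathcal{B}\in\mathcal{A}^q$, the input cardinality $\mathbf{m}(\mathcal{B})$ is the largest $m\in\{0,\dots,q\}$ such that, after some permutation of the $q$ components of the trajectories, the projection of $\mathcal{B}$ onto the first $m$ components is all of $(\mathbb{R}^m)^{\mathbb{Z}}$; the output cardinality is $\mathbf{p}(\mathcal{B}):=q-\mathbf{m}(\mathcal{B})$. The interconnection of $\mathcal{B}\in\mathcal{A}^{q+k}$ and $\mathcal{C}$ is regular if $\mathcal{B}\Join\mathcal{C}$ is nonempty and $\mathbf{m}(\mathcal{B}\Join\mathcal{C})=\mathbf{m}(\mathcal{B})-\mathbf{p}(\mathcal{C})$ (with $\mathcal{B}\Join\mathcal{C}$ regarded as a behavior in $(\mathbb{R}^{q+k})^{\mathbb{Z}}$). For $\mathcal{M}\in\{\mathcal{L}^k,\mathcal{A}^k\}$, $\mathcal{R}\in\mathcal{A}^q$ is regularly $\mathcal{M}$-implementable if there is $\mathcal{C}\in\mathcal{M}$ such that the interconnection of $\mathcal{B}$ and $\mathcal{C}$ is regular and $\mathcal{B}\Vert\mathcal{C}=\mathcal{R}$. Convention for $q=0$ (full interconnection): $\mathcal{B}\Join\mathcal{C}=\mathcal{B}\Vert\mathcal{C}=\mathcal{B}\cap\mathcal{C}$ and $\pi_w(\mathcal{B})=\mathcal{B}$; references are then behaviors $\mathcal{R}\in\mathcal{A}^k$, a pair $(w,c)\in\mathcal{B}$ is read as $w=c\in\mathcal{B}$,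 and detectability holds trivially. *)

theory Defs
  imports "HOL-Analysis.Analysis" "HOL-Combinatorics.Permutations"
begin

(* The dimensions are natural numbers, possibly 0, so R^n is represented by the functions
   nat => real vanishing outside {..<n}.  Limits of trajectories are taken in the product
   topology of nat => real, which induces the usual topology on R^n. *)

type_synonym trajectory = "int \<Rightarrow> nat \<Rightarrow> real"

definition trajectories :: "nat \<Rightarrow> trajectory set" where
  "trajectories n = {w. \<forall>t. \<forall>i\<ge>n. w t i = 0}"

definition time_shift :: "int \<Rightarrow> trajectory \<Rightarrow> trajectory" where
  "time_shift \<tau> w = (\<lambda>t. w (t + \<tau>))"

(* The value of a constant trajectory w is written w 0 below. *)
definition constant_trajectory :: "trajectory \<Rightarrow> bool" where
  "constant_trajectory w \<longleftrightarrow> (\<forall>\<tau>. time_shift \<tau> w = w)"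

definition window :: "int \<Rightarrow> int \<Rightarrow> trajectory \<Rightarrow> (nat \<Rightarrow> real) list" where
  "window t0 t1 w = map w [t0..t1]"

definition time_invariant_behavior :: "trajectory set \<Rightarrow> bool" where
  "time_invariant_behavior B \<longleftrightarrow> (\<forall>w\<in>B. \<forall>t. time_shift t w \<in> B)"

definition complete_behavior :: "nat \<Rightarrow> trajectory set \<Rightarrow> bool" where
  "complete_behavior n B \<longleftrightarrow>
    (\<exists>L\<ge>0. \<forall>w\<in>trajectories n.
      (\<forall>t. window t (t + L) w \<in> window t (t + L) ` B) \<longrightarrow> w \<in> B)"

definition affine_closed :: "trajectory set \<Rightarrow> bool" where
  "affine_closed B \<longleftrightarrow>
    (\<forall>w1\<in>B. \<forall>w2\<in>B. \<forall>\<alpha>. (\<lambda>t i. \<alpha> * w1 t i + (1 - \<alpha>) * w2 t i) \<in> B)"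

definition linear_closed :: "trajectory set \<Rightarrow> bool" where
  "linear_closed B \<longleftrightarrow>
    (\<lambda>t i. 0) \<in> B \<and>
    (\<forall>w1\<in>B. \<forall>w2\<in>B. (\<lambda>t i. w1 t i + w2 t i) \<in> B) \<and>
    (\<forall>w\<in>B. \<forall>\<alpha>. (\<lambda>t i. \<alpha> * w t i) \<in> B)"

definition affine_behaviors :: "nat \<Rightarrow> trajectory set set" where
  "affine_behaviors n =
    {B. B \<subseteq> trajectories n \<and> B \<noteq> {} \<and> time_invariant_behavior B \<and> complete_behavior n B
      \<and> affine_closed B}"

definition linear_behaviors :: "nat \<Rightarrow> trajectory set set" where
  "linear_behaviors n =
    {B. B \<subseteq> trajectories n \<and> B \<noteq> {} \<and> time_invariant_behavior B \<and> complete_behavior n B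
      \<and> linear_closed B}"

definition stable_at :: "trajectory \<Rightarrow> trajectory set \<Rightarrow> bool" where
  "stable_at w0 R \<longleftrightarrow>
    constant_trajectory w0 \<and> w0 \<in> R \<and> (\<forall>w\<in>R. (w \<longlongrightarrow> w0 0) at_top)"

definition offset_stable :: "trajectory set \<Rightarrow> bool" where
  "offset_stable R \<longleftrightarrow> (\<exists>w0\<in>R. stable_at w0 R)"

definition stabilizable_at :: "nat \<Rightarrow> trajectory \<Rightarrow> trajectory set \<Rightarrow> bool" where
  "stabilizable_at n w0 B \<longleftrightarrow>
    constant_trajectory w0 \<and> w0 \<in> trajectories n \<and>
    (\<forall>w\<in>B. \<exists>w'\<in>B. (\<forall>t\<le>0. w' t = w t) \<and> (w' \<longlongrightarrow> w0 0) at_top)"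

definition offset_stabilizable :: "nat \<Rightarrow> trajectory set \<Rightarrow> bool" where
  "offset_stabilizable n B \<longleftrightarrow> (\<exists>w0\<in>B. stabilizable_at n w0 B)"

definition first_components :: "nat \<Rightarrow> trajectory \<Rightarrow> trajectory" where
  "first_components m w = (\<lambda>t i. if i < m then w t i else 0)"

definition permute_components :: "(nat \<Rightarrow> nat) \<Rightarrow> trajectory \<Rightarrow> trajectory" where
  "permute_components \<pi> w = (\<lambda>t i. w t (\<pi> i))"

definition input_cardinality :: "nat \<Rightarrow> trajectory set \<Rightarrow> nat" where
  "input_cardinality n B =
    Max {m. m \<le> n \<and> (\<exists>\<pi>. \<pi> permutes {..<n} \<and>
      (\<lambda>w. first_components m (permute_components \<pi> w)) ` B = trajectories m)}"

definition output_cardinality :: "nat \<Rightarrow> trajectory set \<Rightarrow> nat" where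
  "output_cardinality n B = n - input_cardinality n B"

(* A pair (w, c) is a trajectory b with q + k components: w consists of the first q of them
   and c of the remaining k.  By convention q = 0 stands for full interconnection, in which
   b is read as w = c = b, so that references then have k components. *)

definition w_part :: "nat \<Rightarrow> trajectory \<Rightarrow> trajectory" where
  "w_part q b = (if q = 0 then b else first_components q b)"

definition c_part :: "nat \<Rightarrow> trajectory \<Rightarrow> trajectory" where
  "c_part q b = (\<lambda>t i. b t (q + i))"

definition ref_dim :: "nat \<Rightarrow> nat \<Rightarrow> nat" where
  "ref_dim q k = (if q = 0 then k else q)"

definition proj_w :: "nat \<Rightarrow> trajectory set \<Rightarrow> trajectory set" where
  "proj_w q B = w_part q ` B"

definition detectable :: "nat \<Rightarrow> trajectory set \<Rightarrow> bool" where
  "detectable q B \<longleftrightarrow>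
    (\<forall>b1\<in>B. \<forall>b2\<in>B. c_part q b1 = c_part q b2 \<longrightarrow>
      ((\<lambda>t i. w_part q b1 t i - w_part q b2 t i) \<longlongrightarrow> (\<lambda>i. 0)) at_top)"

definition interconnection :: "nat \<Rightarrow> trajectory set \<Rightarrow> trajectory set \<Rightarrow> trajectory set" where
  "interconnection q B C = {b\<in>B. c_part q b \<in> C}"

definition controlled_behavior :: "nat \<Rightarrow> trajectory set \<Rightarrow> trajectory set \<Rightarrow> trajectory set" where
  "controlled_behavior q B C = proj_w q (interconnection q B C)"

(* The equation is over int because the right-hand side may be negative. *)
definition regular_interconnection ::
    "nat \<Rightarrow> nat \<Rightarrow> trajectory set \<Rightarrow> trajectory set \<Rightarrow> bool" where
  "regular_interconnection q k B C \<longleftrightarrow>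
    interconnection q B C \<noteq> {} \<and>
    int (input_cardinality (q + k) (interconnection q B C)) =
      int (input_cardinality (q + k) B) - int (output_cardinality k C)"

definition regularly_implementable ::
    "nat \<Rightarrow> nat \<Rightarrow> trajectory set set \<Rightarrow> trajectory set \<Rightarrow> trajectory set \<Rightarrow> bool" where
  "regularly_implementable q k M B R \<longleftrightarrow>
    (\<exists>C\<in>M. regular_interconnection q k B C \<and> controlled_behavior q B C = R)"

end

theory Submission
  imports Defs "Jordan_Normal_Form.Gauss_Jordan_Elimination"
    "HOL-Computational_Algebra.Fundamental_Theorem_Algebra"
begin

text \<open>
  The indeterminate of the polynomial ring over the reals acts on trajectories as the time shift, and
  polynomial matrices act as difference operators.  Over this principal ideal domain every matrix is
  diagonal in suitable coordinates (\<open>equivalent_to_diagonal\<close>), and a nonzero scalar operator is onto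
  (\<open>poly_act_surj\<close>); most questions about behaviors thereby become questions about scalar difference
  equations.

  An affine behavior is a translate of the kernel of a difference operator \<open>G\<close> that may be taken to be
  onto (\<open>affine_behavior_kernel_representation\<close>, \<open>kernel_behavior_onto_representation\<close>).  Its input
  cardinality is the number of variables minus the number of rows of \<open>G\<close>, and this equality in turn
  forces \<open>G\<close> to be onto (\<open>input_cardinality_kernel\<close>, \<open>onto_if_input_cardinality\<close>).  Thus the
  interconnection with a controller given by an onto operator \<open>K\<close> is regular iff the equations of \<open>G\<close>
  and of \<open>K\<close> together are onto (\<open>regular_interconnection_iff\<close>).

  From (i) to (ii): detectability and stabilizability only concern the linear part \<open>Gw w + Gc c = 0\<close>
  of the plant.  By detectability \<open>w\<close> is the output of a stable filter driven by a signal computed from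
  \<open>c\<close>.  Some coordinates of this signal can be assigned freely, the others are autonomous, and the
  autonomous ones decay by stabilizability.  The controller sets the free ones to 0; these are
  independent equations, so the interconnection is regular, and \<open>w\<close> decays
  (\<open>stabilizing_constraint\<close>).  For the affine plant this yields a translate of a stable behavior, which
  is time-invariant and hence contains a constant trajectory, because 1 is not a root of a stable
  polynomial (\<open>stable_translate_contains_constant\<close>).  If a constant plant trajectory is given,
  translating the controller by its control part makes its \<open>w\<close> part the offset.

  From (ii) to (i): two plant trajectories with equal control variables differ by an element of the
  linear part of the controlled behavior, which decays; this is detectability.  By regularity any
  evolution of the plant up to the present can be continued by one that eventually satisfies the
  controller equations (\<open>stabilizable_from_onto_constraint\<close>).
\<close>

section \<open>Diagonal form of polynomial matrices\<close>

definition mutually_inverse :: "nat \<Rightarrow> 'a::comm_ring_1 mat \<Rightarrow> 'a mat \<Rightarrow> bool" where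
  "mutually_inverse n U U' \<longleftrightarrow>
     U \<in> carrier_mat n n \<and> U' \<in> carrier_mat n n \<and> U * U' = 1\<^sub>m n \<and> U' * U = 1\<^sub>m n"

definition equivalent_mats :: "nat \<Rightarrow> nat \<Rightarrow> 'a::comm_ring_1 mat \<Rightarrow> 'a mat \<Rightarrow> bool" where
  "equivalent_mats m n A B \<longleftrightarrow> A \<in> carrier_mat m n \<and>
     (\<exists>U U' V V'. mutually_inverse m U U' \<and> mutually_inverse n V V' \<and> B = U * A * V)"

definition diagonal :: "nat \<Rightarrow> nat \<Rightarrow> nat \<Rightarrow> (nat \<Rightarrow> 'a::comm_ring_1) \<Rightarrow> 'a mat" where
  "diagonal m n r d = mat m n (\<lambda>(i, j). if i = j \<and> i < r then d i else 0)"

lemma mutually_inverse_one: "mutually_inverse n (1\<^sub>m n) (1\<^sub>m n)"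
  by (simp add: mutually_inverse_def)

lemma mutually_inverse_mult:
  assumes "mutually_inverse n U U'" "mutually_inverse n V V'"
  shows "mutually_inverse n (U * V) (V' * U')"
proof -
  have c: "U \<in> carrier_mat n n" "U' \<in> carrier_mat n n" "V \<in> carrier_mat n n" "V' \<in> carrier_mat n n"
    and i: "U * U' = 1\<^sub>m n" "U' * U = 1\<^sub>m n" "V * V' = 1\<^sub>m n" "V' * V = 1\<^sub>m n"
    using assms by (auto simp: mutually_inverse_def)
  have "(U * V) * (V' * U') = U * (V * V') * U'"
    using c by (simp add: assoc_mult_mat[of _ n n _ n _ n])
  moreover have "(V' * U') * (U * V) = V' * (U' * U) * V"
    using c by (simp add: assoc_mult_mat[of _ n n _ n _ n])
  ultimately show ?thesis
    using c i by (auto simp: mutually_inverse_def)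
qed

lemma mutually_inverse_transpose:
  assumes "mutually_inverse n U U'"
  shows "mutually_inverse n (transpose_mat U) (transpose_mat U')"
proof -
  have c: "U \<in> carrier_mat n n" "U' \<in> carrier_mat n n" 
    and i: "U * U' = 1\<^sub>m n" "U' * U = 1\<^sub>m n"
    using assms by (auto simp: mutually_inverse_def)
  have "transpose_mat U * transpose_mat U' = transpose_mat (U' * U)"
       "transpose_mat U' * transpose_mat U = transpose_mat (U * U')"
    using c transpose_mult by metis+
  then show ?thesis using c i by (auto simp: mutually_inverse_def)
qed

lemma equivalent_mats_refl: "A \<in> carrier_mat m n \<Longrightarrow> equivalent_mats m n A A"
  unfolding equivalent_mats_def using mutually_inverse_one by fastforce

lemma equivalent_mats_carrier:
  "equivalent_mats m n A B \<Longrightarrow> A \<in> carrier_mat m n \<and> B \<in> carrier_mat m n"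
  unfolding equivalent_mats_def mutually_inverse_def by auto

lemma equivalent_mats_trans:
  assumes "equivalent_mats m n A B" "equivalent_mats m n B C"
  shows "equivalent_mats m n A C"
proof -
  obtain U U' V V' where 1: "mutually_inverse m U U'" "mutually_inverse n V V'" "B = U * A * V"
    and A: "A \<in> carrier_mat m n"
    using assms(1) unfolding equivalent_mats_def by blast
  obtain X X' Y Y' where 2: "mutually_inverse m X X'" "mutually_inverse n Y Y'" "C = X * B * Y"
    using assms(2) unfolding equivalent_mats_def by blast
  have c: "U \<in> carrier_mat m m" "V \<in> carrier_mat n n" "X \<in> carrier_mat m m" "Y \<in> carrier_mat n n"
    using 1 2 by (auto simp: mutually_inverse_def)
  have "C = (X * U) * A * (V * Y)"
    using c A unfolding 2 1 by (simp add: assoc_mult_mat[of _ m m _ m _ n] assoc_mult_mat[of _ m m _ n _ n]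
      assoc_mult_mat[of _ m n _ n _ n] assoc_mult_mat[of _ m m _ m _ m])
  then show ?thesis
    using A mutually_inverse_mult[OF 2(1) 1(1)] mutually_inverse_mult[OF 1(2) 2(2)]
    unfolding equivalent_mats_def by blast
qed

text \<open>Transposition exchanges row and column operations, so that only row operations need
  explicit matrices.\<close>

lemma equivalent_mats_transpose:
  assumes "equivalent_mats m n A B"
  shows "equivalent_mats n m (transpose_mat A) (transpose_mat B)"
proof -
  obtain U U' V V' where 1: "mutually_inverse m U U'" "mutually_inverse n V V'" "B = U * A * V"
    and A: "A \<in> carrier_mat m n"
    using assms(1) unfolding equivalent_mats_def by blast
  have c: "U \<in> carrier_mat m m" "V \<in> carrier_mat n n"
    using 1 by (auto simp: mutually_inverse_def)
  have "transpose_mat B = transpose_mat V * transpose_mat A * transpose_mat U"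
    using c A unfolding 1 by (simp add: transpose_mult[of _ m n _ n] transpose_mult[of _ m m _ n]
      assoc_mult_mat[of _ n n _ m _ m])
  then show ?thesis
    using A mutually_inverse_transpose[OF 1(1)] mutually_inverse_transpose[OF 1(2)]
    unfolding equivalent_mats_def by auto
qed

lemma equivalent_mats_swaprows:
  assumes "A \<in> carrier_mat m n" "k < m" "l < m"
  shows "equivalent_mats m n A (swaprows k l A)"
proof -
  have "mutually_inverse m (swaprows_mat m k l) (swaprows_mat m k l :: 'a mat)"
    using swaprows_mat_inv[OF assms(2,3)] by (auto simp: mutually_inverse_def)
  moreover have "swaprows k l A = swaprows_mat m k l * A * 1\<^sub>m n"
    using swaprows_mat[OF assms] assms(1) by (metis right_mult_one_mat swaprows_carrier)
  ultimately show ?thesis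
    using assms(1) mutually_inverse_one unfolding equivalent_mats_def by blast
qed

lemma equivalent_mats_addrow:
  assumes "A \<in> carrier_mat m n" "k < m" "l < m" "k \<noteq> l"
  shows "equivalent_mats m n A (addrow a k l A)"
proof -
  have "mutually_inverse m (addrow_mat m a k l) (addrow_mat m (- a) k l :: 'a mat)"
    using addrow_mat_inv[OF assms(2-4), of a] addrow_mat_inv[OF assms(2-4), of "-a"]
    by (auto simp: mutually_inverse_def)
  moreover have "addrow a k l A = addrow_mat m a k l * A * 1\<^sub>m n"
    using addrow_mat[OF assms(1,3)] assms(1) by (metis right_mult_one_mat addrow_carrier)
  ultimately show ?thesis
    using assms(1) mutually_inverse_one unfolding equivalent_mats_def by blast
qed

lemma equivalent_mats_block:
  assumes "equivalent_mats m n A B"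
  defines "bl \<equiv> \<lambda>x X. four_block_mat (mat 1 1 (\<lambda>_. x)) (0\<^sub>m 1 (dim_col X)) (0\<^sub>m (dim_row X) 1) X"
  shows "equivalent_mats (Suc m) (Suc n) (bl x A) (bl x B)"
proof -
  have one: "mat 1 1 (\<lambda>_. 1) = (1\<^sub>m 1 :: 'a mat)" by auto
  have mult: "bl x X * bl y Y = bl (x * y) (X * Y)"
    if "X \<in> carrier_mat i j" "Y \<in> carrier_mat j k" for x y i j k and X Y :: "'a mat"
  proof -
    have "mat 1 1 (\<lambda>_. x) * mat 1 1 (\<lambda>_. y) = mat 1 1 (\<lambda>_. x * y)"
      by (auto simp: scalar_prod_def)
    then show ?thesis
      unfolding bl_def using that
      by (subst mult_four_block_mat[of _ 1 1 _ j _ i _ _ 1 _ k]) auto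
  qed
  have inv: "mutually_inverse (Suc j) (bl 1 U) (bl 1 U')" if "mutually_inverse j U U'" for j and U U' :: "'a mat"
  proof -
    have c: "U \<in> carrier_mat j j" "U' \<in> carrier_mat j j" and i: "U * U' = 1\<^sub>m j" "U' * U = 1\<^sub>m j"
      using that by (auto simp: mutually_inverse_def)
    have b: "bl 1 (1\<^sub>m j) = (1\<^sub>m (Suc j) :: 'a mat)"
      unfolding bl_def by (rule eq_matI) auto
    have "bl 1 U \<in> carrier_mat (Suc j) (Suc j)" "bl 1 U' \<in> carrier_mat (Suc j) (Suc j)"
      using c unfolding bl_def by auto
    then show ?thesis
      using mult[OF c, of 1 1] mult[OF c(2,1), of 1 1] i b unfolding mutually_inverse_def by auto
  qed
  obtain U U' V V' where 1: "mutually_inverse m U U'" "mutually_inverse n V V'" "B = U * A * V"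
    and A: "A \<in> carrier_mat m n"
    using assms(1) unfolding equivalent_mats_def by blast
  have c: "U \<in> carrier_mat m m" "V \<in> carrier_mat n n"
    using 1 by (auto simp: mutually_inverse_def)
  have "bl x B = bl 1 U * bl x A * bl 1 V"
    unfolding 1(3) using mult[OF c(1) A] mult[OF mult_carrier_mat[OF c(1) A] c(2)] by simp
  moreover have "bl x A \<in> carrier_mat (Suc m) (Suc n)"
    using A unfolding bl_def by auto
  ultimately show ?thesis
    using inv[OF 1(1)] inv[OF 1(2)] unfolding equivalent_mats_def by blast
qed

text \<open>The Euclidean step: among the equivalent matrices with nonzero corner, take one whose corner
  has least degree and, among these, one with the fewest nonzero entries beside and below the
  corner.  A nonzero entry there, divided by the corner, would either leave a nonzero remainder of
  smaller degree or vanish by a row operation, contradicting one of the two choices.\<close>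

lemma equivalent_mats_pivot:
  fixes A :: "'a::field poly mat"
  assumes A: "A \<in> carrier_mat (Suc m) (Suc n)" and nz: "A \<noteq> 0\<^sub>m (Suc m) (Suc n)"
  shows "\<exists>B. equivalent_mats (Suc m) (Suc n) A B \<and> B $$ (0, 0) \<noteq> 0 \<and>
           (\<forall>i. 0 < i \<and> i < Suc m \<longrightarrow> B $$ (i, 0) = 0) \<and> (\<forall>j. 0 < j \<and> j < Suc n \<longrightarrow> B $$ (0, j) = 0)"
proof -
  let ?m = "Suc m" and ?n = "Suc n"
  define cnt where "cnt = (\<lambda>m n (B::'a poly mat). card {i. 0 < i \<and> i < m \<and> B $$ (i, 0) \<noteq> 0}
       + card {j. 0 < j \<and> j < n \<and> B $$ (0, j) \<noteq> 0})"
  define P where "P = (\<lambda>d c. \<exists>B. equivalent_mats ?m ?n A B \<and> B $$ (0, 0) \<noteq> 0 \<and>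
       degree (B $$ (0, 0)) = d \<and> cnt ?m ?n B = c)"
  have ex: "\<exists>d c. P d c"
  proof -
    obtain i j where ij: "i < ?m" "j < ?n" "A $$ (i, j) \<noteq> 0"
      using A nz by (metis carrier_matD eq_matI index_zero_mat)
    let ?B = "swaprows 0 i A"
    let ?C = "transpose_mat (swaprows 0 j (transpose_mat ?B))"
    have 1: "equivalent_mats ?m ?n A ?B"
      by (rule equivalent_mats_swaprows[OF A]) (use ij in auto)
    have B: "?B \<in> carrier_mat ?m ?n" using A by simp
    have "equivalent_mats ?n ?m (transpose_mat ?B) (swaprows 0 j (transpose_mat ?B))"
      by (rule equivalent_mats_swaprows) (use ij B in auto)
    from equivalent_mats_transpose[OF this] have "equivalent_mats ?m ?n ?B ?C"
      by simp
    with 1 have "equivalent_mats ?m ?n A ?C" by (rule equivalent_mats_trans)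
    moreover have "?C $$ (0, 0) = A $$ (i, j)"
      using A B ij by auto
    ultimately show ?thesis using ij(3) unfolding P_def by metis
  qed
  define d where "d = (LEAST d. \<exists>c. P d c)"
  have d: "\<exists>c. P d c" unfolding d_def using ex by (rule LeastI_ex)
  have dmin: "\<not> P d' c" if "d' < d" for d' c using that not_less_Least unfolding d_def by blast
  define c where "c = (LEAST c. P d c)"
  have c: "P d c" unfolding c_def using d by (rule LeastI_ex)
  have cmin: "\<not> P d c'" if "c' < c" for c' using that not_less_Least unfolding c_def by blast
  from c obtain B where B: "equivalent_mats ?m ?n A B" "B $$ (0, 0) \<noteq> 0"
     "degree (B $$ (0, 0)) = d" "cnt ?m ?n B = c"
    unfolding P_def by blast
  have Bc: "B \<in> carrier_mat ?m ?n" using equivalent_mats_carrier[OF B(1)] by simp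
  have key: "False"
    if X: "X \<in> carrier_mat k l" and eqv: "\<And>Y. equivalent_mats k l X Y \<Longrightarrow> Y $$ (0,0) \<noteq> 0 \<Longrightarrow>
         P (degree (Y $$ (0,0))) (cnt k l Y)"
      and X0: "X $$ (0, 0) \<noteq> 0" "degree (X $$ (0,0)) = d" "cnt k l X = c"
      and i: "0 < i" "i < k" "X $$ (i, 0) \<noteq> 0" and l: "0 < l" for X k l i
  proof -
    let ?q = "X $$ (i, 0) div X $$ (0, 0)"
    let ?Y = "addrow (- ?q) i 0 X"
    have Y: "equivalent_mats k l X ?Y"
      by (rule equivalent_mats_addrow[OF X]) (use i in auto)
    have Yc: "?Y \<in> carrier_mat k l" using X by simp
    have Yi: "?Y $$ (i, 0) = X $$ (i, 0) mod X $$ (0, 0)"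
      using X i l by (simp add: minus_div_mult_eq_mod[symmetric])
    have Yo: "?Y $$ (i', j) = X $$ (i', j)" if "i' < k" "i' \<noteq> i" "j < l" for i' j
      using X that by simp
    show False
    proof (cases "?Y $$ (i, 0) = 0")
      case True
      have "{i'. 0 < i' \<and> i' < k \<and> ?Y $$ (i', 0) \<noteq> 0} \<subset> {i'. 0 < i' \<and> i' < k \<and> X $$ (i', 0) \<noteq> 0}"
      proof -
        have "X $$ (i', 0) \<noteq> 0" if "i' < k" "?Y $$ (i', 0) \<noteq> 0" for i'
          using that True Yo[of i' 0] l by (cases "i' = i") auto
        then show ?thesis using True i by blast
      qed
      then have "card {i'. 0 < i' \<and> i' < k \<and> ?Y $$ (i', 0) \<noteq> 0} < card {i'. 0 < i' \<and> i' < k \<and> X $$ (i', 0) \<noteq> 0}"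
        by (rule psubset_card_mono[rotated]) auto
      moreover have "{j. 0 < j \<and> j < l \<and> ?Y $$ (0, j) \<noteq> 0} = {j. 0 < j \<and> j < l \<and> X $$ (0, j) \<noteq> 0}"
        using Yo[of 0] i by auto
      ultimately have "cnt k l ?Y < cnt k l X" unfolding cnt_def by simp
      moreover have "?Y $$ (0, 0) = X $$ (0, 0)" using Yo[of 0 0] i l by simp
      ultimately show False using eqv[OF Y] X0 cmin by metis
    next
      case False
      let ?Z = "swaprows 0 i ?Y"
      have "equivalent_mats k l X ?Z"
        using equivalent_mats_trans[OF Y equivalent_mats_swaprows[OF Yc]] i by auto
      moreover have Z: "?Z $$ (0, 0) = ?Y $$ (i, 0)" using Yc i l by simp
      moreover have "degree (?Y $$ (i, 0)) < d"
        using False X0 unfolding Yi by (metis degree_mod_less')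
      ultimately show False using eqv dmin False by metis
    qed
  qed
  have "B $$ (i, 0) = 0" if "0 < i" "i < ?m" for i
  proof (rule ccontr)
    assume "B $$ (i, 0) \<noteq> 0"
    moreover have "P (degree (Y $$ (0,0))) (cnt ?m ?n Y)" 
       if "equivalent_mats ?m ?n B Y" "Y $$ (0,0) \<noteq> 0" for Y
      using that B(1) equivalent_mats_trans unfolding P_def by blast
    ultimately show False using key[OF Bc _ B(2-4) that] by blast
  qed
  moreover have "B $$ (0, j) = 0" if "0 < j" "j < ?n" for j
  proof (rule ccontr)
    assume *: "B $$ (0, j) \<noteq> 0"
    let ?T = "transpose_mat B"
    have sym: "cnt ?m ?n (transpose_mat Y) = cnt ?n ?m Y" if "Y \<in> carrier_mat ?n ?m" for Y
    proof -
      have "{i. 0 < i \<and> i < ?m \<and> transpose_mat Y $$ (i, 0) \<noteq> 0} = {j. 0 < j \<and> j < ?m \<and> Y $$ (0, j) \<noteq> 0}"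
        "{j. 0 < j \<and> j < ?n \<and> transpose_mat Y $$ (0, j) \<noteq> 0} = {i. 0 < i \<and> i < ?n \<and> Y $$ (i, 0) \<noteq> 0}"
        using that by auto
      then show ?thesis unfolding cnt_def by simp
    qed
    have Tc: "?T \<in> carrier_mat ?n ?m" using Bc by simp
    have T0: "?T $$ (0, 0) = B $$ (0, 0)" "?T $$ (j, 0) = B $$ (0, j)" using Bc that by auto
    have "P (degree (Y $$ (0,0))) (cnt ?n ?m Y)" 
       if Y: "equivalent_mats ?n ?m ?T Y" "Y $$ (0,0) \<noteq> 0" for Y
    proof -
      have Yc: "Y \<in> carrier_mat ?n ?m" using equivalent_mats_carrier[OF Y(1)] by simp
      have "equivalent_mats ?m ?n B (transpose_mat Y)"
        using equivalent_mats_transpose[OF Y(1)] by simp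
      then have "equivalent_mats ?m ?n A (transpose_mat Y)"
        using equivalent_mats_trans[OF B(1)] by blast
      moreover have "transpose_mat Y $$ (0, 0) = Y $$ (0, 0)" using Yc by auto
      ultimately show ?thesis unfolding P_def using sym[OF Yc] Y(2) by metis
    qed
    moreover have "cnt ?n ?m ?T = c" using sym[OF Tc] B(4) by simp
    ultimately show False
      using key[OF Tc, of j] B(2,3) that * unfolding T0 by blast
  qed
  ultimately show ?thesis using B by blast
qed

text \<open>This is the Smith form without its divisibility chain; the nonzero entries come first because
  pivots are split off as long as the remaining block is nonzero.\<close>

lemma equivalent_to_diagonal:
  fixes A :: "'a::field poly mat"
  assumes "A \<in> carrier_mat m n"
  shows "\<exists>r d. r \<le> m \<and> r \<le> n \<and> (\<forall>i<r. d i \<noteq> 0) \<and> equivalent_mats m n A (diagonal m n r d)"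
  using assms
proof (induction m arbitrary: n A)
  case 0
  have "diagonal 0 n 0 (\<lambda>_. 0) = A" using 0 unfolding diagonal_def by auto
  then show ?case using equivalent_mats_refl[OF 0] by (intro exI[of _ 0] exI[of _ "\<lambda>_. 0"]) auto
next
  case (Suc m)
  show ?case
  proof (cases "A = 0\<^sub>m (Suc m) n")
    case True
    have "diagonal (Suc m) n 0 (\<lambda>_. 0) = A" unfolding diagonal_def True by auto
    then show ?thesis using equivalent_mats_refl[OF Suc.prems] 
      by (intro exI[of _ 0] exI[of _ "\<lambda>_. 0"]) auto
  next
    case False
    then obtain n' where n: "n = Suc n'" using Suc.prems by (cases n) auto
    obtain B where B: "equivalent_mats (Suc m) n A B" "B $$ (0, 0) \<noteq> 0"
      "\<And>i. 0 < i \<Longrightarrow> i < Suc m \<Longrightarrow> B $$ (i, 0) = 0" "\<And>j. 0 < j \<Longrightarrow> j < n \<Longrightarrow> B $$ (0, j) = 0"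
      using equivalent_mats_pivot[of A m n'] Suc.prems False unfolding n by metis
    define C where "C = mat m n' (\<lambda>(i, j). B $$ (Suc i, Suc j))"
    obtain r d where rd: "r \<le> m" "r \<le> n'" "\<forall>i<r. d i \<noteq> 0" "equivalent_mats m n' C (diagonal m n' r d)"
      using Suc.IH[of C n'] unfolding C_def by auto
    let ?d = "\<lambda>i. case i of 0 \<Rightarrow> B $$ (0, 0) | Suc i \<Rightarrow> d i"
    let ?bl = "\<lambda>X. four_block_mat (mat 1 1 (\<lambda>_. B $$ (0,0))) (0\<^sub>m 1 (dim_col X)) (0\<^sub>m (dim_row X) 1) X"
    have "?bl C = B"
      using B equivalent_mats_carrier[OF B(1)] unfolding C_def n
      by (intro eq_matI) (auto simp: less_Suc_eq_0_disj)
    moreover have "?bl (diagonal m n' r d) = diagonal (Suc m) n (Suc r) ?d"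
      unfolding diagonal_def n by (intro eq_matI) (auto split: nat.splits)
    ultimately have "equivalent_mats (Suc m) n B (diagonal (Suc m) n (Suc r) ?d)"
      using equivalent_mats_block[OF rd(4), of "B $$ (0,0)"] n by simp
    with B(1) have "equivalent_mats (Suc m) n A (diagonal (Suc m) n (Suc r) ?d)"
      by (rule equivalent_mats_trans)
    moreover have "\<forall>i<Suc r. ?d i \<noteq> 0" using rd B by (auto split: nat.splits)
    ultimately show ?thesis using rd n by blast
  qed
qed

section \<open>Scalar difference equations\<close>

text \<open>This is the operator \<open>p(\<sigma>)\<close> for the unit shift \<open>\<sigma>\<close>: two-sided signals are a module over the
  polynomial ring.\<close>

definition poly_act :: "'a::comm_ring_1 poly \<Rightarrow> (int \<Rightarrow> 'a) \<Rightarrow> int \<Rightarrow> 'a" where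
  "poly_act p s t = (\<Sum>l\<le>degree p. coeff p l * s (t + int l))"

lemma poly_act_upto:
  assumes "degree p \<le> N"
  shows "poly_act p s t = (\<Sum>l\<le>N. coeff p l * s (t + int l))"
  unfolding poly_act_def using assms
  by (intro sum.mono_neutral_left) (auto simp: coeff_eq_0)

lemma poly_act_0 [simp]: "poly_act 0 s = (\<lambda>t. 0)"
  by (simp add: poly_act_def fun_eq_iff)

lemma poly_act_zero [simp]: "poly_act p (\<lambda>t. 0) = (\<lambda>t. 0)"
  by (simp add: poly_act_def fun_eq_iff)

lemma poly_act_pCons: "poly_act (pCons a p) s t = a * s t + poly_act p s (t + 1)"
proof -
  have "poly_act (pCons a p) s t = (\<Sum>l\<le>Suc (degree p). coeff (pCons a p) l * s (t + int l))"
    by (rule poly_act_upto) (rule degree_pCons_le)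
  also have "\<dots> = a * s t + (\<Sum>l\<le>degree p. coeff p l * s (t + 1 + int l))"
    by (subst sum.atMost_Suc_shift) (simp add: add.assoc)
  finally show ?thesis by (simp add: poly_act_def)
qed

lemma poly_act_const: "poly_act [:a:] s = (\<lambda>t. a * s t)"
  by (simp add: poly_act_pCons fun_eq_iff)

lemma poly_act_1 [simp]: "poly_act 1 s = s"
  using poly_act_const[of 1 s] by (simp add: one_pCons)

lemma poly_act_add: "poly_act (p + q) s t = poly_act p s t + poly_act q s t"
proof -
  define N where "N = max (degree p) (degree q)"
  have "degree p \<le> N" "degree q \<le> N" "degree (p + q) \<le> N"
    using degree_add_le_max[of p q] by (auto simp: N_def)
  then show ?thesis by (simp add: poly_act_upto sum.distrib algebra_simps)
qed

lemma poly_act_uminus: "poly_act (- p) s t = - poly_act p s t"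
  by (simp add: poly_act_def sum_negf)

lemma poly_act_diff: "poly_act (p - q) s t = poly_act p s t - poly_act q s t"
  using poly_act_add[of p "- q" s t] by (simp add: poly_act_uminus)

lemma poly_act_sum_poly: "poly_act (\<Sum>j\<in>J. p j) s t = (\<Sum>j\<in>J. poly_act (p j) s t)"
  by (induction J rule: infinite_finite_induct) (auto simp: poly_act_add)

lemma poly_act_plus: "poly_act p (\<lambda>t. s t + s' t) t = poly_act p s t + poly_act p s' t"
  by (simp add: poly_act_def sum.distrib algebra_simps)

lemma poly_act_minus: "poly_act p (\<lambda>t. s t - s' t) t = poly_act p s t - poly_act p s' t"
  by (simp add: poly_act_def sum_subtractf algebra_simps)

lemma poly_act_scale: "poly_act p (\<lambda>t. c * s t) t = c * poly_act p s t"
  by (simp add: poly_act_def sum_distrib_left mult_ac)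

lemma poly_act_sum: "poly_act p (\<lambda>t. \<Sum>j\<in>J. s j t) t = (\<Sum>j\<in>J. poly_act p (s j) t)"
  by (induction J rule: infinite_finite_induct) (auto simp: poly_act_plus)

lemma poly_act_mult: "poly_act (p * q) s t = poly_act p (poly_act q s) t"
proof (induction p arbitrary: t)
  case (pCons a p)
  have "poly_act (Polynomial.smult a q) s t = a * poly_act q s t"
    by (rule poly_act_upto[OF degree_smult_le, THEN trans])
       (simp add: poly_act_def sum_distrib_left mult_ac)
  moreover have "poly_act (pCons 0 (p * q)) s t = poly_act (p * q) s (t + 1)"
    by (simp add: poly_act_pCons)
  ultimately show ?case
    using pCons by (simp add: poly_act_add poly_act_pCons)
qed simp

lemma poly_act_time: "poly_act p (\<lambda>t. s (t + \<tau>)) t = poly_act p s (t + \<tau>)"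
  unfolding poly_act_def by (intro sum.cong refl arg_cong2[where f = "(*)"] arg_cong[where f = s]) auto

lemma filterlim_int_shift: "filterlim (\<lambda>t. t + c) at_top (at_top :: int filter)"
  unfolding filterlim_at_top eventually_at_top_linorder
proof
  fix Z :: int
  show "\<exists>N. \<forall>n\<ge>N. Z \<le> n + c" by (rule exI[of _ "Z - c"]) auto
qed

lemma poly_act_tendsto_0:
  fixes s :: "int \<Rightarrow> 'a::real_normed_field"
  assumes "(s \<longlongrightarrow> 0) at_top"
  shows "(poly_act p s \<longlongrightarrow> 0) at_top"
proof -
  have "((\<lambda>t. \<Sum>l\<le>degree p. coeff p l * s (t + int l)) \<longlongrightarrow> (\<Sum>l\<le>degree p. coeff p l * 0)) at_top"
    by (intro tendsto_intros filterlim_compose[OF assms filterlim_int_shift])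
  then show ?thesis unfolding poly_act_def[abs_def] by simp
qed

text \<open>Course-of-values recursion for a functional that is only known to depend on earlier values.\<close>

lemma recursion_exists:
  fixes F :: "(nat \<Rightarrow> 'a) \<Rightarrow> nat \<Rightarrow> 'a"
  assumes "\<And>u v n. (\<And>k. k < n \<Longrightarrow> u k = v k) \<Longrightarrow> F u n = F v n"
  shows "\<exists>u. \<forall>n. u n = F u n"
proof -
  define u where "u = wfrec less_than (\<lambda>f n. F f n)"
  have "u n = F u n" for n
  proof -
    have "u n = F (cut u less_than n) n"
      unfolding u_def by (subst wfrec) (auto simp: cut_def)
    also have "\<dots> = F u n" by (rule assms) (simp add: cut_def)
    finally show ?thesis .
  qed
  then show ?thesis by blast
qed

text \<open>The leading coefficient expresses the next value of the solution by earlier ones, so a solution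
  can be computed forward from rest.\<close>

lemma poly_act_solve_forward:
  fixes p :: "'a::field poly"
  assumes "p \<noteq> 0" "\<And>t. t < \<tau> \<Longrightarrow> y t = 0"
  shows "\<exists>z. poly_act p z = y \<and> (\<forall>t<\<tau>. z t = 0)"
proof -
  let ?D = "degree p"
  define F where "F = (\<lambda>u n. if n < ?D then 0
      else (y (\<tau> + int (n - ?D)) - (\<Sum>l<?D. coeff p l * u (n - ?D + l))) / lead_coeff p)"
  have "\<exists>u. \<forall>n. u n = F u n"
    by (rule recursion_exists) (auto simp: F_def intro!: sum.cong)
  then obtain u where u: "\<And>n. u n = F u n" by blast
  define z where "z = (\<lambda>t. if t < \<tau> then 0 else u (nat (t - \<tau>)))"
  have lc: "lead_coeff p \<noteq> 0" using assms by simp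
  have zD: "z t = 0" if "t < \<tau> + int ?D" for t
    using that u[of "nat (t - \<tau>)"] by (auto simp: z_def F_def)
  have "poly_act p z t = y t" for t
  proof (cases "t < \<tau>")
    case True
    then show ?thesis using assms zD unfolding poly_act_def by (auto intro!: sum.neutral)
  next
    case False
    define n where "n = nat (t - \<tau>)"
    have t: "t = \<tau> + int n" using False by (simp add: n_def)
    have zu: "z (t + int l) = u (n + l)" for l by (simp add: z_def t nat_add_distrib)
    have "poly_act p z t = (\<Sum>l<?D. coeff p l * u (n + l)) + lead_coeff p * u (n + ?D)"
      unfolding poly_act_def zu by (simp add: lessThan_Suc_atMost[symmetric])
    also have "u (n + ?D) = (y t - (\<Sum>l<?D. coeff p l * u (n + l))) / lead_coeff p"
      using u[of "n + ?D"] by (simp add: F_def t)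
    finally show ?thesis using lc by simp
  qed
  then show ?thesis by (intro exI[of _ z]) (auto simp: z_def)
qed

text \<open>Time reversal turns a polynomial into its reflection, up to a delay by the degree.\<close>

lemma poly_act_reflect:
  "poly_act p s t = poly_act (reflect_poly p) (\<lambda>t. s (- t)) (- t - int (degree p))"
proof -
  have "poly_act (reflect_poly p) (\<lambda>t. s (- t)) (- t - int (degree p)) =
     (\<Sum>l\<le>degree p. coeff p (degree p - l) * s (t + int (degree p) - int l))"
    by (subst poly_act_upto[OF degree_reflect_poly_le])
       (auto intro!: sum.cong simp: coeff_reflect_poly algebra_simps)
  also have "\<dots> = (\<Sum>l\<le>degree p. coeff p l * s (t + int l))"
    by (rule sum.reindex_bij_witness[of _ "\<lambda>l. degree p - l" "\<lambda>l. degree p - l"])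
       (auto simp: of_nat_diff algebra_simps)
  finally show ?thesis by (simp add: poly_act_def)
qed

lemma poly_act_solve_backward:
  fixes p :: "'a::field poly"
  assumes "p \<noteq> 0" "\<And>t. t \<ge> \<tau> \<Longrightarrow> y t = 0"
  shows "\<exists>z. poly_act p z = y \<and> (\<forall>t\<ge>\<tau> + int (degree p). z t = 0)"
proof -
  let ?D = "int (degree p)"
  have "reflect_poly p \<noteq> 0" using assms by simp
  moreover have "y (- t - ?D) = 0" if "t < 1 - \<tau> - ?D" for t using assms(2) that by simp
  ultimately obtain z where z: "poly_act (reflect_poly p) z = (\<lambda>t. y (- t - ?D))"
     "\<forall>t<1 - \<tau> - ?D. z t = 0"
    using poly_act_solve_forward[of "reflect_poly p" "1 - \<tau> - ?D" "\<lambda>t. y (- t - ?D)"] by blast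
  have "poly_act p (\<lambda>t. z (- t)) t = y t" for t
    by (subst poly_act_reflect) (simp add: z(1))
  then show ?thesis using z(2) by (intro exI[of _ "\<lambda>t. z (- t)"]) (auto simp: fun_eq_iff)
qed

text \<open>Scalar signals form a divisible module: the part of the right-hand side before time 0 is
  handled by backward recursion, the rest by forward recursion.  All solvability statements about
  matrices rest on this.\<close>

lemma poly_act_surj:
  fixes p :: "'a::field poly"
  assumes "p \<noteq> 0"
  shows "\<exists>z. poly_act p z = y"
proof -
  obtain z1 where z1: "poly_act p z1 = (\<lambda>t. if t < 0 then 0 else y t)"
    using poly_act_solve_forward[OF assms, of 0 "\<lambda>t. if t < 0 then 0 else y t"] by auto
  obtain z2 where z2: "poly_act p z2 = (\<lambda>t. if t < 0 then y t else 0)"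
    using poly_act_solve_backward[OF assms, of 0 "\<lambda>t. if t < 0 then y t else 0"] by auto
  have "poly_act p (\<lambda>t. z1 t + z2 t) = y"
    by (simp add: fun_eq_iff poly_act_plus z1 z2)
  then show ?thesis by blast
qed

lemma poly_act_eq_zero:
  assumes "poly_act p = (\<lambda>s t. 0)"
  shows "p = 0"
proof (rule poly_eqI)
  fix l
  have "0 = poly_act p (\<lambda>t. if t = int l then 1 else 0) 0" by (simp add: assms)
  also have "\<dots> = (\<Sum>k\<le>max l (degree p). coeff p k * (if k = l then 1 else 0))"
    by (subst poly_act_upto[of p "max l (degree p)"]) (auto intro!: sum.cong)
  also have "\<dots> = coeff p l" by (simp add: if_distrib sum.delta cong: if_cong)
  finally show "coeff p l = coeff 0 l" by simp
qed

text \<open>The leading coefficient determines each value from the preceding ones, so a solution that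
  vanishes in the past vanishes.\<close>

lemma poly_act_autonomous:
  fixes p :: "'a::field poly"
  assumes p: "p \<noteq> 0" "poly_act p s = (\<lambda>t. 0)" and s: "\<And>t. t \<le> T \<Longrightarrow> s t = 0"
  shows "s t = 0"
proof -
  have "s (T + int n) = 0" for n
  proof (induction n rule: less_induct)
    case (less n)
    show ?case
    proof (cases "n = 0")
      case False
      have before: "s t = 0" if "t < T + int n" for t
        using that less.IH[of "nat (t - T)"] s[of t] by (cases "t \<le> T") auto
      define t where "t = T + int n - int (degree p)"
      have "0 = poly_act p s t" using p by simp
      also have "\<dots> = (\<Sum>l<degree p. coeff p l * s (t + int l)) + lead_coeff p * s (T + int n)"
        unfolding poly_act_def by (simp add: lessThan_Suc_atMost[symmetric] t_def)
      also have "(\<Sum>l<degree p. coeff p l * s (t + int l)) = 0"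
        by (intro sum.neutral) (auto simp: t_def before)
      finally show ?thesis using p by simp
    qed (simp add: s)
  qed
  from this[of "nat (t - T)"] show ?thesis using s[of t] by (cases "t \<le> T") auto
qed

text \<open>On the two-sided time axis a root at 0 contributes no solution, so this is Schur stability.\<close>

definition stable_poly :: "real poly \<Rightarrow> bool" where
  "stable_poly p \<longleftrightarrow> (\<forall>s. poly_act p s = (\<lambda>t. 0) \<longrightarrow> (s \<longlongrightarrow> 0) at_top)"

lemma first_order_tendsto_0:
  fixes u :: "int \<Rightarrow> 'a::real_normed_field"
  assumes a: "norm a < 1" and e: "((\<lambda>t. u (t + 1) - a * u t) \<longlongrightarrow> 0) at_top"
  shows "(u \<longlongrightarrow> 0) at_top"
proof (rule tendstoI)
  fix \<epsilon> :: real assume \<epsilon>: "\<epsilon> > 0"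
  define \<delta> where "\<delta> = \<epsilon> / 2 * (1 - norm a)"
  have \<delta>: "\<delta> > 0" using \<epsilon> a by (simp add: \<delta>_def)
  obtain T where T: "\<And>t. t \<ge> T \<Longrightarrow> norm (u (t + 1) - a * u t) < \<delta>"
    using tendstoD[OF e \<delta>] by (auto simp: eventually_at_top_linorder)
  have ring: "e / 2 * (1 - x) + x * (y * w + e / 2) = x * y * w + e / 2" for e x y w :: real
    by (simp add: right_diff_distrib distrib_left)
  have bound: "norm (u (T + int n)) \<le> norm a ^ n * norm (u T) + \<epsilon> / 2" for n
  proof (induction n)
    case (Suc n)
    let ?t = "T + int n"
    have "norm (u (?t + 1)) \<le> norm (u (?t + 1) - a * u ?t) + norm (a * u ?t)"
      by (metis diff_add_cancel norm_triangle_ineq)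
    also have "\<dots> \<le> \<delta> + norm a * (norm a ^ n * norm (u T) + \<epsilon> / 2)"
    proof (rule add_mono)
      show "norm (u (?t + 1) - a * u ?t) \<le> \<delta>" using T[of ?t] by simp
      show "norm (a * u ?t) \<le> norm a * (norm a ^ n * norm (u T) + \<epsilon> / 2)"
        unfolding norm_mult using Suc by (rule mult_left_mono) simp
    qed
    also have "\<dots> = norm a ^ Suc n * norm (u T) + \<epsilon> / 2"
      unfolding \<delta>_def power_Suc by (rule ring)
    finally show ?case by (simp add: add_ac)
  qed (use \<epsilon> in auto)
  have "(\<lambda>n. norm a ^ n * norm (u T)) \<longlonglongrightarrow> 0"
    by (intro tendsto_mult_left_zero LIMSEQ_power_zero) (use a in auto)
  then obtain N where N: "\<And>n. n \<ge> N \<Longrightarrow> \<bar>norm a ^ n * norm (u T)\<bar> < \<epsilon> / 2"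
    using LIMSEQ_D[of _ 0 "\<epsilon> / 2"] \<epsilon> by (metis diff_zero half_gt_zero real_norm_def)
  have "dist (u t) 0 < \<epsilon>" if t: "t \<ge> T + int N" for t
  proof -
    obtain n where n: "t = T + int n" "n \<ge> N"
      using that[of "nat (t - T)"] t by auto
    show ?thesis unfolding n(1) using bound[of n] N[OF n(2)] by simp
  qed
  then show "\<forall>\<^sub>F t in at_top. dist (u t) 0 < \<epsilon>"
    unfolding eventually_at_top_linorder by blast
qed

text \<open>Over the complex numbers the polynomial is a product of linear factors, each of which is a
  contracting first-order filter.\<close>

lemma contracting_roots_tendsto_0:
  fixes p :: "complex poly"
  assumes "p \<noteq> 0" "\<And>z. poly p z = 0 \<Longrightarrow> norm z < 1" "(poly_act p v \<longlongrightarrow> 0) at_top"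
  shows "(v \<longlongrightarrow> 0) at_top"
  using assms
proof (induction "degree p" arbitrary: p)
  case 0
  then obtain a where a: "p = [:a:]" "a \<noteq> 0" by (metis degree_eq_zeroE pCons_0_0)
  have "((\<lambda>t. (a * v t) * inverse a) \<longlongrightarrow> 0 * inverse a) at_top"
    using 0 unfolding a poly_act_const by (intro tendsto_intros) auto
  then show ?case using a by (simp add: field_simps)
next
  case (Suc n)
  have "\<not> constant (poly p)" using Suc.hyps(2) by (simp add: constant_degree)
  then obtain z where z: "poly p z = 0" using fundamental_theorem_of_algebra by blast
  then obtain r where r: "p = [:- z, 1:] * r" by (metis poly_eq_0_iff_dvd dvdE)
  have "r \<noteq> 0" using Suc.prems r by auto
  moreover have "n = degree r" using Suc.hyps(2) \<open>r \<noteq> 0\<close> unfolding r by (subst (asm) degree_mult_eq) auto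
  moreover have "poly r w = 0 \<Longrightarrow> norm w < 1" for w using Suc.prems(2) unfolding r by simp
  moreover have "(poly_act r v \<longlongrightarrow> 0) at_top"
  proof (rule first_order_tendsto_0)
    show "norm z < 1" using Suc.prems z by blast
    have "poly_act p v t = poly_act r v (t + 1) - z * poly_act r v t" for t
      unfolding r poly_act_mult by (simp add: poly_act_pCons)
    then have "(\<lambda>t. poly_act r v (t + 1) - z * poly_act r v t) = poly_act p v" by auto
    then show "((\<lambda>t. poly_act r v (t + 1) - z * poly_act r v t) \<longlongrightarrow> 0) at_top"
      using Suc.prems by simp
  qed
  ultimately show ?case using Suc.hyps(1) by blast
qed

lemma poly_act_complex:
  "poly_act (map_poly complex_of_real p) s t =
     Complex (poly_act p (\<lambda>t. Re (s t)) t) (poly_act p (\<lambda>t. Im (s t)) t)"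
  by (subst poly_act_upto[of _ "degree p"])
     (auto simp: degree_map_poly coeff_map_poly poly_act_def complex_eq_iff)

text \<open>A root \<open>z \<noteq> 0\<close> yields the solution \<open>z\<^sup>t\<close>, whose real and imaginary parts are real solutions.\<close>

lemma stable_poly_roots:
  assumes "stable_poly p" "poly (map_poly complex_of_real p) z = 0"
  shows "norm z < 1"
proof (rule ccontr)
  assume z: "\<not> norm z < 1"
  then have z0: "z \<noteq> 0" by auto
  let ?p = "map_poly complex_of_real p"
  define s where "s = (\<lambda>t. z powi t)"
  have "poly_act ?p s t = z powi t * poly ?p z" for t
    unfolding poly_act_def poly_altdef s_def sum_distrib_left using z0
    by (intro sum.cong) (auto simp: power_int_add)
  then have "Complex (poly_act p (\<lambda>t. Re (s t)) t) (poly_act p (\<lambda>t. Im (s t)) t) = 0" for t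
    using assms(2) by (simp add: poly_act_complex)
  then have "poly_act p (\<lambda>t. Re (s t)) = (\<lambda>t. 0)" "poly_act p (\<lambda>t. Im (s t)) = (\<lambda>t. 0)"
    by (auto simp: complex_eq_iff)
  then have "((\<lambda>t. Re (s t)) \<longlongrightarrow> 0) at_top" "((\<lambda>t. Im (s t)) \<longlongrightarrow> 0) at_top"
    using assms(1) unfolding stable_poly_def by blast+
  then have "(s \<longlongrightarrow> 0) at_top" by (simp add: tendsto_complex_iff)
  then obtain T where T: "\<And>t. t \<ge> T \<Longrightarrow> norm (s t) < 1"
    using tendstoD[of s 0 at_top 1] by (auto simp: eventually_at_top_linorder)
  have "norm (s (max T 0)) = norm z ^ nat (max T 0)"
    by (simp add: s_def power_int_def norm_power)
  moreover have "1 \<le> norm z ^ nat (max T 0)" using z by (intro one_le_power) auto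
  ultimately show False using T[of "max T 0"] by simp
qed

lemma stable_poly_filter:
  assumes p: "stable_poly p" "p \<noteq> 0" and v: "(poly_act p v \<longlongrightarrow> 0) at_top"
  shows "(v \<longlongrightarrow> 0) at_top"
proof -
  let ?p = "map_poly complex_of_real p" and ?v = "\<lambda>t. complex_of_real (v t)"
  have "poly_act ?p ?v = (\<lambda>t. complex_of_real (poly_act p v t))"
    by (simp add: fun_eq_iff poly_act_complex complex_eq_iff)
  then have "(poly_act ?p ?v \<longlongrightarrow> 0) at_top"
    using tendsto_of_real[OF v, where 'a = complex] by simp
  moreover have "?p \<noteq> 0" using p(2) by (simp add: map_poly_eq_0_iff)
  ultimately have "(?v \<longlongrightarrow> complex_of_real 0) at_top"
    using contracting_roots_tendsto_0[of ?p ?v] stable_poly_roots[OF p(1)] by simp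
  then show ?thesis by (rule tendsto_of_real_iff[THEN iffD1])
qed

lemma stable_poly_at_1:
  assumes "stable_poly p"
  shows "poly p 1 \<noteq> 0"
proof
  assume "poly p 1 = 0"
  then have "poly_act p (\<lambda>t. 1) = (\<lambda>t. 0)"
    by (simp add: poly_act_def fun_eq_iff poly_altdef)
  then have "((\<lambda>t::int. 1::real) \<longlongrightarrow> 0) at_top" using assms unfolding stable_poly_def by blast
  then show False by (simp add: tendsto_const_iff)
qed

section \<open>Difference operators on trajectories\<close>

definition act :: "real poly mat \<Rightarrow> trajectory \<Rightarrow> trajectory" where
  "act A w = (\<lambda>t i. if i < dim_row A
     then \<Sum>j<dim_col A. poly_act (A $$ (i, j)) (\<lambda>t. w t j) t else 0)"

definition kernel_behavior :: "nat \<Rightarrow> real poly mat \<Rightarrow> trajectory set" where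
  "kernel_behavior n A = {w \<in> trajectories n. act A w = (\<lambda>t i. 0)}"

definition onto :: "nat \<Rightarrow> nat \<Rightarrow> real poly mat \<Rightarrow> bool" where
  "onto m n A \<longleftrightarrow> (\<forall>y\<in>trajectories m. \<exists>w\<in>trajectories n. act A w = y)"

lemma trajectories_iff: "w \<in> trajectories n \<longleftrightarrow> (\<forall>t i. n \<le> i \<longrightarrow> w t i = 0)"
  by (auto simp: trajectories_def)

lemma trajectories_zero [simp]: "(\<lambda>t i. 0) \<in> trajectories n"
  by (simp add: trajectories_iff)

lemma trajectories_add:
  "v \<in> trajectories n \<Longrightarrow> w \<in> trajectories n \<Longrightarrow> (\<lambda>t i. v t i + w t i) \<in> trajectories n"
  by (simp add: trajectories_iff)

lemma trajectories_diff:
  "v \<in> trajectories n \<Longrightarrow> w \<in> trajectories n \<Longrightarrow> (\<lambda>t i. v t i - w t i) \<in> trajectories n"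
  by (simp add: trajectories_iff)

lemma trajectories_scale: "w \<in> trajectories n \<Longrightarrow> (\<lambda>t i. \<alpha> * w t i) \<in> trajectories n"
  by (simp add: trajectories_iff)

lemma trajectories_shift: "w \<in> trajectories n \<Longrightarrow> time_shift \<tau> w \<in> trajectories n"
  by (simp add: trajectories_iff time_shift_def)

lemma act_trajectories [simp]: "A \<in> carrier_mat m n \<Longrightarrow> act A w \<in> trajectories m"
  by (auto simp: trajectories_iff act_def)

lemma act_add: "act A (\<lambda>t i. v t i + w t i) = (\<lambda>t i. act A v t i + act A w t i)"
  by (simp add: act_def fun_eq_iff poly_act_plus sum.distrib)

lemma act_diff: "act A (\<lambda>t i. v t i - w t i) = (\<lambda>t i. act A v t i - act A w t i)"
  by (simp add: act_def fun_eq_iff poly_act_minus sum_subtractf)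

lemma act_scale: "act A (\<lambda>t i. \<alpha> * w t i) = (\<lambda>t i. \<alpha> * act A w t i)"
  by (simp add: act_def fun_eq_iff poly_act_scale sum_distrib_left)

lemma act_zero [simp]: "act A (\<lambda>t i. 0) = (\<lambda>t i. 0)"
  by (simp add: act_def fun_eq_iff)

lemma act_shift: "act A (time_shift \<tau> w) = time_shift \<tau> (act A w)"
proof (intro ext)
  fix t i
  have "poly_act (A $$ (i, j)) (\<lambda>t. time_shift \<tau> w t j) t
      = poly_act (A $$ (i, j)) (\<lambda>t. w t j) (t + \<tau>)" for j
    unfolding time_shift_def by (rule poly_act_time)
  then show "act A (time_shift \<tau> w) t i = time_shift \<tau> (act A w) t i"
    by (simp add: act_def time_shift_def)
qed

lemma act_mult:
  assumes "A \<in> carrier_mat m n" "B \<in> carrier_mat n p"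
  shows "act (A * B) w = act A (act B w)"
proof (intro ext)
  fix t i
  show "act (A * B) w t i = act A (act B w) t i"
  proof (cases "i < m")
    case True
    have "act (A * B) w t i = (\<Sum>j<p. poly_act (\<Sum>k<n. A $$ (i, k) * B $$ (k, j)) (\<lambda>t. w t j) t)"
      using assms True by (simp add: act_def scalar_prod_def lessThan_atLeast0)
    also have "\<dots> = (\<Sum>j<p. \<Sum>k<n. poly_act (A $$ (i, k)) (poly_act (B $$ (k, j)) (\<lambda>t. w t j)) t)"
      by (simp add: poly_act_sum_poly poly_act_mult)
    also have "\<dots> = (\<Sum>k<n. \<Sum>j<p. poly_act (A $$ (i, k)) (poly_act (B $$ (k, j)) (\<lambda>t. w t j)) t)"
      by (rule sum.swap)
    also have "\<dots> = (\<Sum>k<n. poly_act (A $$ (i, k)) (\<lambda>t. \<Sum>j<p. poly_act (B $$ (k, j)) (\<lambda>t. w t j) t) t)"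
      by (simp add: poly_act_sum)
    also have "\<dots> = act A (act B w) t i"
      using assms True by (auto simp: act_def intro!: sum.cong)
    finally show ?thesis .
  qed (use assms in \<open>simp add: act_def\<close>)
qed

lemma act_diagonal:
  assumes "r \<le> m" "r \<le> n"
  shows "act (diagonal m n r d) w = (\<lambda>t i. if i < r then poly_act (d i) (\<lambda>t. w t i) t else 0)"
proof (intro ext)
  fix t i
  show "act (diagonal m n r d) w t i = (if i < r then poly_act (d i) (\<lambda>t. w t i) t else 0)"
  proof (cases "i < m")
    case True
    have "act (diagonal m n r d) w t i = (\<Sum>j<n. poly_act (diagonal m n r d $$ (i, j)) (\<lambda>t. w t j) t)"
      using True by (simp add: act_def diagonal_def)
    also have "\<dots> = (\<Sum>j<n. if j = i then if i < r then poly_act (d i) (\<lambda>t. w t i) t else 0 else 0)"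
      by (rule sum.cong) (use True in \<open>auto simp: diagonal_def\<close>)
    finally show ?thesis using True assms by simp
  qed (use assms in \<open>simp add: act_def diagonal_def\<close>)
qed

lemma act_one: "w \<in> trajectories n \<Longrightarrow> act (1\<^sub>m n) w = w"
proof -
  assume w: "w \<in> trajectories n"
  have "1\<^sub>m n = diagonal n n n (\<lambda>_. 1 :: real poly)" by (auto simp: diagonal_def)
  then show ?thesis using w by (auto simp: act_diagonal fun_eq_iff trajectories_iff)
qed

lemma act_inverse:
  assumes "mutually_inverse n U U'" "w \<in> trajectories n"
  shows "act U (act U' w) = w" "act U' (act U w) = w"
  using assms act_mult[of U n n U' n w] act_mult[of U' n n U n w] act_one[of w n]
  by (auto simp: mutually_inverse_def)

lemma act_inverse_eq:
  assumes "mutually_inverse n U U'" "v \<in> trajectories n" "w \<in> trajectories n"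
  shows "act U v = act U w \<longleftrightarrow> v = w"
  using act_inverse(2)[OF assms(1,2)] act_inverse(2)[OF assms(1,3)] by metis

text \<open>A difference operator looks ahead by a bounded number of steps.  Hence agreement of two
  trajectories on a future half-line is preserved, and agreement on a past half-line is shortened by
  that number.\<close>

lemma act_cong_window:
  "\<exists>N\<ge>0. \<forall>v w t. (\<forall>s\<in>{t..t + N}. v s = w s) \<longrightarrow> act A v t = act A w t"
proof -
  define N where "N = (\<Sum>i<dim_row A. \<Sum>j<dim_col A. degree (A $$ (i, j)))"
  have N: "degree (A $$ (i, j)) \<le> N" if "i < dim_row A" "j < dim_col A" for i j
  proof -
    have "degree (A $$ (i, j)) \<le> (\<Sum>j<dim_col A. degree (A $$ (i, j)))"
      using that by (intro member_le_sum) auto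
    also have "\<dots> \<le> N" unfolding N_def
      using that by (intro member_le_sum[of i _ "\<lambda>i. \<Sum>j<dim_col A. degree (A $$ (i, j))"]) auto
    finally show ?thesis .
  qed
  have "act A v t = act A w t" if eq: "\<forall>s\<in>{t..t + int N}. v s = w s" for v w t
  proof (rule ext)
    fix i
    have "poly_act (A $$ (i, j)) (\<lambda>t. v t j) t = poly_act (A $$ (i, j)) (\<lambda>t. w t j) t"
      if "i < dim_row A" "j < dim_col A" for j
      unfolding poly_act_def using eq N[OF that] by (intro sum.cong) auto
    then show "act A v t i = act A w t i" by (auto simp: act_def intro!: sum.cong)
  qed
  then show ?thesis by (intro exI[of _ "int N"]) auto
qed

lemma act_cong_after:
  assumes "\<And>t. t \<ge> T \<Longrightarrow> v t = w t" "t \<ge> T"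
  shows "act A v t = act A w t"
  using act_cong_window[of A] assms by auto

lemma act_cong_before:
  "\<exists>N\<ge>0. \<forall>T v w. (\<forall>t\<le>T. v t = w t) \<longrightarrow> (\<forall>t\<le>T - N. act A v t = act A w t)"
proof -
  obtain N where "N \<ge> 0" and
    N: "\<And>v w t. \<forall>s\<in>{t..t + N}. v s = w s \<Longrightarrow> act A v t = act A w t"
    using act_cong_window by blast
  have "act A v t = act A w t" if "\<forall>t\<le>T. v t = w t" "t \<le> T - N" for T v w t
    using that by (intro N) auto
  then show ?thesis using \<open>N \<ge> 0\<close> by blast
qed

lemma tendsto_fun_iff:
  fixes f :: "'b \<Rightarrow> 'i \<Rightarrow> 'a::topological_space"
  shows "(f \<longlongrightarrow> l) F \<longleftrightarrow> (\<forall>i. ((\<lambda>t. f t i) \<longlongrightarrow> l i) F)"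
proof -
  have "limitin (product_topology (\<lambda>_. euclidean) UNIV) f l F \<longleftrightarrow>
      (\<forall>i. limitin euclidean (\<lambda>t. f t i) (l i) F)"
    by (subst limitin_componentwise) (auto simp: extensional_def)
  then show ?thesis unfolding euclidean_product_topology by simp
qed

lemma act_tendsto_0:
  assumes "(w \<longlongrightarrow> (\<lambda>i. 0)) at_top"
  shows "(act A w \<longlongrightarrow> (\<lambda>i. 0)) at_top"
proof (unfold tendsto_fun_iff, rule allI)
  fix i
  have "((\<lambda>t. \<Sum>j<dim_col A. poly_act (A $$ (i, j)) (\<lambda>t. w t j) t) \<longlongrightarrow> (\<Sum>j<dim_col A. 0)) at_top"
    using assms[unfolded tendsto_fun_iff] by (intro tendsto_sum poly_act_tendsto_0) auto
  then show "((\<lambda>t. act A w t i) \<longlongrightarrow> 0) at_top"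
    by (cases "i < dim_row A") (simp_all add: act_def)
qed

lemma tendsto_eventually_eq_int:
  fixes f g :: "int \<Rightarrow> 'a::topological_space"
  assumes "\<And>t. t \<ge> T \<Longrightarrow> f t = g t" "(g \<longlongrightarrow> l) at_top"
  shows "(f \<longlongrightarrow> l) at_top"
proof (rule Lim_transform_eventually[OF assms(2)])
  show "\<forall>\<^sub>F t in at_top. g t = f t"
    unfolding eventually_at_top_linorder using assms(1) by metis
qed

text \<open>The diagonal form at the level of trajectories.  The first equation serves to construct solutions in
  the new coordinates, the second one to analyse given trajectories.\<close>

lemma diagonal_form:
  fixes A :: "real poly mat"
  assumes A: "A \<in> carrier_mat m n"
  obtains U U' V V' r d where "mutually_inverse m U U'" "mutually_inverse n V V'"
    "r \<le> m" "r \<le> n" "\<And>i. i < r \<Longrightarrow> d i \<noteq> 0"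
    "\<And>w. act U (act A (act V w)) = (\<lambda>t i. if i < r then poly_act (d i) (\<lambda>t. w t i) t else 0)"
    "\<And>w. w \<in> trajectories n \<Longrightarrow>
       act U (act A w) = (\<lambda>t i. if i < r then poly_act (d i) (\<lambda>t. act V' w t i) t else 0)"
proof -
  obtain r d where r: "r \<le> m" "r \<le> n" and d: "\<forall>i<r. d i \<noteq> 0" and "equivalent_mats m n A (diagonal m n r d)"
    using equivalent_to_diagonal[OF A] by blast
  then obtain U U' V V' where UV: "mutually_inverse m U U'" "mutually_inverse n V V'"
     "diagonal m n r d = U * A * V"
    unfolding equivalent_mats_def by blast
  have c: "U \<in> carrier_mat m m" "V \<in> carrier_mat n n"
    using UV by (auto simp: mutually_inverse_def)
  have "act (U * A * V) w = act U (act A (act V w))" for w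
    using act_mult[OF mult_carrier_mat[OF c(1) A] c(2)] act_mult[OF c(1) A] by simp
  then have 1: "act U (act A (act V w)) = (\<lambda>t i. if i < r then poly_act (d i) (\<lambda>t. w t i) t else 0)" for w
    using act_diagonal[OF r, of d w] UV(3) by simp
  have "act U (act A w) = (\<lambda>t i. if i < r then poly_act (d i) (\<lambda>t. act V' w t i) t else 0)"
    if "w \<in> trajectories n" for w
    using 1[of "act V' w"] act_inverse(1)[OF UV(2) that] by simp
  with 1 show thesis using that UV r d by blast
qed

section \<open>Kernel representations\<close>

definition translate :: "trajectory \<Rightarrow> trajectory set \<Rightarrow> trajectory set" where
  "translate w0 W = (\<lambda>w t i. w0 t i + w t i) ` W"

lemma mem_translate: "w \<in> translate w0 W \<longleftrightarrow> (\<lambda>t i. w t i - w0 t i) \<in> W"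
proof
  assume "(\<lambda>t i. w t i - w0 t i) \<in> W"
  then show "w \<in> translate w0 W"
    unfolding translate_def by (intro image_eqI[of _ _ "\<lambda>t i. w t i - w0 t i"]) auto
qed (auto simp: translate_def)

lemma kernelD: "w \<in> kernel_behavior n A \<Longrightarrow> w \<in> trajectories n" "w \<in> kernel_behavior n A \<Longrightarrow> act A w = (\<lambda>t i. 0)"
  by (auto simp: kernel_behavior_def)

lemma kernel_zero [simp]: "(\<lambda>t i. 0) \<in> kernel_behavior n A"
  by (simp add: kernel_behavior_def)

lemma kernel_add: "v \<in> kernel_behavior n A \<Longrightarrow> w \<in> kernel_behavior n A \<Longrightarrow> (\<lambda>t i. v t i + w t i) \<in> kernel_behavior n A"
  by (simp add: kernel_behavior_def trajectories_add act_add)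

lemma kernel_diff: "v \<in> kernel_behavior n A \<Longrightarrow> w \<in> kernel_behavior n A \<Longrightarrow> (\<lambda>t i. v t i - w t i) \<in> kernel_behavior n A"
  by (simp add: kernel_behavior_def trajectories_diff act_diff)

lemma kernel_scale: "w \<in> kernel_behavior n A \<Longrightarrow> (\<lambda>t i. \<alpha> * w t i) \<in> kernel_behavior n A"
  by (simp add: kernel_behavior_def trajectories_scale act_scale)

lemma kernel_shift: "w \<in> kernel_behavior n A \<Longrightarrow> time_shift \<tau> w \<in> kernel_behavior n A"
  by (simp add: kernel_behavior_def trajectories_shift act_shift) (simp add: time_shift_def)

lemma translate_kernel_eq:
  assumes "w1 \<in> translate w0 (kernel_behavior n A)"
  shows "translate w1 (kernel_behavior n A) = translate w0 (kernel_behavior n A)"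
proof (rule Set.set_eqI)
  fix w
  have d: "(\<lambda>t i. w1 t i - w0 t i) \<in> kernel_behavior n A" using assms by (simp add: mem_translate)
  show "w \<in> translate w1 (kernel_behavior n A) \<longleftrightarrow> w \<in> translate w0 (kernel_behavior n A)"
    using kernel_add[OF _ d, of "\<lambda>t i. w t i - w1 t i"] kernel_diff[OF _ d, of "\<lambda>t i. w t i - w0 t i"]
    by (auto simp: mem_translate)
qed

lemma window_eq_iff: "window t (t + L) v = window t (t + L) w \<longleftrightarrow> (\<forall>s\<in>{t..t + L}. v s = w s)"
  by (simp add: window_def)

text \<open>Time-invariance needs the constancy of the offset; completeness holds with the look-ahead of the
  operator as window length.\<close>

lemma affine_behavior_translate:
  assumes A: "A \<in> carrier_mat m n" and w0: "constant_trajectory w0" "w0 \<in> trajectories n"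
  shows "translate w0 (kernel_behavior n A) \<in> affine_behaviors n"
proof -
  let ?B = "translate w0 (kernel_behavior n A)"
  have sub: "?B \<subseteq> trajectories n"
    using w0(2) by (auto simp: translate_def kernel_behavior_def trajectories_add)
  have ne: "w0 \<in> ?B" by (simp add: mem_translate)
  have ti: "time_invariant_behavior ?B"
    unfolding time_invariant_behavior_def
  proof (intro ballI allI)
    fix w \<tau> assume "w \<in> ?B"
    then have "time_shift \<tau> (\<lambda>t i. w t i - w0 t i) \<in> kernel_behavior n A"
      by (intro kernel_shift) (simp add: mem_translate)
    moreover have "time_shift \<tau> (\<lambda>t i. w t i - w0 t i) = (\<lambda>t i. time_shift \<tau> w t i - time_shift \<tau> w0 t i)"
      by (simp add: time_shift_def)
    moreover have "time_shift \<tau> w0 = w0" using w0 by (simp add: constant_trajectory_def)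
    ultimately show "time_shift \<tau> w \<in> ?B" by (simp add: mem_translate)
  qed
  have aff: "affine_closed ?B"
    unfolding affine_closed_def
  proof (intro ballI allI)
    fix w1 w2 \<alpha> assume "w1 \<in> ?B" "w2 \<in> ?B"
    then have "(\<lambda>t i. \<alpha> * (w1 t i - w0 t i) + (1 - \<alpha>) * (w2 t i - w0 t i)) \<in> kernel_behavior n A"
      by (intro kernel_add kernel_scale) (auto simp: mem_translate)
    then show "(\<lambda>t i. \<alpha> * w1 t i + (1 - \<alpha>) * w2 t i) \<in> ?B"
      by (simp add: mem_translate algebra_simps)
  qed
  obtain L where L: "L \<ge> 0" "\<And>v w t. \<forall>s\<in>{t..t + L}. v s = w s \<Longrightarrow> act A v t = act A w t"
    using act_cong_window[of A] by metis
  have "w \<in> ?B" if w: "w \<in> trajectories n" "\<forall>t. window t (t + L) w \<in> window t (t + L) ` ?B" for w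
  proof -
    have "act A (\<lambda>t i. w t i - w0 t i) t = (\<lambda>i. 0)" for t
    proof -
      obtain b where "b \<in> ?B" and b: "\<forall>s\<in>{t..t + L}. w s = b s"
        using w(2) unfolding image_iff window_eq_iff by metis
      then have "act A (\<lambda>t i. b t i - w0 t i) t = (\<lambda>i. 0)"
        by (auto simp: mem_translate kernel_behavior_def)
      moreover have "act A (\<lambda>t i. w t i - w0 t i) t = act A (\<lambda>t i. b t i - w0 t i) t"
        using b by (intro L) auto
      ultimately show ?thesis by simp
    qed
    then show ?thesis using w(1) w0(2) by (auto simp: mem_translate kernel_behavior_def trajectories_diff)
  qed
  then have "complete_behavior n ?B" unfolding complete_behavior_def using L(1) by blast
  then show ?thesis using sub ne ti aff by (auto simp: affine_behaviors_def)
qed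

lemma linear_behavior_kernel:
  assumes "A \<in> carrier_mat m n"
  shows "kernel_behavior n A \<in> linear_behaviors n"
proof -
  have "translate (\<lambda>t i. 0) (kernel_behavior n A) = kernel_behavior n A"
    by (auto simp: mem_translate)
  moreover have "constant_trajectory (\<lambda>t i. 0)"
    by (simp add: constant_trajectory_def time_shift_def)
  ultimately have "kernel_behavior n A \<in> affine_behaviors n"
    using affine_behavior_translate[OF assms, of "\<lambda>t i. 0"] by simp
  then show ?thesis
    by (auto simp: affine_behaviors_def linear_behaviors_def linear_closed_def kernel_add kernel_scale)
qed

text \<open>A subspace of a finite-dimensional coordinate space is a finite intersection of hyperplanes.  In
  the induction a new coordinate either vanishes on the subspace, which is one more hyperplane, or is 1
  on some vector \<open>s\<close>, multiples of which are subtracted to reduce membership to the old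
  coordinates.\<close>

lemma subspace_hyperplanes:
  fixes S :: "('b \<Rightarrow> real) set"
  assumes "finite A"
    "S \<subseteq> {x. \<forall>a. a \<notin> A \<longrightarrow> x a = 0}" "(\<lambda>a. 0) \<in> S"
    "\<And>x y. x \<in> S \<Longrightarrow> y \<in> S \<Longrightarrow> (\<lambda>a. x a + y a) \<in> S"
    "\<And>x c. x \<in> S \<Longrightarrow> (\<lambda>a. c * x a) \<in> S"
  shows "\<exists>\<Phi>. finite \<Phi> \<and> S = {x. (\<forall>a. a \<notin> A \<longrightarrow> x a = 0) \<and> (\<forall>\<phi>\<in>\<Phi>. (\<Sum>a\<in>A. \<phi> a * x a) = 0)}"
  using assms
proof (induction A arbitrary: S rule: finite_induct)
  case empty
  then have "S = {\<lambda>a. 0}" by auto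
  then show ?case by (intro exI[of _ "{}"]) auto
next
  case (insert b A)
  note S0 = insert.prems(1) and z = insert.prems(2) and add = insert.prems(3) and sc = insert.prems(4)
  define S' where "S' = {x\<in>S. x b = 0}"
  have "\<exists>\<Phi>. finite \<Phi> \<and> S' = {x. (\<forall>a. a \<notin> A \<longrightarrow> x a = 0) \<and> (\<forall>\<phi>\<in>\<Phi>. (\<Sum>a\<in>A. \<phi> a * x a) = 0)}"
  proof (rule insert.IH)
    show "S' \<subseteq> {x. \<forall>a. a \<notin> A \<longrightarrow> x a = 0}" using S0 unfolding S'_def by force
  qed (use z add sc in \<open>auto simp: S'_def\<close>)
  then obtain \<Phi> where \<Phi>: "finite \<Phi>"
    "S' = {x. (\<forall>a. a \<notin> A \<longrightarrow> x a = 0) \<and> (\<forall>\<phi>\<in>\<Phi>. (\<Sum>a\<in>A. \<phi> a * x a) = 0)}" by blast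
  show ?case
  proof (cases "\<exists>s\<in>S. s b \<noteq> 0")
    case False
    let ?e = "\<lambda>\<phi> a. if a = b then 0 else \<phi> a" and ?u = "\<lambda>a. if a = b then 1 else 0 :: real"
    have "(\<Sum>a\<in>insert b A. ?e \<phi> a * x a) = (\<Sum>a\<in>A. \<phi> a * x a)" for \<phi> x :: "'b \<Rightarrow> real"
    proof -
      have "(\<Sum>a\<in>A. ?e \<phi> a * x a) = (\<Sum>a\<in>A. \<phi> a * x a)"
        using insert.hyps by (intro sum.cong) auto
      then show ?thesis using insert.hyps by simp
    qed
    moreover have "(\<Sum>a\<in>insert b A. ?u a * x a) = x b" for x
    proof -
      have "(\<Sum>a\<in>A. ?u a * x a) = 0" using insert.hyps by (intro sum.neutral) auto
      then show ?thesis using insert.hyps by simp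
    qed
    moreover have "S = S'" using False by (auto simp: S'_def)
    moreover have "(\<forall>a. a \<notin> A \<longrightarrow> x a = 0) \<longleftrightarrow> x b = 0 \<and> (\<forall>a. a \<notin> insert b A \<longrightarrow> x a = 0)" for x :: "'b \<Rightarrow> real"
      using insert.hyps by auto
    ultimately have "S = {x. (\<forall>a. a \<notin> insert b A \<longrightarrow> x a = 0) \<and>
        (\<forall>\<phi>\<in>insert ?u (?e ` \<Phi>). (\<Sum>a\<in>insert b A. \<phi> a * x a) = 0)}"
      using \<Phi>(2) by (simp del: sum.insert insert_iff) blast
    then show ?thesis using \<Phi>(1) by (intro exI[of _ "insert ?u (?e ` \<Phi>)"]) simp
  next
    case True
    then obtain s0 where s0: "s0 \<in> S" "s0 b \<noteq> 0" by blast
    define s where "s = (\<lambda>a. inverse (s0 b) * s0 a)"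
    have s: "s \<in> S" "s b = 1" using s0 sc by (auto simp: s_def)
    have mem: "x \<in> S \<longleftrightarrow> (\<lambda>a. x a - x b * s a) \<in> S'" for x
    proof
      assume "x \<in> S"
      then show "(\<lambda>a. x a - x b * s a) \<in> S'"
        using add[OF _ sc[OF s(1), of "- x b"], of x] s by (simp add: S'_def)
    next
      assume "(\<lambda>a. x a - x b * s a) \<in> S'"
      then show "x \<in> S" using add[OF _ sc[OF s(1), of "x b"], of "\<lambda>a. x a - x b * s a"] by (simp add: S'_def)
    qed
    let ?e = "\<lambda>\<phi> a. if a = b then - (\<Sum>a\<in>A. \<phi> a * s a) else \<phi> a"
    have e: "(\<Sum>a\<in>insert b A. ?e \<phi> a * x a) = (\<Sum>a\<in>A. \<phi> a * (x a - x b * s a))" for \<phi> x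
    proof -
      have "(\<Sum>a\<in>A. ?e \<phi> a * x a) = (\<Sum>a\<in>A. \<phi> a * x a)"
        using insert.hyps by (intro sum.cong) auto
      then show ?thesis using insert.hyps
        by (simp add: right_diff_distrib sum_subtractf sum_distrib_left mult_ac)
    qed
    have supp: "(\<forall>a. a \<notin> A \<longrightarrow> x a - x b * s a = 0) \<longleftrightarrow> (\<forall>a. a \<notin> insert b A \<longrightarrow> x a = 0)" for x
      using S0 s by force
    have "x \<in> S \<longleftrightarrow> (\<forall>a. a \<notin> insert b A \<longrightarrow> x a = 0) \<and> (\<forall>\<phi>\<in>\<Phi>. (\<Sum>a\<in>insert b A. ?e \<phi> a * x a) = 0)" for x
      unfolding mem e by (simp only: \<Phi>(2) mem_Collect_eq supp)
    then show ?thesis using \<Phi>(1)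
      by (intro exI[of _ "?e ` \<Phi>"]) auto
  qed
qed

text \<open>The windows of a linear behavior form a finite-dimensional subspace.  It is cut
  out by finitely many hyperplanes, each of which is a difference equation, and by completeness these
  equations characterize the behavior.\<close>

lemma linear_behavior_kernel_representation:
  assumes "B \<in> linear_behaviors n"
  shows "\<exists>g G. G \<in> carrier_mat g n \<and> B = kernel_behavior n G"
proof -
  have B: "B \<subseteq> trajectories n" "time_invariant_behavior B" "linear_closed B" "complete_behavior n B"
    using assms by (auto simp: linear_behaviors_def)
  obtain L where L: "L \<ge> 0"
    "\<And>w. w \<in> trajectories n \<Longrightarrow> \<forall>t. window t (t + L) w \<in> window t (t + L) ` B \<Longrightarrow> w \<in> B"
    using B(4) unfolding complete_behavior_def by blast
  define N where "N = nat L"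
  define A where "A = {..N} \<times> {..<n}"
  define e where "e = (\<lambda>(w::trajectory) a. if a \<in> A then w (int (fst a)) (snd a) else 0)"
  have "\<exists>\<Phi>. finite \<Phi> \<and> e ` B = {x. (\<forall>a. a \<notin> A \<longrightarrow> x a = 0) \<and> (\<forall>\<phi>\<in>\<Phi>. (\<Sum>a\<in>A. \<phi> a * x a) = 0)}"
  proof (rule subspace_hyperplanes)
    show "finite A" by (simp add: A_def)
    show "e ` B \<subseteq> {x. \<forall>a. a \<notin> A \<longrightarrow> x a = 0}" by (auto simp: e_def)
    show "(\<lambda>a. 0) \<in> e ` B"
      using B(3) by (intro image_eqI[of _ _ "\<lambda>t i. 0"]) (auto simp: e_def linear_closed_def)
    fix x y c assume "x \<in> e ` B"
    then obtain v where v: "v \<in> B" "x = e v" by blast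
    show "(\<lambda>a. c * x a) \<in> e ` B"
      using B(3) v by (intro image_eqI[of _ _ "\<lambda>t i. c * v t i"]) (auto simp: e_def linear_closed_def)
    assume "y \<in> e ` B"
    then obtain w where w: "w \<in> B" "y = e w" by blast
    show "(\<lambda>a. x a + y a) \<in> e ` B"
      using B(3) v w by (intro image_eqI[of _ _ "\<lambda>t i. v t i + w t i"]) (auto simp: e_def linear_closed_def)
  qed
  then obtain \<Phi> where \<Phi>: "finite \<Phi>"
    "e ` B = {x. (\<forall>a. a \<notin> A \<longrightarrow> x a = 0) \<and> (\<forall>\<phi>\<in>\<Phi>. (\<Sum>a\<in>A. \<phi> a * x a) = 0)}" by blast
  obtain f where f: "bij_betw f {0..<card \<Phi>} \<Phi>" using ex_bij_betw_nat_finite[OF \<Phi>(1)] by blast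
  define g where "g = card \<Phi>"
  have f: "f ` {..<g} = \<Phi>" using f by (simp add: bij_betw_def g_def lessThan_atLeast0)
  define G where "G = mat g n (\<lambda>(i, j). \<Sum>l\<le>N. monom (f i (l, j)) l)"
  have G: "G \<in> carrier_mat g n" by (simp add: G_def)
  have actG: "act G w t i = (\<Sum>a\<in>A. f i a * e (time_shift t w) a)" if "i < g" for w t i
  proof -
    have monom: "poly_act (monom c l) s t = c * s (t + int l)" for c :: real and l s
      by (subst poly_act_upto[OF degree_monom_le]) (simp add: if_distrib[of "\<lambda>c. c * _"] cong: if_cong)
    have "act G w t i = (\<Sum>j<n. \<Sum>l\<le>N. f i (l, j) * w (t + int l) j)"
      using that by (simp add: act_def G_def poly_act_sum_poly monom)
    also have "\<dots> = (\<Sum>l\<le>N. \<Sum>j<n. f i (l, j) * w (t + int l) j)" by (rule sum.swap)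
    also have "\<dots> = (\<Sum>a\<in>A. f i a * e (time_shift t w) a)"
      unfolding A_def sum.cartesian_product
      by (intro sum.cong) (auto simp: e_def A_def time_shift_def add.commute)
    finally show ?thesis .
  qed
  have ker: "act G w = (\<lambda>t i. 0) \<longleftrightarrow> (\<forall>t. e (time_shift t w) \<in> e ` B)" for w
  proof -
    have "act G w = (\<lambda>t i. 0) \<longleftrightarrow> (\<forall>t. \<forall>i<g. act G w t i = 0)"
      using G by (auto simp: fun_eq_iff act_def)
    also have "\<dots> \<longleftrightarrow> (\<forall>t. \<forall>\<phi>\<in>f ` {..<g}. (\<Sum>a\<in>A. \<phi> a * e (time_shift t w) a) = 0)"
      by (auto simp: actG)
    also have "\<dots> \<longleftrightarrow> (\<forall>t. e (time_shift t w) \<in> e ` B)"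
      unfolding \<Phi>(2) f by (auto simp: e_def)
    finally show ?thesis .
  qed
  have "B = kernel_behavior n G"
  proof (intro Set.set_eqI iffI)
    fix w assume w: "w \<in> B"
    then have "\<forall>t. e (time_shift t w) \<in> e ` B" using B(2) by (auto simp: time_invariant_behavior_def)
    then show "w \<in> kernel_behavior n G" using ker w B(1) by (auto simp: kernel_behavior_def)
  next
    fix w assume "w \<in> kernel_behavior n G"
    then have w: "w \<in> trajectories n" "\<forall>t. e (time_shift t w) \<in> e ` B"
      using ker by (auto simp: kernel_behavior_def)
    show "w \<in> B"
    proof (rule L(2)[OF w(1)], rule allI)
      fix t
      obtain b where b: "b \<in> B" "e (time_shift t w) = e b" using w(2) by blast
      have "w s = time_shift (- t) b s" if "s \<in> {t..t + L}" for s
      proof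
        fix j
        show "w s j = time_shift (- t) b s j"
        proof (cases "j < n")
          case True
          then have "(nat (s - t), j) \<in> A" using that by (auto simp: A_def N_def)
          then show ?thesis using fun_cong[OF b(2), of "(nat (s - t), j)"] that
            by (simp add: e_def time_shift_def)
        next
          case False
          then show ?thesis using w(1) b(1) B(1) by (auto simp: trajectories_iff time_shift_def subset_iff)
        qed
      qed
      then have "window t (t + L) w = window t (t + L) (time_shift (- t) b)"
        by (simp add: window_eq_iff)
      then show "window t (t + L) w \<in> window t (t + L) ` B"
        using B(2) b(1) unfolding time_invariant_behavior_def by blast
    qed
  qed
  then show ?thesis using G by blast
qed

text \<open>The differences to a fixed element form a linear behavior.  For its closure under addition, a sum is
  the midpoint of the two doubled vectors.\<close>

lemma affine_behavior_kernel_representation: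
  assumes "B \<in> affine_behaviors n"
  shows "\<exists>g G. G \<in> carrier_mat g n \<and> (\<forall>b\<in>B. B = translate b (kernel_behavior n G))"
proof -
  have B: "B \<subseteq> trajectories n" "time_invariant_behavior B" "affine_closed B" "complete_behavior n B" "B \<noteq> {}"
    using assms by (auto simp: affine_behaviors_def)
  from B(5) obtain b0 where b0: "b0 \<in> B" by blast
  define W where "W = (\<lambda>b t i. b t i - b0 t i) ` B"
  have mem: "w \<in> W \<longleftrightarrow> (\<lambda>t i. b0 t i + w t i) \<in> B" for w
  proof
    assume "(\<lambda>t i. b0 t i + w t i) \<in> B"
    then show "w \<in> W" unfolding W_def by (intro image_eqI[of _ _ "\<lambda>t i. b0 t i + w t i"]) auto
  qed (auto simp: W_def)
  have aff: "(\<lambda>t i. \<alpha> * w1 t i + (1 - \<alpha>) * w2 t i) \<in> B" if "w1 \<in> B" "w2 \<in> B" for w1 w2 \<alpha>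
    using B(3) that by (auto simp: affine_closed_def)
  have scale: "(\<lambda>t i. \<alpha> * w t i) \<in> W" if "w \<in> W" for w \<alpha>
  proof -
    have "(\<lambda>t i. b0 t i + \<alpha> * w t i) = (\<lambda>t i. \<alpha> * (b0 t i + w t i) + (1 - \<alpha>) * b0 t i)"
      by (simp add: fun_eq_iff algebra_simps)
    then show ?thesis using aff[of _ b0] b0 that by (simp add: mem)
  qed
  have add: "(\<lambda>t i. v t i + w t i) \<in> W" if "v \<in> W" "w \<in> W" for v w
  proof -
    have "(\<lambda>t i. b0 t i + (v t i + w t i)) =
        (\<lambda>t i. (1/2) * (b0 t i + 2 * v t i) + (1 - 1/2) * (b0 t i + 2 * w t i))"
      by (simp add: fun_eq_iff algebra_simps)
    then show ?thesis
      using aff[of "\<lambda>t i. b0 t i + 2 * v t i" "\<lambda>t i. b0 t i + 2 * w t i" "1/2"]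
        scale[OF that(1), of 2] scale[OF that(2), of 2] by (simp add: mem)
  qed
  have zero: "(\<lambda>t i. 0) \<in> W" using b0 by (simp add: mem)
  have "W \<in> linear_behaviors n"
  proof -
    have "W \<subseteq> trajectories n" using B(1) b0 by (auto simp: W_def trajectories_diff subset_iff)
    moreover have "time_invariant_behavior W"
      unfolding time_invariant_behavior_def
    proof (intro ballI allI)
      fix w \<tau> assume "w \<in> W"
      then obtain b where b: "b \<in> B" "w = (\<lambda>t i. b t i - b0 t i)" by (auto simp: W_def)
      have "time_shift \<tau> b \<in> B" "time_shift \<tau> b0 \<in> B"
        using b b0 B(2) by (auto simp: time_invariant_behavior_def)
      then have "(\<lambda>t i. time_shift \<tau> b t i - b0 t i) \<in> W" "(\<lambda>t i. time_shift \<tau> b0 t i - b0 t i) \<in> W"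
        by (auto simp: mem)
      from add[OF this(1) scale[OF this(2), of "-1"]]
      show "time_shift \<tau> w \<in> W" unfolding b by (simp add: time_shift_def)
    qed
    moreover have "complete_behavior n W"
    proof -
      obtain L where L: "L \<ge> 0"
        "\<And>w. w \<in> trajectories n \<Longrightarrow> \<forall>t. window t (t + L) w \<in> window t (t + L) ` B \<Longrightarrow> w \<in> B"
        using B(4) unfolding complete_behavior_def by blast
      have "w \<in> W" if w: "w \<in> trajectories n" "\<forall>t. window t (t + L) w \<in> window t (t + L) ` W" for w
        unfolding mem
      proof (rule L(2))
        show "(\<lambda>t i. b0 t i + w t i) \<in> trajectories n"
          using w(1) b0 B(1) by (auto simp: trajectories_add subset_iff)
        show "\<forall>t. window t (t + L) (\<lambda>t i. b0 t i + w t i) \<in> window t (t + L) ` B"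
        proof
          fix t
          obtain v where v: "v \<in> W" "\<forall>s\<in>{t..t + L}. w s = v s"
            using w(2) unfolding image_iff window_eq_iff by metis
          then have "window t (t + L) (\<lambda>t i. b0 t i + w t i) = window t (t + L) (\<lambda>t i. b0 t i + v t i)"
            unfolding window_eq_iff by auto
          then show "window t (t + L) (\<lambda>t i. b0 t i + w t i) \<in> window t (t + L) ` B"
            using v(1) mem by blast
        qed
      qed
      then show ?thesis unfolding complete_behavior_def using L(1) by blast
    qed
    ultimately show ?thesis
      using zero add scale by (auto simp: linear_behaviors_def linear_closed_def)
  qed
  then obtain g G where G: "G \<in> carrier_mat g n" "W = kernel_behavior n G"
    using linear_behavior_kernel_representation by blast
  have eq: "B = translate b0 (kernel_behavior n G)"
    unfolding G(2)[symmetric] by (rule Set.set_eqI) (simp add: mem_translate mem)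
  have "B = translate b (kernel_behavior n G)" if "b \<in> B" for b
    using translate_kernel_eq[of b b0 n G] that eq by simp
  then show ?thesis using G(1) by blast
qed

section \<open>Independent equations and the input cardinality\<close>

definition block_rows :: "nat \<Rightarrow> nat \<Rightarrow> 'a mat \<Rightarrow> 'a mat" where
  "block_rows a m A = mat m (dim_col A) (\<lambda>(i, j). A $$ (a + i, j))"

definition stack :: "'a mat \<Rightarrow> 'a mat \<Rightarrow> 'a mat" where
  "stack A B = mat (dim_row A + dim_row B) (dim_col A)
     (\<lambda>(i, j). if i < dim_row A then A $$ (i, j) else B $$ (i - dim_row A, j))"

lemma block_rows_carrier: "A \<in> carrier_mat k n \<Longrightarrow> block_rows a m A \<in> carrier_mat m n"
  by (simp add: block_rows_def)

lemma act_block_rows: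
  assumes "a + m \<le> dim_row A"
  shows "act (block_rows a m A) w = (\<lambda>t i. if i < m then act A w t (a + i) else 0)"
  using assms by (auto simp: act_def block_rows_def fun_eq_iff)

lemma stack_carrier: "A \<in> carrier_mat a n \<Longrightarrow> B \<in> carrier_mat b n \<Longrightarrow> stack A B \<in> carrier_mat (a + b) n"
  by (simp add: stack_def)

lemma act_stack:
  assumes "A \<in> carrier_mat a n" "B \<in> carrier_mat b n"
  shows "act (stack A B) w = (\<lambda>t i. if i < a then act A w t i else act B w t (i - a))"
  using assms by (auto simp: act_def stack_def fun_eq_iff)

lemma act_stack_eq_iff:
  assumes A: "A \<in> carrier_mat a n" and B: "B \<in> carrier_mat b n" and y: "y \<in> trajectories a"
  shows "act (stack A B) w = (\<lambda>t i. if i < a then y t i else z t (i - a)) \<longleftrightarrow> act A w = y \<and> act B w = z"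
proof
  assume *: "act (stack A B) w = (\<lambda>t i. if i < a then y t i else z t (i - a))"
  have "act A w t i = y t i" "act B w t i = z t i" for t i
  proof -
    show "act A w t i = y t i"
    proof (cases "i < a")
      case True
      then show ?thesis using fun_cong[OF fun_cong[OF *], of t i] by (simp add: act_stack[OF A B])
    next
      case False
      then show ?thesis using act_trajectories[OF A, of w] y by (simp add: trajectories_iff)
    qed
    show "act B w t i = z t i"
      using fun_cong[OF fun_cong[OF *], of t "a + i"] by (simp add: act_stack[OF A B])
  qed
  then show "act A w = y \<and> act B w = z" by (simp add: fun_eq_iff)
qed (auto simp: act_stack[OF A B])

lemma act_stack_zero_iff:
  assumes A: "A \<in> carrier_mat a n" and B: "B \<in> carrier_mat b n"
  shows "act (stack A B) w = (\<lambda>t i. 0) \<longleftrightarrow> act A w = (\<lambda>t i. 0) \<and> act B w = (\<lambda>t i. 0)"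
  using act_stack_eq_iff[OF A B, of "\<lambda>t i. 0" w "\<lambda>t i. 0"] by simp

lemma onto_stack_iff:
  assumes A: "A \<in> carrier_mat a n" and B: "B \<in> carrier_mat b n"
  shows "onto (a + b) n (stack A B) \<longleftrightarrow>
    (\<forall>y\<in>trajectories a. \<forall>z\<in>trajectories b. \<exists>w\<in>trajectories n. act A w = y \<and> act B w = z)"
proof
  assume *: "onto (a + b) n (stack A B)"
  show "\<forall>y\<in>trajectories a. \<forall>z\<in>trajectories b. \<exists>w\<in>trajectories n. act A w = y \<and> act B w = z"
  proof (intro ballI)
    fix y z assume y: "y \<in> trajectories a" and z: "z \<in> trajectories b"
    have "(\<lambda>t i. if i < a then y t i else z t (i - a)) \<in> trajectories (a + b)"
      using z by (auto simp: trajectories_iff)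
    then show "\<exists>w\<in>trajectories n. act A w = y \<and> act B w = z"
      using * unfolding onto_def act_stack_eq_iff[OF A B y, symmetric] by blast
  qed
next
  assume *: "\<forall>y\<in>trajectories a. \<forall>z\<in>trajectories b. \<exists>w\<in>trajectories n. act A w = y \<and> act B w = z"
  show "onto (a + b) n (stack A B)"
    unfolding onto_def
  proof
    fix x assume x: "x \<in> trajectories (a + b)"
    define y where "y = first_components a x"
    define z where "z = (\<lambda>t i. x t (a + i))"
    have y: "y \<in> trajectories a" by (simp add: y_def first_components_def trajectories_iff)
    have "z \<in> trajectories b" using x by (auto simp: z_def trajectories_iff)
    with y obtain w where w: "w \<in> trajectories n" "act A w = y" "act B w = z" using * by blast
    have "(\<lambda>t i. if i < a then y t i else z t (i - a)) = x"
      by (auto simp: fun_eq_iff y_def z_def first_components_def)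
    then show "\<exists>w\<in>trajectories n. act (stack A B) w = x"
      using w act_stack_eq_iff[OF A B y, of w z] by auto
  qed
qed

text \<open>The rows of the diagonal form that vanish impose no equation; the others are onto because nonzero
  scalar operators are.\<close>

lemma kernel_behavior_onto_representation:
  assumes G: "G \<in> carrier_mat m n"
  shows "\<exists>r G1. r \<le> m \<and> G1 \<in> carrier_mat r n \<and> onto r n G1 \<and>
           kernel_behavior n G1 = kernel_behavior n G \<and> (r = m \<longrightarrow> onto m n G)"
proof -
  obtain U U' V V' r d where UV: "mutually_inverse m U U'" "mutually_inverse n V V'"
    and r: "r \<le> m" "r \<le> n" and d: "\<And>i. i < r \<Longrightarrow> d i \<noteq> 0"
    and D: "\<And>w. act U (act G (act V w)) = (\<lambda>t i. if i < r then poly_act (d i) (\<lambda>t. w t i) t else 0)"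
    and D': "\<And>w. w \<in> trajectories n \<Longrightarrow>
       act U (act G w) = (\<lambda>t i. if i < r then poly_act (d i) (\<lambda>t. act V' w t i) t else 0)"
    using diagonal_form[OF G] by blast
  have c: "U \<in> carrier_mat m m" "V \<in> carrier_mat n n" using UV by (auto simp: mutually_inverse_def)
  define G1 where "G1 = block_rows 0 r (U * G)"
  have G1: "G1 \<in> carrier_mat r n"
    unfolding G1_def using c G by (intro block_rows_carrier) (rule mult_carrier_mat)
  have G1act: "act G1 w = act U (act G w)" if "w \<in> trajectories n" for w
    unfolding G1_def using act_block_rows[of 0 r "U * G"] r c G D'[OF that] act_mult[OF c(1) G]
    by (auto simp: fun_eq_iff)
  have Uz: "act U v = (\<lambda>t i. 0) \<longleftrightarrow> v = (\<lambda>t i. 0)" if "v \<in> trajectories m" for v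
    using act_inverse_eq[OF UV(1) that trajectories_zero] by simp
  have "kernel_behavior n G1 = kernel_behavior n G"
    unfolding kernel_behavior_def using G1act Uz act_trajectories[OF G] by auto
  moreover have ex: "\<exists>w\<in>trajectories n. act U (act G w) = y" if y: "y \<in> trajectories r" for y
  proof -
    have "\<forall>i. \<exists>s. i < r \<longrightarrow> poly_act (d i) s = (\<lambda>t. y t i)" using poly_act_surj d by metis
    then obtain s where s: "\<And>i. i < r \<Longrightarrow> poly_act (d i) (s i) = (\<lambda>t. y t i)" by metis
    have "act U (act G (act V (\<lambda>t i. s i t))) t i = y t i" for t i
      unfolding D using y s[of i] by (auto simp: trajectories_iff)
    then show ?thesis using act_trajectories[OF c(2)] by (meson ext)
  qed
  moreover have "onto r n G1" unfolding onto_def using ex G1act by metis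
  moreover have "onto m n G" if "r = m"
    unfolding onto_def
  proof
    fix y assume y: "y \<in> trajectories m"
    then have "act U y \<in> trajectories r" using c that by simp
    then obtain w where w: "w \<in> trajectories n" "act U (act G w) = act U y" using ex by blast
    then show "\<exists>w\<in>trajectories n. act G w = y"
      using act_inverse_eq[OF UV(1) act_trajectories[OF G] y] by blast
  qed
  ultimately show ?thesis using r(1) G1 by blast
qed

text \<open>A homogeneous system with more unknowns than equations has a nonzero solution; the elimination is
  fraction-free, so the solution is polynomial.\<close>

lemma polynomial_kernel_vector:
  fixes A :: "'i \<Rightarrow> 'j \<Rightarrow> 'a::idom"
  assumes "finite I" "finite J" "card I < card J"
  shows "\<exists>x. (\<exists>j\<in>J. x j \<noteq> 0) \<and> (\<forall>i\<in>I. (\<Sum>j\<in>J. A i j * x j) = 0)"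
  using assms
proof (induction I arbitrary: J A rule: finite_induct)
  case empty
  then have "J \<noteq> {}" by auto
  then show ?case by (intro exI[of _ "\<lambda>_. 1"]) auto
next
  case (insert k I)
  show ?case
  proof (cases "\<forall>j\<in>J. A k j = 0")
    case True
    then show ?thesis using insert.IH[of J A] insert.prems insert.hyps by auto
  next
    case False
    then obtain p where p: "p \<in> J" "A k p \<noteq> 0" by blast
    define A' where "A' = (\<lambda>i j. A k p * A i j - A i p * A k j)"
    have "card I < card (J - {p})" using insert.prems insert.hyps p by simp
    then obtain x where x: "\<exists>j\<in>J - {p}. x j \<noteq> 0" "\<And>i. i \<in> I \<Longrightarrow> (\<Sum>j\<in>J - {p}. A' i j * x j) = 0"
      using insert.IH[of "J - {p}" A'] insert.prems by auto
    define z where "z = (\<lambda>j. if j = p then - (\<Sum>j\<in>J - {p}. A k j * x j) else A k p * x j)"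
    have "(\<Sum>j\<in>J. A i j * z j) = (\<Sum>j\<in>J - {p}. A' i j * x j)" for i
    proof -
      have "(\<Sum>j\<in>J. A i j * z j) = A i p * z p + (\<Sum>j\<in>J - {p}. A i j * z j)"
        using insert.prems(1) p(1) by (rule sum.remove)
      also have "(\<Sum>j\<in>J - {p}. A i j * z j) = (\<Sum>j\<in>J - {p}. A k p * (A i j * x j))"
        by (intro sum.cong) (auto simp: z_def)
      finally have "(\<Sum>j\<in>J. A i j * z j) =
          (\<Sum>j\<in>J - {p}. A k p * (A i j * x j)) - (\<Sum>j\<in>J - {p}. A i p * (A k j * x j))"
        by (simp add: z_def sum_distrib_left)
      also have "\<dots> = (\<Sum>j\<in>J - {p}. A' i j * x j)"
        unfolding sum_subtractf[symmetric] by (intro sum.cong) (auto simp: A'_def algebra_simps)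
      finally show ?thesis .
    qed
    moreover have "(\<Sum>j\<in>J - {p}. A' k j * x j) = 0" by (simp add: A'_def)
    moreover have "\<exists>j\<in>J. z j \<noteq> 0" using x(1) p by (auto simp: z_def)
    ultimately show ?thesis using x(2) by (intro exI[of _ z]) auto
  qed
qed

definition onto_using :: "nat \<Rightarrow> nat \<Rightarrow> nat set \<Rightarrow> real poly mat \<Rightarrow> bool" where
  "onto_using m n J A \<longleftrightarrow>
     (\<forall>y\<in>trajectories m. \<exists>w\<in>trajectories n. (\<forall>t j. j \<notin> J \<longrightarrow> w t j = 0) \<and> act A w = y)"

text \<open>With fewer columns than rows, some nonzero polynomial combination of the rows vanishes on the columns
  used, and would annihilate every right-hand side.\<close>

lemma onto_using_card_ge:
  assumes A: "A \<in> carrier_mat m n" and J: "J \<subseteq> {..<n}" "onto_using m n J A"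
  shows "m \<le> card J"
proof (rule ccontr)
  assume "\<not> m \<le> card J"
  then have "card J < card {..<m}" by simp
  moreover have fJ: "finite J" using J(1) finite_subset by blast
  ultimately obtain x where x: "\<exists>i<m. x i \<noteq> 0" "\<And>j. j \<in> J \<Longrightarrow> (\<Sum>i<m. A $$ (i, j) * x i) = 0"
    using polynomial_kernel_vector[of J "{..<m}" "\<lambda>j i. A $$ (i, j)"] by auto
  then obtain k where k: "k < m" "x k \<noteq> 0" by blast
  have "poly_act (x k) s t = 0" for s t
  proof -
    define y :: trajectory where "y = (\<lambda>t i. if i = k then s t else 0)"
    have "y \<in> trajectories m" using k by (auto simp: y_def trajectories_iff)
    then obtain w where w: "w \<in> trajectories n" "\<And>t j. j \<notin> J \<Longrightarrow> w t j = 0" "act A w = y"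
      using J(2) unfolding onto_using_def by blast
    have "(\<Sum>i<m. poly_act (x i) (\<lambda>t. act A w t i) t)
        = (\<Sum>i<m. \<Sum>j<n. poly_act (A $$ (i, j) * x i) (\<lambda>t. w t j) t)"
      using A by (simp add: act_def poly_act_sum poly_act_mult[symmetric] mult.commute)
    also have "\<dots> = (\<Sum>j<n. poly_act (\<Sum>i<m. A $$ (i, j) * x i) (\<lambda>t. w t j) t)"
      unfolding poly_act_sum_poly by (rule sum.swap)
    also have "\<dots> = 0"
    proof (intro sum.neutral ballI)
      fix j show "poly_act (\<Sum>i<m. A $$ (i, j) * x i) (\<lambda>t. w t j) t = 0"
        by (cases "j \<in> J") (simp_all add: x(2) w(2))
    qed
    also have "(\<Sum>i<m. poly_act (x i) (\<lambda>t. act A w t i) t) = (\<Sum>i<m. if i = k then poly_act (x k) s t else 0)"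
      unfolding w(3) y_def by (intro sum.cong) auto
    also have "\<dots> = poly_act (x k) s t" using k by simp
    finally show ?thesis by simp
  qed
  then have "x k = 0" by (intro poly_act_eq_zero) (simp add: fun_eq_iff)
  with k show False by simp
qed

text \<open>In a minimal set of columns that suffices there are no more columns than rows: otherwise a
  polynomial kernel vector \<open>x\<close> exists, and as \<open>x k\<close> acts onto, a multiple of \<open>x\<close> can be
  subtracted from any solution to make its component \<open>k\<close> vanish.\<close>

lemma onto_using_minimal:
  assumes A: "A \<in> carrier_mat m n" and on: "onto m n A"
  shows "\<exists>J\<subseteq>{..<n}. card J = m \<and> onto_using m n J A"
proof -
  have "onto_using m n {..<n} A"
    using on unfolding onto_def onto_using_def by (auto simp: trajectories_iff)
  then have "{..<n} \<subseteq> {..<n} \<and> onto_using m n {..<n} A" by simp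
  from ex_has_least_nat[of "\<lambda>J. J \<subseteq> {..<n} \<and> onto_using m n J A", OF this, of card]
  obtain J where J: "J \<subseteq> {..<n}" "onto_using m n J A"
    and min: "\<forall>J'. J' \<subseteq> {..<n} \<and> onto_using m n J' A \<longrightarrow> card J \<le> card J'"
    by auto
  have fJ: "finite J" using J(1) finite_subset by blast
  have "card J \<le> m"
  proof (rule ccontr)
    assume "\<not> card J \<le> m"
    then obtain x where x: "\<exists>j\<in>J. x j \<noteq> 0" "\<And>i. i < m \<Longrightarrow> (\<Sum>j\<in>J. A $$ (i, j) * x j) = 0"
      using polynomial_kernel_vector[of "{..<m}" J "\<lambda>i j. A $$ (i, j)"] fJ by auto
    then obtain k where k: "k \<in> J" "x k \<noteq> 0" by blast
    have "onto_using m n (J - {k}) A"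
      unfolding onto_using_def
    proof
      fix y assume "y \<in> trajectories m"
      then obtain w where w: "w \<in> trajectories n" "\<And>t j. j \<notin> J \<Longrightarrow> w t j = 0" "act A w = y"
        using J(2) unfolding onto_using_def by blast
      obtain s where s: "poly_act (x k) s = (\<lambda>t. w t k)" using poly_act_surj[OF k(2)] by blast
      define v :: trajectory where "v = (\<lambda>t j. if j \<in> J then poly_act (x j) s t else 0)"
      have "act A v t i = 0" for t i
      proof (cases "i < m")
        case True
        have "act A v t i = (\<Sum>j<n. poly_act (A $$ (i, j)) (\<lambda>t. v t j) t)"
          using A True by (simp add: act_def)
        also have "\<dots> = (\<Sum>j\<in>J. poly_act (A $$ (i, j)) (\<lambda>t. v t j) t)"
          using J(1) by (intro sum.mono_neutral_right) (auto simp: v_def)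
        also have "\<dots> = (\<Sum>j\<in>J. poly_act (A $$ (i, j) * x j) s t)"
          by (intro sum.cong) (auto simp: v_def poly_act_mult)
        also have "\<dots> = poly_act (\<Sum>j\<in>J. A $$ (i, j) * x j) s t" by (simp add: poly_act_sum_poly)
        finally show ?thesis using x(2)[OF True] by simp
      qed (use A in \<open>simp add: act_def\<close>)
      then have "act A (\<lambda>t i. w t i - v t i) = y" using w(3) by (simp add: act_diff)
      moreover have "(\<lambda>t i. w t i - v t i) \<in> trajectories n"
        using w(1) J(1) by (auto simp: trajectories_iff v_def)
      moreover have "w t j - v t j = 0" if "j \<notin> J - {k}" for t j
      proof (cases "j = k")
        case True
        then show ?thesis using fun_cong[OF s, of t] k(1) by (simp add: v_def)
      next
        case False
        then have "j \<notin> J" using that by blast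
        then show ?thesis using w(2)[of j t] by (simp add: v_def)
      qed
      ultimately show "\<exists>w\<in>trajectories n. (\<forall>t j. j \<notin> J - {k} \<longrightarrow> w t j = 0) \<and> act A w = y"
        by (intro bexI[of _ "\<lambda>t i. w t i - v t i"]) blast+
    qed
    then have "card J \<le> card (J - {k})" using J(1) min by blast
    then show False using k(1) fJ by (metis card_Diff1_less not_less)
  qed
  then have "card J = m" using onto_using_card_ge[OF A J] by simp
  then show ?thesis using J by (intro exI[of _ J] conjI)
qed

definition free_on :: "nat set \<Rightarrow> trajectory set \<Rightarrow> bool" where
  "free_on I W \<longleftrightarrow> (\<forall>u::trajectory. \<exists>w\<in>W. \<forall>t. \<forall>i\<in>I. w t i = u t i)"

text \<open>Prescribing the components in \<open>I\<close> arbitrarily amounts to solving for the others with an arbitrary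
  right-hand side.\<close>

lemma free_on_kernel_iff:
  assumes A: "A \<in> carrier_mat m n" and on: "onto m n A" and I: "I \<subseteq> {..<n}"
  shows "free_on I (kernel_behavior n A) \<longleftrightarrow> onto_using m n ({..<n} - I) A"
proof
  assume fr: "free_on I (kernel_behavior n A)"
  show "onto_using m n ({..<n} - I) A"
    unfolding onto_using_def
  proof
    fix y assume "y \<in> trajectories m"
    then obtain w0 where w0: "w0 \<in> trajectories n" "act A w0 = y" using on unfolding onto_def by blast
    obtain w where w: "w \<in> kernel_behavior n A" "\<And>t i. i \<in> I \<Longrightarrow> w t i = w0 t i"
      using fr unfolding free_on_def by blast
    show "\<exists>v\<in>trajectories n. (\<forall>t j. j \<notin> {..<n} - I \<longrightarrow> v t j = 0) \<and> act A v = y"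
    proof (intro bexI[of _ "\<lambda>t i. w0 t i - w t i"] conjI)
      show t: "(\<lambda>t i. w0 t i - w t i) \<in> trajectories n" using w0 w(1) kernelD(1) trajectories_diff by blast
      show "\<forall>t j. j \<notin> {..<n} - I \<longrightarrow> w0 t j - w t j = 0" using w(2) t by (auto simp: trajectories_iff)
      show "act A (\<lambda>t i. w0 t i - w t i) = y" using w0 kernelD(2)[OF w(1)] by (simp add: act_diff)
    qed
  qed
next
  assume on: "onto_using m n ({..<n} - I) A"
  show "free_on I (kernel_behavior n A)"
    unfolding free_on_def
  proof
    fix u :: trajectory
    define v :: trajectory where "v = (\<lambda>t i. if i \<in> I then u t i else 0)"
    have v: "v \<in> trajectories n" using I by (auto simp: v_def trajectories_iff)
    obtain x where x: "x \<in> trajectories n" "\<And>t j. j \<notin> {..<n} - I \<Longrightarrow> x t j = 0" "act A x = act A v"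
      using on act_trajectories[OF A] unfolding onto_using_def by blast
    show "\<exists>w\<in>kernel_behavior n A. \<forall>t. \<forall>i\<in>I. w t i = u t i"
    proof (intro bexI[of _ "\<lambda>t i. v t i - x t i"] allI ballI)
      show "(\<lambda>t i. v t i - x t i) \<in> kernel_behavior n A"
        using v x by (simp add: kernel_behavior_def trajectories_diff act_diff)
      show "v t i - x t i = u t i" if "i \<in> I" for t i using that x(2)[of i t] by (simp add: v_def)
    qed
  qed
qed

lemma free_on_translate: "free_on I (translate w0 W) \<longleftrightarrow> free_on I W"
proof
  assume fr: "free_on I (translate w0 W)"
  show "free_on I W"
    unfolding free_on_def
  proof
    fix u :: trajectory
    obtain w where "w \<in> translate w0 W" "\<forall>t. \<forall>i\<in>I. w t i = w0 t i + u t i"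
      using fr unfolding free_on_def by (elim allE[of _ "\<lambda>t i. w0 t i + u t i"]) blast
    then show "\<exists>w\<in>W. \<forall>t. \<forall>i\<in>I. w t i = u t i"
      unfolding mem_translate by (intro bexI[of _ "\<lambda>t i. w t i - w0 t i"]) auto
  qed
next
  assume fr: "free_on I W"
  show "free_on I (translate w0 W)"
    unfolding free_on_def
  proof
    fix u :: trajectory
    obtain w where "w \<in> W" "\<forall>t. \<forall>i\<in>I. w t i = u t i - w0 t i"
      using fr unfolding free_on_def by (elim allE[of _ "\<lambda>t i. u t i - w0 t i"]) blast
    then show "\<exists>w\<in>translate w0 W. \<forall>t. \<forall>i\<in>I. w t i = u t i"
      unfolding mem_translate by (intro bexI[of _ "\<lambda>t i. w0 t i + w t i"]) (auto simp: mem_translate)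
  qed
qed

lemma permutation_onto_subset:
  assumes "I \<subseteq> {..<n}"
  shows "\<exists>\<pi>. \<pi> permutes {..<n} \<and> \<pi> ` {..<card I} = I"
proof -
  let ?k = "card I"
  have fI: "finite I" using assms finite_subset by blast
  have k: "?k \<le> n" using card_mono[OF _ assms] by simp
  have "card ({..<n} - I) = card {?k..<n}" using assms fI by (simp add: card_Diff_subset)
  then obtain g where g: "bij_betw g {?k..<n} ({..<n} - I)"
    using finite_same_card_bij[of "{?k..<n}" "{..<n} - I"] by auto
  obtain f where f: "bij_betw f {..<?k} I"
    using finite_same_card_bij[of "{..<?k}" I] fI by auto
  define \<pi> where "\<pi> = (\<lambda>i. if i < ?k then f i else if i < n then g i else i)"
  have f': "bij_betw \<pi> {..<?k} I"
    using f by (rule bij_betw_cong[THEN iffD1, rotated]) (simp add: \<pi>_def)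
  have g': "bij_betw \<pi> {?k..<n} ({..<n} - I)"
    using g by (rule bij_betw_cong[THEN iffD1, rotated]) (simp add: \<pi>_def)
  have "bij_betw \<pi> ({..<?k} \<union> {?k..<n}) (I \<union> ({..<n} - I))"
    by (rule bij_betw_combine[OF f' g']) auto
  moreover have "{..<?k} \<union> {?k..<n} = {..<n}" "I \<union> ({..<n} - I) = {..<n}" using k assms by auto
  ultimately have "bij_betw \<pi> {..<n} {..<n}" by simp
  then have "\<pi> permutes {..<n}" by (rule bij_imp_permutes) (use k in \<open>auto simp: \<pi>_def\<close>)
  then show ?thesis using f' by (auto simp: bij_betw_def)
qed

lemma projection_onto_iff:
  assumes "\<pi> permutes {..<n}" "m \<le> n"
  shows "(\<lambda>w. first_components m (permute_components \<pi> w)) ` B = trajectories m \<longleftrightarrow> free_on (\<pi> ` {..<m}) B"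
proof -
  let ?f = "\<lambda>w. first_components m (permute_components \<pi> w)"
  have image_eq: "X \<subseteq> Y \<Longrightarrow> X = Y \<longleftrightarrow> (\<forall>u\<in>Y. u \<in> X)" for X Y :: "trajectory set"
    by blast
  have in_image: "u \<in> g ` B \<longleftrightarrow> (\<exists>w\<in>B. g w = u)" for u and g :: "trajectory \<Rightarrow> trajectory"
    by blast
  have sub: "?f ` B \<subseteq> trajectories m" by (auto simp: first_components_def trajectories_iff)
  have "?f ` B = trajectories m \<longleftrightarrow> (\<forall>u\<in>trajectories m. \<exists>w\<in>B. ?f w = u)"
    unfolding image_eq[OF sub] in_image ..
  also have "\<dots> \<longleftrightarrow> (\<forall>u\<in>trajectories m. \<exists>w\<in>B. \<forall>t. \<forall>i<m. w t (\<pi> i) = u t i)"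
  proof (intro ball_cong bex_cong refl)
    fix u w assume u: "u \<in> trajectories m"
    show "?f w = u \<longleftrightarrow> (\<forall>t. \<forall>i<m. w t (\<pi> i) = u t i)"
      using u by (auto simp: first_components_def permute_components_def fun_eq_iff trajectories_iff)
  qed
  also have "\<dots> \<longleftrightarrow> free_on (\<pi> ` {..<m}) B"
  proof
    assume *: "\<forall>u\<in>trajectories m. \<exists>w\<in>B. \<forall>t. \<forall>i<m. w t (\<pi> i) = u t i"
    show "free_on (\<pi> ` {..<m}) B"
      unfolding free_on_def
    proof
      fix u :: trajectory
      have "(\<lambda>t i. if i < m then u t (\<pi> i) else 0) \<in> trajectories m" by (simp add: trajectories_iff)
      from bspec[OF * this] obtain w where "w \<in> B" "\<forall>t. \<forall>i<m. w t (\<pi> i) = u t (\<pi> i)" by auto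
      then show "\<exists>w\<in>B. \<forall>t. \<forall>i\<in>\<pi> ` {..<m}. w t i = u t i" by auto
    qed
  next
    assume fr: "free_on (\<pi> ` {..<m}) B"
    show "\<forall>u\<in>trajectories m. \<exists>w\<in>B. \<forall>t. \<forall>i<m. w t (\<pi> i) = u t i"
    proof
      fix u assume "u \<in> trajectories m"
      obtain w where "w \<in> B" "\<forall>t. \<forall>i\<in>\<pi> ` {..<m}. w t i = u t (inv_into UNIV \<pi> i)"
        using fr unfolding free_on_def by (elim allE[of _ "\<lambda>t i. u t (inv_into UNIV \<pi> i)"]) blast
      then show "\<exists>w\<in>B. \<forall>t. \<forall>i<m. w t (\<pi> i) = u t i"
        using permutes_inverses(2)[OF assms(1)] by auto
    qed
  qed
  finally show ?thesis .
qed

text \<open>Each independent equation removes one input: a set of components is free iff the complementary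
  columns are onto, which is impossible for fewer than \<open>m\<close> columns and possible for some \<open>m\<close>
  columns.\<close>

lemma input_cardinality_kernel:
  assumes A: "A \<in> carrier_mat m n" and on: "onto m n A"
  shows "m \<le> n" "input_cardinality n (translate w0 (kernel_behavior n A)) = n - m"
proof -
  let ?B = "translate w0 (kernel_behavior n A)"
  have fr: "free_on I ?B \<longleftrightarrow> onto_using m n ({..<n} - I) A" if "I \<subseteq> {..<n}" for I
    unfolding free_on_translate by (rule free_on_kernel_iff[OF A on that])
  obtain J where J: "J \<subseteq> {..<n}" "card J = m" "onto_using m n J A"
    using onto_using_minimal[OF A on] by blast
  have fJ: "finite J" using J(1) finite_subset by blast
  show mn: "m \<le> n" using card_mono[OF _ J(1)] J(2) by simp
  let ?M = "{k. k \<le> n \<and> (\<exists>\<pi>. \<pi> permutes {..<n} \<and>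
      (\<lambda>w. first_components k (permute_components \<pi> w)) ` ?B = trajectories k)}"
  have "Max ?M = n - m"
  proof (rule Max_eqI)
    show "finite ?M" by (rule finite_subset[of _ "{..n}"]) auto
    show "k \<le> n - m" if "k \<in> ?M" for k
    proof -
      from that obtain \<pi> where k: "k \<le> n" and \<pi>: "\<pi> permutes {..<n}"
        and im: "(\<lambda>w. first_components k (permute_components \<pi> w)) ` ?B = trajectories k" by blast
      have sub: "\<pi> ` {..<k} \<subseteq> {..<n}" using permutes_image[OF \<pi>] k by fastforce
      have "onto_using m n ({..<n} - \<pi> ` {..<k}) A"
        using im fr[OF sub] unfolding projection_onto_iff[OF \<pi> k] by blast
      then have "m \<le> card ({..<n} - \<pi> ` {..<k})" by (intro onto_using_card_ge[OF A]) auto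
      also have "\<dots> = n - k"
        using sub card_image[OF permutes_inj_on[OF \<pi>]] by (simp add: card_Diff_subset)
      finally show ?thesis using k by linarith
    qed
    let ?I = "{..<n} - J"
    have "card ?I = n - m" using J fJ by (simp add: card_Diff_subset)
    then obtain \<pi> where \<pi>: "\<pi> permutes {..<n}" "\<pi> ` {..<n - m} = ?I"
      using permutation_onto_subset[of ?I n] by auto
    have "{..<n} - ?I = J" using J(1) by auto
    then have "free_on ?I ?B" using fr[of ?I] J(3) by auto
    then show "n - m \<in> ?M" using projection_onto_iff[OF \<pi>(1), of "n - m"] \<pi> by auto
  qed
  then show "input_cardinality n ?B = n - m" by (simp add: input_cardinality_def)
qed

lemma onto_if_input_cardinality:
  assumes A: "A \<in> carrier_mat m n"
    and card: "int (input_cardinality n (translate w0 (kernel_behavior n A))) = int n - int m"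
  shows "onto m n A"
proof -
  obtain r A1 where A1: "r \<le> m" "A1 \<in> carrier_mat r n" "onto r n A1"
    "kernel_behavior n A1 = kernel_behavior n A" "r = m \<longrightarrow> onto m n A"
    using kernel_behavior_onto_representation[OF A] by blast
  then have "r = m" using input_cardinality_kernel(1)[OF A1(2,3)] input_cardinality_kernel(2)[OF A1(2,3), of w0] card by simp
  then show ?thesis using A1 by simp
qed

section \<open>Extension, elimination and stability\<close>

text \<open>A solution up to time \<open>T\<close> agrees in the past with a solution on the whole axis.  In diagonal
  coordinates the defect is supported in the future, and is removed by subtracting a forward solution.
  The loss \<open>N\<close> is uniform in \<open>T\<close>, so \<open>T\<close> may later be chosen in terms of \<open>N\<close>.\<close>

lemma kernel_extends_past:
  assumes A: "A \<in> carrier_mat m n"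
  shows "\<exists>N\<ge>0. \<forall>T. \<forall>x\<in>trajectories n. (\<forall>t\<le>T. act A x t = (\<lambda>i. 0)) \<longrightarrow>
           (\<exists>z\<in>kernel_behavior n A. \<forall>t\<le>T - N. z t = x t)"
proof -
  obtain U U' V V' r d where UV: "mutually_inverse m U U'" "mutually_inverse n V V'"
    and r: "r \<le> m" "r \<le> n" and d: "\<And>i. i < r \<Longrightarrow> d i \<noteq> 0"
    and D: "\<And>w. act U (act A (act V w)) = (\<lambda>t i. if i < r then poly_act (d i) (\<lambda>t. w t i) t else 0)"
    and D': "\<And>w. w \<in> trajectories n \<Longrightarrow>
       act U (act A w) = (\<lambda>t i. if i < r then poly_act (d i) (\<lambda>t. act V' w t i) t else 0)"
    using diagonal_form[OF A] by blast
  have c: "V \<in> carrier_mat n n" "V' \<in> carrier_mat n n" using UV by (auto simp: mutually_inverse_def)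
  from act_cong_before[of U] obtain N1 where N1: "N1 \<ge> 0"
    "\<And>T v w t. \<forall>t\<le>T. v t = w t \<Longrightarrow> t \<le> T - N1 \<Longrightarrow> act U v t = act U w t" by metis
  from act_cong_before[of V] obtain N2 where N2: "N2 \<ge> 0"
    "\<And>T v w t. \<forall>t\<le>T. v t = w t \<Longrightarrow> t \<le> T - N2 \<Longrightarrow> act V v t = act V w t" by metis
  have "\<exists>z\<in>kernel_behavior n A. \<forall>t\<le>T - (N1 + N2). z t = x t"
    if x: "x \<in> trajectories n" "\<forall>t\<le>T. act A x t = (\<lambda>i. 0)" for T x
  proof -
    define y where "y = act V' x"
    have y: "y \<in> trajectories n" using c by (simp add: y_def)
    have dy: "poly_act (d i) (\<lambda>t. y t i) t = 0" if "i < r" "t < T - N1 + 1" for i t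
    proof -
      have "act U (act A x) t = act U (\<lambda>t i. 0) t"
        by (rule N1(2)[of T]) (use x(2) that in auto)
      then have "act U (act A x) t i = 0" by simp
      then show ?thesis using that(1) by (simp add: D'[OF x(1)] y_def)
    qed
    have "\<exists>z. poly_act (d i) z = poly_act (d i) (\<lambda>t. y t i) \<and> (\<forall>t<T - N1 + 1. z t = 0)" if "i < r" for i
      by (rule poly_act_solve_forward) (use d[OF that] dy[OF that] in auto)
    then obtain z where z: "\<And>i. i < r \<Longrightarrow> poly_act (d i) (z i) = poly_act (d i) (\<lambda>t. y t i)"
      "\<And>i t. i < r \<Longrightarrow> t < T - N1 + 1 \<Longrightarrow> z i t = 0" by metis
    define e where "e = (\<lambda>t i. y t i - (if i < r then z i t else 0))"
    have e: "e \<in> trajectories n" using y r by (auto simp: e_def trajectories_iff)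
    have "act U (act A (act V e)) = (\<lambda>t i. 0)"
      unfolding D by (auto simp: e_def poly_act_minus z(1) fun_eq_iff)
    then have "act A (act V e) = (\<lambda>t i. 0)"
      using act_inverse(2)[OF UV(1) act_trajectories[OF A, of "act V e"]] by simp
    then have "act V e \<in> kernel_behavior n A" using c by (simp add: kernel_behavior_def)
    moreover have "act V e t = x t" if "t \<le> T - (N1 + N2)" for t
    proof -
      have "act V e t = act V y t"
        by (rule N2(2)[of "T - N1"]) (use that in \<open>auto simp: e_def z(2)\<close>)
      then show ?thesis unfolding y_def act_inverse(1)[OF UV(2) x(1)] .
    qed
    ultimately show ?thesis by blast
  qed
  then show ?thesis using N1(1) N2(1) by (intro exI[of _ "N1 + N2"]) auto
qed

text \<open>The same with past and future exchanged: the defect is supported in the past and is removed by a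
  backward solution.\<close>

lemma kernel_extends_future:
  assumes A: "A \<in> carrier_mat m n" and x: "x \<in> trajectories n" "\<forall>t\<ge>T. act A x t = (\<lambda>i. 0)"
  shows "\<exists>z\<in>kernel_behavior n A. \<exists>T'. \<forall>t\<ge>T'. z t = x t"
proof -
  obtain U U' V V' r d where UV: "mutually_inverse m U U'" "mutually_inverse n V V'"
    and r: "r \<le> m" "r \<le> n" and d: "\<And>i. i < r \<Longrightarrow> d i \<noteq> 0"
    and D: "\<And>w. act U (act A (act V w)) = (\<lambda>t i. if i < r then poly_act (d i) (\<lambda>t. w t i) t else 0)"
    and D': "\<And>w. w \<in> trajectories n \<Longrightarrow>
       act U (act A w) = (\<lambda>t i. if i < r then poly_act (d i) (\<lambda>t. act V' w t i) t else 0)"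
    using diagonal_form[OF A] by blast
  have c: "V \<in> carrier_mat n n" "V' \<in> carrier_mat n n" using UV by (auto simp: mutually_inverse_def)
  define y where "y = act V' x"
  have y: "y \<in> trajectories n" using c by (simp add: y_def)
  have dy: "poly_act (d i) (\<lambda>t. y t i) t = 0" if "i < r" "t \<ge> T" for i t
  proof -
    have "act U (act A x) t = act U (\<lambda>t i. 0) t"
      by (rule act_cong_after[of T]) (use x(2) that in auto)
    then have "act U (act A x) t i = 0" by simp
    then show ?thesis using that(1) by (simp add: D'[OF x(1)] y_def)
  qed
  have "\<exists>z. poly_act (d i) z = poly_act (d i) (\<lambda>t. y t i) \<and> (\<forall>t\<ge>T + int (degree (d i)). z t = 0)"
    if "i < r" for i
    by (rule poly_act_solve_backward) (use d[OF that] dy[OF that] in auto)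
  then obtain z where z: "\<And>i. i < r \<Longrightarrow> poly_act (d i) (z i) = poly_act (d i) (\<lambda>t. y t i)"
    "\<And>i t. i < r \<Longrightarrow> t \<ge> T + int (degree (d i)) \<Longrightarrow> z i t = 0" by metis
  define T' where "T' = T + int (\<Sum>i<r. degree (d i))"
  have T': "z i t = 0" if "i < r" "t \<ge> T'" for i t
  proof -
    have "degree (d i) \<le> (\<Sum>i<r. degree (d i))"
      using that(1) by (intro member_le_sum) auto
    then have "int (degree (d i)) \<le> int (\<Sum>i<r. degree (d i))" by (rule of_nat_mono)
    then show ?thesis using that unfolding T'_def by (intro z(2)) linarith+
  qed
  define e where "e = (\<lambda>t i. y t i - (if i < r then z i t else 0))"
  have e: "e \<in> trajectories n" using y r by (auto simp: e_def trajectories_iff)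
  have "act U (act A (act V e)) = (\<lambda>t i. 0)"
    unfolding D by (auto simp: e_def poly_act_minus z(1) fun_eq_iff)
  then have "act A (act V e) = (\<lambda>t i. 0)"
    using act_inverse(2)[OF UV(1) act_trajectories[OF A, of "act V e"]] by simp
  then have "act V e \<in> kernel_behavior n A" using c by (simp add: kernel_behavior_def)
  moreover have "act V e t = x t" if "t \<ge> T'" for t
  proof -
    have "act V e t = act V y t"
      by (rule act_cong_after[of T']) (use that in \<open>auto simp: e_def T'\<close>)
    then show ?thesis unfolding y_def act_inverse(1)[OF UV(2) x(1)] .
  qed
  ultimately show ?thesis by blast
qed

text \<open>In diagonal coordinates the solvability conditions are that the coordinates of the right-hand side
  belonging to zero rows vanish.\<close>

lemma image_is_kernel:
  assumes A: "A \<in> carrier_mat m n"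
  shows "\<exists>s S. S \<in> carrier_mat s m \<and>
    (\<forall>y\<in>trajectories m. (\<exists>w\<in>trajectories n. act A w = y) \<longleftrightarrow> act S y = (\<lambda>t i. 0))"
proof -
  obtain U U' V V' r d where UV: "mutually_inverse m U U'" "mutually_inverse n V V'"
    and r: "r \<le> m" "r \<le> n" and d: "\<And>i. i < r \<Longrightarrow> d i \<noteq> 0"
    and D: "\<And>w. act U (act A (act V w)) = (\<lambda>t i. if i < r then poly_act (d i) (\<lambda>t. w t i) t else 0)"
    and D': "\<And>w. w \<in> trajectories n \<Longrightarrow>
       act U (act A w) = (\<lambda>t i. if i < r then poly_act (d i) (\<lambda>t. act V' w t i) t else 0)"
    using diagonal_form[OF A] by blast
  have c: "U \<in> carrier_mat m m" "V \<in> carrier_mat n n" using UV by (auto simp: mutually_inverse_def)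
  define S where "S = block_rows r (m - r) U"
  have S: "S \<in> carrier_mat (m - r) m" unfolding S_def using c by (intro block_rows_carrier)
  have Sact: "act S y = (\<lambda>t i. if i < m - r then act U y t (r + i) else 0)" for y
    unfolding S_def using c r by (intro act_block_rows) auto
  have "(\<exists>w\<in>trajectories n. act A w = y) \<longleftrightarrow> act S y = (\<lambda>t i. 0)" if y: "y \<in> trajectories m" for y
  proof
    assume "\<exists>w\<in>trajectories n. act A w = y"
    then obtain w where w: "w \<in> trajectories n" "y = act A w" by blast
    have "act U y t (r + i) = 0" for t i unfolding w(2) D'[OF w(1)] by simp
    then show "act S y = (\<lambda>t i. 0)" unfolding Sact by (auto simp: fun_eq_iff)
  next
    assume S0: "act S y = (\<lambda>t i. 0)"
    have U0: "act U y t i = 0" if "i \<ge> r" for t i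
    proof (cases "i < m")
      case True
      then have "i - r < m - r" "r + (i - r) = i" using that by auto
      then show ?thesis using fun_cong[OF fun_cong[OF S0], of t "i - r"] by (simp add: Sact)
    next
      case False
      then show ?thesis using act_trajectories[OF c(1), of y] by (simp add: trajectories_iff)
    qed
    have "\<forall>i. \<exists>s. i < r \<longrightarrow> poly_act (d i) s = (\<lambda>t. act U y t i)" using poly_act_surj d by metis
    then obtain s where s: "\<And>i. i < r \<Longrightarrow> poly_act (d i) (s i) = (\<lambda>t. act U y t i)" by metis
    have "act U (act A (act V (\<lambda>t i. s i t))) = act U y"
      unfolding D using U0 by (auto simp: fun_eq_iff s)
    then have "act A (act V (\<lambda>t i. s i t)) = y"
      using act_inverse_eq[OF UV(1) act_trajectories[OF A] y] by simp
    then show "\<exists>w\<in>trajectories n. act A w = y" using act_trajectories[OF c(2)] by blast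
  qed
  then show ?thesis using S by blast
qed

text \<open>Elimination of variables; in particular the controlled behavior is again complete.\<close>

lemma projection_is_kernel:
  assumes H: "H \<in> carrier_mat h n" and P: "P \<in> carrier_mat r n"
  shows "\<exists>s Q. Q \<in> carrier_mat s r \<and> act P ` kernel_behavior n H = kernel_behavior r Q"
proof -
  obtain s S where S: "S \<in> carrier_mat s (h + r)"
    "\<And>y. y \<in> trajectories (h + r) \<Longrightarrow>
       (\<exists>b\<in>trajectories n. act (stack H P) b = y) \<longleftrightarrow> act S y = (\<lambda>t i. 0)"
    using image_is_kernel[OF stack_carrier[OF H P]] by blast
  define E :: "real poly mat" where "E = stack (0\<^sub>m h r) (1\<^sub>m r)"
  have E: "E \<in> carrier_mat (h + r) r" unfolding E_def by (intro stack_carrier) auto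
  have Eact: "act E w = (\<lambda>t i. if i < h then 0 else w t (i - h))" if "w \<in> trajectories r" for w
  proof -
    have "act (0\<^sub>m h r) w = (\<lambda>t i. 0)" by (simp add: act_def fun_eq_iff)
    then show ?thesis
      unfolding E_def act_stack[OF zero_carrier_mat one_carrier_mat] act_one[OF that] by (simp only:)
  qed
  have "w \<in> act P ` kernel_behavior n H \<longleftrightarrow> w \<in> kernel_behavior r (S * E)" for w
  proof (cases "w \<in> trajectories r")
    case True
    have "w \<in> act P ` kernel_behavior n H \<longleftrightarrow>
        (\<exists>b\<in>trajectories n. act H b = (\<lambda>t i. 0) \<and> act P b = w)"
      by (auto simp: kernel_behavior_def image_iff)
    also have "\<dots> \<longleftrightarrow> (\<exists>b\<in>trajectories n. act (stack H P) b = act E w)"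
      unfolding Eact[OF True] act_stack_eq_iff[OF H P trajectories_zero] ..
    also have "\<dots> \<longleftrightarrow> act S (act E w) = (\<lambda>t i. 0)"
      by (rule S(2)) (rule act_trajectories[OF E])
    also have "\<dots> \<longleftrightarrow> w \<in> kernel_behavior r (S * E)"
      using True by (simp add: kernel_behavior_def act_mult[OF S(1) E])
    finally show ?thesis .
  next
    case False
    then show ?thesis using act_trajectories[OF P] by (auto simp: kernel_behavior_def)
  qed
  then show ?thesis using mult_carrier_mat[OF S(1) E] by blast
qed

text \<open>A coordinate that is free, or governed by an unstable polynomial, would contribute trajectories to
  the kernel that do not tend to 0.\<close>

lemma stable_diagonal_form:
  fixes A :: "real poly mat"
  assumes A: "A \<in> carrier_mat m n"
    and stable: "\<And>w. w \<in> kernel_behavior n A \<Longrightarrow> (w \<longlongrightarrow> (\<lambda>i. 0)) at_top"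
  obtains U U' V V' d where "mutually_inverse m U U'" "mutually_inverse n V V'" "n \<le> m"
    "\<And>i. i < n \<Longrightarrow> d i \<noteq> 0" "\<And>i. i < n \<Longrightarrow> stable_poly (d i)"
    "\<And>w. act U (act A (act V w)) = (\<lambda>t i. if i < n then poly_act (d i) (\<lambda>t. w t i) t else 0)"
    "\<And>w. w \<in> trajectories n \<Longrightarrow>
       act U (act A w) = (\<lambda>t i. if i < n then poly_act (d i) (\<lambda>t. act V' w t i) t else 0)"
proof -
  obtain U U' V V' r d where UV: "mutually_inverse m U U'" "mutually_inverse n V V'"
    and r: "r \<le> m" "r \<le> n" and d: "\<And>i. i < r \<Longrightarrow> d i \<noteq> 0"
    and D: "\<And>w. act U (act A (act V w)) = (\<lambda>t i. if i < r then poly_act (d i) (\<lambda>t. w t i) t else 0)"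
    and D': "\<And>w. w \<in> trajectories n \<Longrightarrow>
       act U (act A w) = (\<lambda>t i. if i < r then poly_act (d i) (\<lambda>t. act V' w t i) t else 0)"
    using diagonal_form[OF A] by blast
  have c: "V \<in> carrier_mat n n" using UV by (auto simp: mutually_inverse_def)
  have coord: "(s \<longlongrightarrow> 0) at_top" if i: "i < n" and s: "i < r \<Longrightarrow> poly_act (d i) s = (\<lambda>t. 0)" for i s
  proof -
    define v :: trajectory where "v = (\<lambda>t j. if j = i then s t else 0)"
    have v: "v \<in> trajectories n" using i by (auto simp: v_def trajectories_iff)
    have "(\<lambda>t. v t j) = (if j = i then s else (\<lambda>t. 0))" for j by (auto simp: v_def)
    then have "act U (act A (act V v)) = (\<lambda>t i. 0)"
      unfolding D using s by (auto simp: fun_eq_iff)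
    then have "act A (act V v) = (\<lambda>t i. 0)"
      using act_inverse(2)[OF UV(1) act_trajectories[OF A, of "act V v"]] by simp
    then have "act V v \<in> kernel_behavior n A" using c by (simp add: kernel_behavior_def)
    then have "(act V' (act V v) \<longlongrightarrow> (\<lambda>i. 0)) at_top" by (intro act_tendsto_0 stable)
    then have "(v \<longlongrightarrow> (\<lambda>i. 0)) at_top" unfolding act_inverse(2)[OF UV(2) v] .
    then have "((\<lambda>t. v t i) \<longlongrightarrow> 0) at_top" unfolding tendsto_fun_iff by blast
    then show ?thesis by (simp add: v_def)
  qed
  have rn: "r = n"
  proof (rule ccontr)
    assume "r \<noteq> n"
    then have "((\<lambda>t::int. 1::real) \<longlongrightarrow> 0) at_top" using r coord[of r "\<lambda>t. 1"] by simp
    then show False by (simp add: tendsto_const_iff)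
  qed
  have "stable_poly (d i)" if "i < n" for i
    unfolding stable_poly_def using coord[OF that] by blast
  with that[OF UV _ _ _ D[unfolded rn] D'[unfolded rn]] r(1) d show thesis unfolding rn by blast
qed

text \<open>The hypothesis on \<open>w\<close> says that its translate of the kernel is time-invariant.  Since 1 is not a root
  of the stable polynomials \<open>d i\<close>, each of them is coprime to \<open>x - 1\<close>, and the shift minus the identity
  is invertible on the kernel.  So the increments of \<open>w\<close> can be compensated within the kernel.\<close>

lemma stable_translate_contains_constant:
  assumes Q: "Q \<in> carrier_mat s n"
    and stable: "\<And>w. w \<in> kernel_behavior n Q \<Longrightarrow> (w \<longlongrightarrow> (\<lambda>i. 0)) at_top"
    and w: "w \<in> trajectories n" and dw: "(\<lambda>t i. w (t + 1) i - w t i) \<in> kernel_behavior n Q"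
  shows "\<exists>w0\<in>translate w (kernel_behavior n Q). constant_trajectory w0"
proof -
  obtain U U' V V' d where UV: "mutually_inverse s U U'" "mutually_inverse n V V'" "n \<le> s"
    and d: "\<And>i. i < n \<Longrightarrow> d i \<noteq> 0" "\<And>i. i < n \<Longrightarrow> stable_poly (d i)"
    and D: "\<And>w. act U (act Q (act V w)) = (\<lambda>t i. if i < n then poly_act (d i) (\<lambda>t. w t i) t else 0)"
    and D': "\<And>w. w \<in> trajectories n \<Longrightarrow>
       act U (act Q w) = (\<lambda>t i. if i < n then poly_act (d i) (\<lambda>t. act V' w t i) t else 0)"
    using stable_diagonal_form[OF Q stable] by blast
  have c: "V \<in> carrier_mat n n" "V' \<in> carrier_mat n n" using UV by (auto simp: mutually_inverse_def)
  define v where "v = act V' w"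
  have v: "v \<in> trajectories n" using c by (simp add: v_def)
  define e where "e = (\<lambda>i t. v (t + 1) i - v t i)"
  have "act V' (\<lambda>t i. w (t + 1) i - w t i) = (\<lambda>t i. v (t + 1) i - v t i)"
    using act_shift[of V' 1 w] by (simp add: act_diff time_shift_def v_def)
  then have de: "poly_act (d i) (e i) = (\<lambda>t. 0)" if "i < n" for i
    using fun_cong[OF fun_cong[OF D'[OF kernelD(1)[OF dw]]], of _ i] kernelD(2)[OF dw] that
    by (simp add: e_def fun_eq_iff)
  have "\<exists>s. poly_act (d i) s = (\<lambda>t. 0) \<and> (\<forall>t. v (t + 1) i + s (t + 1) = v t i + s t)" if i: "i < n" for i
  proof -
    define a where "a = poly (d i) 1"
    have a: "a \<noteq> 0" using stable_poly_at_1[OF d(2)[OF i]] by (simp add: a_def)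
    \<comment> \<open>the Bezout identity for \<open>d i\<close> and \<open>x - 1\<close>\<close>
    have "poly (d i - [:a:]) 1 = 0" by (simp add: a_def)
    then obtain q where q: "d i - [:a:] = [:- 1, 1:] * q" by (metis poly_eq_0_iff_dvd dvdE)
    define s where "s = (\<lambda>t. inverse a * poly_act q (e i) t)"
    have "poly_act (d i) s t = inverse a * poly_act q (poly_act (d i) (e i)) t" for t
      unfolding s_def poly_act_scale poly_act_mult[symmetric] by (simp add: mult.commute)
    then have "poly_act (d i) s = (\<lambda>t. 0)" using de[OF i] by auto
    moreover have "v (t + 1) i + s (t + 1) = v t i + s t" for t
    proof -
      have "poly_act q (e i) (t + 1) - poly_act q (e i) t = poly_act (d i - [:a:]) (e i) t"
        unfolding q poly_act_mult by (simp add: poly_act_pCons)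
      also have "\<dots> = - a * e i t" using de[OF i] by (simp add: poly_act_diff poly_act_const)
      finally have "s (t + 1) - s t = - e i t"
        using a by (simp add: s_def right_diff_distrib[symmetric])
      then show ?thesis by (simp add: e_def)
    qed
    ultimately show ?thesis by blast
  qed
  then obtain s where s: "\<And>i. i < n \<Longrightarrow> poly_act (d i) (s i) = (\<lambda>t. 0)"
    "\<And>i t. i < n \<Longrightarrow> v (t + 1) i + s i (t + 1) = v t i + s i t" by metis
  define x where "x = (\<lambda>t i. if i < n then s i t else 0)"
  define y where "y = (\<lambda>t i. v t i + x t i)"
  have x: "x \<in> trajectories n" by (simp add: x_def trajectories_iff)
  have step: "y (t + 1) = y t" for t
    using s(2) v by (auto simp: y_def x_def fun_eq_iff trajectories_iff)
  have const: "y t = y 0" for t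
  proof (induction t rule: int_induct[of _ 0])
    case (step2 i)
    then show ?case using step[of "i - 1"] by simp
  qed (use step in auto)
  have "act U (act Q (act V x)) = (\<lambda>t i. 0)"
    unfolding D by (auto simp: x_def s(1) fun_eq_iff)
  then have "act Q (act V x) = (\<lambda>t i. 0)"
    using act_inverse(2)[OF UV(1) act_trajectories[OF Q, of "act V x"]] by simp
  then have "act V x \<in> kernel_behavior n Q" using c by (simp add: kernel_behavior_def)
  moreover have "act V y = (\<lambda>t i. w t i + act V x t i)"
    unfolding y_def act_add v_def act_inverse(1)[OF UV(2) w] ..
  ultimately have "act V y \<in> translate w (kernel_behavior n Q)" by (simp add: mem_translate)
  moreover have "constant_trajectory (act V y)"
  proof -
    have shift_y: "time_shift \<tau> y = y" for \<tau>
    proof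
      fix t show "time_shift \<tau> y t = y t"
        unfolding time_shift_def const[of "t + \<tau>"] const[of t] ..
    qed
    show ?thesis
      unfolding constant_trajectory_def act_shift[symmetric] shift_y by simp
  qed
  ultimately show ?thesis by blast
qed

section \<open>A stabilizing constraint on the control variables\<close>

lemma solve_diagonal:
  assumes "\<And>i. i < r \<Longrightarrow> d i \<noteq> (0::real poly)"
  shows "\<exists>v\<in>trajectories r. \<forall>i<r. \<forall>t. poly_act (d i) (\<lambda>t. v t i) t = y t i"
proof -
  have "\<forall>i. \<exists>s. i < r \<longrightarrow> poly_act (d i) s = (\<lambda>t. y t i)" using poly_act_surj assms by metis
  then obtain s where s: "\<And>i. i < r \<Longrightarrow> poly_act (d i) (s i) = (\<lambda>t. y t i)" by metis
  have "(\<lambda>t i. if i < r then s i t else 0) \<in> trajectories r" by (simp add: trajectories_iff)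
  moreover have "poly_act (d i) (\<lambda>t. if i < r then s i t else 0) t = y t i" if "i < r" for i t
    using s[OF that] that by simp
  ultimately show ?thesis by (intro bexI[of _ "\<lambda>t i. if i < r then s i t else 0"]) auto
qed

lemma trajectories_eq_zero_iff:
  assumes "w \<in> trajectories n"
  shows "w = (\<lambda>t i. 0) \<longleftrightarrow> (\<forall>t i. i < n \<longrightarrow> w t i = 0)"
proof
  assume *: "\<forall>t i. i < n \<longrightarrow> w t i = 0"
  show "w = (\<lambda>t i. 0)"
  proof (intro ext)
    fix t i show "w t i = 0" using * assms by (cases "i < n") (auto simp: trajectories_iff)
  qed
qed simp

text \<open>The controller design.  Detectability makes \<open>Gw\<close> equivalent to a stable diagonal operator, so the
  system reads \<open>D1 w = - N1 c\<close>, \<open>M c = 0\<close>, and \<open>w\<close> tends to 0 as soon as \<open>N1 c\<close> does.  The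
  diagonal form of \<open>M\<close> splits \<open>c\<close> into autonomous and free coordinates, and that of the action of
  the free coordinates on \<open>N1 c\<close> yields coordinates \<open>Q c\<close> of \<open>N1 c\<close>, of which the first \<open>p\<close> can be
  assigned at will while the others are autonomous.  The constraint \<open>K c = 0\<close> sets the former to 0.
  The latter decay by themselves: they are determined by their past, and stabilizability provides a
  decaying trajectory with the same past.\<close>

lemma stabilizing_constraint:
  assumes Gw: "Gw \<in> carrier_mat g r" and Gc: "Gc \<in> carrier_mat g k"
    and det: "\<And>w. w \<in> kernel_behavior r Gw \<Longrightarrow> (w \<longlongrightarrow> (\<lambda>i. 0)) at_top"
  defines "sys \<equiv> \<lambda>w c. w \<in> trajectories r \<and> c \<in> trajectories k \<and>
      (\<forall>t i. act Gw w t i + act Gc c t i = 0)"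
  assumes stab: "\<And>w c. sys w c \<Longrightarrow> \<exists>w' c'. sys w' c' \<and> (\<forall>t\<le>0. w' t = w t) \<and> (w' \<longlongrightarrow> (\<lambda>i. 0)) at_top"
  shows "\<exists>p K. K \<in> carrier_mat p k \<and> (\<forall>y\<in>trajectories p. \<exists>w c. sys w c \<and> act K c = y) \<and>
    (\<forall>w c. sys w c \<and> act K c = (\<lambda>t i. 0) \<longrightarrow> (w \<longlongrightarrow> (\<lambda>i. 0)) at_top)"
proof -
  obtain U U' V V' d where UV: "mutually_inverse g U U'" "mutually_inverse r V V'" and rg: "r \<le> g"
    and d: "\<And>i. i < r \<Longrightarrow> d i \<noteq> 0" "\<And>i. i < r \<Longrightarrow> stable_poly (d i)"
    and D: "\<And>w. act U (act Gw (act V w)) = (\<lambda>t i. if i < r then poly_act (d i) (\<lambda>t. w t i) t else 0)"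
    and D': "\<And>w. w \<in> trajectories r \<Longrightarrow>
       act U (act Gw w) = (\<lambda>t i. if i < r then poly_act (d i) (\<lambda>t. act V' w t i) t else 0)"
    using stable_diagonal_form[OF Gw det] by blast
  have c: "U \<in> carrier_mat g g" "V \<in> carrier_mat r r" "V' \<in> carrier_mat r r"
    using UV by (auto simp: mutually_inverse_def)
  define N1 where "N1 = block_rows 0 r (U * Gc)"
  define M where "M = block_rows r (g - r) (U * Gc)"
  define D1 where "D1 = block_rows 0 r (U * Gw)"
  have N1: "N1 \<in> carrier_mat r k" and M: "M \<in> carrier_mat (g - r) k" and D1: "D1 \<in> carrier_mat r r"
    unfolding N1_def M_def D1_def using c Gc Gw by (auto intro!: block_rows_carrier)
  have UGc: "act (U * Gc) x = act U (act Gc x)" for x by (rule act_mult[OF c(1) Gc])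
  have rows: "0 + r \<le> dim_row (U * Gc)" "r + (g - r) \<le> dim_row (U * Gc)" "0 + r \<le> dim_row (U * Gw)"
    using c rg by auto
  have N1act: "act N1 x = (\<lambda>t i. if i < r then act U (act Gc x) t i else 0)" for x
    unfolding N1_def act_block_rows[OF rows(1)] UGc add_0 by (rule refl)
  have Mact: "act M x = (\<lambda>t i. if i < g - r then act U (act Gc x) t (r + i) else 0)" for x
    unfolding M_def act_block_rows[OF rows(2)] UGc by (rule refl)
  have D1act: "act D1 w = (\<lambda>t i. if i < r then poly_act (d i) (\<lambda>t. act V' w t i) t else 0)"
    if "w \<in> trajectories r" for w
    unfolding D1_def act_block_rows[OF rows(3)] act_mult[OF c(1) Gw] D'[OF that] by (simp add: fun_eq_iff)
  \<comment> \<open>the first \<open>r\<close> rows of the system, and the remaining ones, which restrict \<open>c\<close> alone\<close>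
  have sys_iff: "sys w x \<longleftrightarrow> w \<in> trajectories r \<and> x \<in> trajectories k \<and>
      act N1 x = (\<lambda>t i. - act D1 w t i) \<and> act M x = (\<lambda>t i. 0)" for w x
  proof (cases "w \<in> trajectories r \<and> x \<in> trajectories k")
    case True
    let ?s = "\<lambda>t i. act Gw w t i + act Gc x t i"
    have "?s \<in> trajectories g" using act_trajectories[OF Gw] act_trajectories[OF Gc] by (rule trajectories_add)
    then have "?s = (\<lambda>t i. 0) \<longleftrightarrow> act U ?s = (\<lambda>t i. 0)"
      using act_inverse_eq[OF UV(1), of ?s "\<lambda>t i. 0"] by simp
    also have "\<dots> \<longleftrightarrow> (\<forall>t i. i < g \<longrightarrow> act U (act Gw w) t i + act U (act Gc x) t i = 0)"
      unfolding act_add using trajectories_add[OF act_trajectories[OF c(1)] act_trajectories[OF c(1)]]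
      by (rule trajectories_eq_zero_iff)
    also have "\<dots> \<longleftrightarrow> (\<forall>t i. i < r \<longrightarrow> act N1 x t i = - act D1 w t i) \<and>
        (\<forall>t i. r \<le> i \<longrightarrow> i < g \<longrightarrow> act M x t (i - r) = 0)"
    proof -
      let ?P = "\<lambda>t i. act U (act Gw w) t i + act U (act Gc x) t i = 0"
      have upper: "?P t i \<longleftrightarrow> act N1 x t i = - act D1 w t i" if "i < r" for t i
        using that unfolding N1act D'[OF conjunct1[OF True]] D1act[OF conjunct1[OF True]]
        by (simp add: eq_neg_iff_add_eq_0 add.commute)
      have lower: "?P t i \<longleftrightarrow> act M x t (i - r) = 0" if "r \<le> i" "i < g" for t i
        using that unfolding Mact D'[OF conjunct1[OF True]] by simp
      have "(\<forall>t i. i < g \<longrightarrow> P t i) \<longleftrightarrow> (\<forall>t i. i < r \<longrightarrow> P t i) \<and> (\<forall>t i. r \<le> i \<longrightarrow> i < g \<longrightarrow> P t i)"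
        for P :: "int \<Rightarrow> nat \<Rightarrow> bool"
        using rg by (meson le_less_linear less_le_trans)
      then show ?thesis using upper lower by (simp cong: imp_cong)
    qed
    also have "(\<forall>t i. i < r \<longrightarrow> act N1 x t i = - act D1 w t i) \<longleftrightarrow> act N1 x = (\<lambda>t i. - act D1 w t i)"
      using D1act[OF conjunct1[OF True]] N1act[of x] by (auto simp: fun_eq_iff)
    also have "(\<forall>t i. r \<le> i \<longrightarrow> i < g \<longrightarrow> act M x t (i - r) = 0) \<longleftrightarrow> act M x = (\<lambda>t i. 0)"
    proof
      assume *: "\<forall>t i. r \<le> i \<longrightarrow> i < g \<longrightarrow> act M x t (i - r) = 0"
      show "act M x = (\<lambda>t i. 0)"
      proof (intro ext)
        fix t i show "act M x t i = 0"
          using *[rule_format, of "r + i" t] Mact[of x] by (cases "i < g - r") auto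
      qed
    qed auto
    finally show ?thesis using True by (auto simp: sys_def fun_eq_iff)
  qed (auto simp: sys_def)

  obtain U2 U2' V2 V2' a e where UV2: "mutually_inverse (g - r) U2 U2'" "mutually_inverse k V2 V2'"
    and a: "a \<le> g - r" "a \<le> k" and e: "\<And>i. i < a \<Longrightarrow> e i \<noteq> 0"
    and "\<And>w. act U2 (act M (act V2 w)) = (\<lambda>t i. if i < a then poly_act (e i) (\<lambda>t. w t i) t else 0)"
    and D2': "\<And>w. w \<in> trajectories k \<Longrightarrow>
       act U2 (act M w) = (\<lambda>t i. if i < a then poly_act (e i) (\<lambda>t. act V2' w t i) t else 0)"
    using diagonal_form[OF M] by blast
  have c2: "V2 \<in> carrier_mat k k" "V2' \<in> carrier_mat k k" using UV2 by (auto simp: mutually_inverse_def)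
  have M_iff: "act M x = (\<lambda>t i. 0) \<longleftrightarrow> (\<forall>j<a. poly_act (e j) (\<lambda>t. act V2' x t j) = (\<lambda>t. 0))"
    if "x \<in> trajectories k" for x
  proof -
    have "act M x = (\<lambda>t i. 0) \<longleftrightarrow> act U2 (act M x) = (\<lambda>t i. 0)"
      using act_inverse_eq[OF UV2(1) act_trajectories[OF M, of x] trajectories_zero] by simp
    then show ?thesis unfolding D2'[OF that] by (auto simp: fun_eq_iff)
  qed
  \<comment> \<open>\<open>Z\<close> retains the coordinates of \<open>c\<close> that the equation \<open>M c = 0\<close> leaves free\<close>
  define Z :: "real poly mat" where "Z = mat k k (\<lambda>(i, j). if i = j \<and> a \<le> i then 1 else 0)"
  have Z: "Z \<in> carrier_mat k k" by (simp add: Z_def)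
  have Zact: "act Z x = (\<lambda>t i. if a \<le> i \<and> i < k then x t i else 0)" for x
  proof (intro ext)
    fix t i
    show "act Z x t i = (if a \<le> i \<and> i < k then x t i else 0)"
    proof (cases "i < k")
      case True
      have "act Z x t i = (\<Sum>j<k. poly_act (Z $$ (i, j)) (\<lambda>t. x t j) t)"
        using Z True by (simp add: act_def)
      also have "\<dots> = (\<Sum>j<k. if j = i then if a \<le> i then x t i else 0 else 0)"
        by (rule sum.cong) (use True in \<open>auto simp: Z_def\<close>)
      finally show ?thesis using True by simp
    qed (use Z in \<open>simp add: act_def\<close>)
  qed
  define N2 where "N2 = N1 * V2 * Z"
  have N2: "N2 \<in> carrier_mat r k" unfolding N2_def using N1 c2 Z by (metis mult_carrier_mat)
  have N2act: "act N2 x = act N1 (act V2 (act Z x))" for x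
    unfolding N2_def using act_mult[OF mult_carrier_mat[OF N1 c2(1)] Z] act_mult[OF N1 c2(1)] by simp

  obtain U3 U3' V3 V3' p f where UV3: "mutually_inverse r U3 U3'" "mutually_inverse k V3 V3'"
    and p: "p \<le> r" "p \<le> k" and f: "\<And>i. i < p \<Longrightarrow> f i \<noteq> 0"
    and D3: "\<And>w. act U3 (act N2 (act V3 w)) = (\<lambda>t i. if i < p then poly_act (f i) (\<lambda>t. w t i) t else 0)"
    and D3': "\<And>w. w \<in> trajectories k \<Longrightarrow>
       act U3 (act N2 w) = (\<lambda>t i. if i < p then poly_act (f i) (\<lambda>t. act V3' w t i) t else 0)"
    using diagonal_form[OF N2] by blast
  have c3: "U3 \<in> carrier_mat r r" "U3' \<in> carrier_mat r r" "V3 \<in> carrier_mat k k"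
    using UV3 by (auto simp: mutually_inverse_def)
  define Q where "Q = U3 * N1"
  have Q: "Q \<in> carrier_mat r k" unfolding Q_def using c3 N1 by simp
  have Qact: "act Q x = act U3 (act N1 x)" for x unfolding Q_def by (rule act_mult[OF c3(1) N1])
  define K where "K = block_rows 0 p Q"
  have K: "K \<in> carrier_mat p k" unfolding K_def using Q by (rule block_rows_carrier)
  have Kact: "act K x = (\<lambda>t i. if i < p then act Q x t i else 0)" for x
  proof -
    have "0 + p \<le> dim_row Q" using Q p by simp
    then show ?thesis unfolding K_def by (simp only: act_block_rows add_0)
  qed

  have onto: "\<exists>w x. sys w x \<and> act K x = y" if y: "y \<in> trajectories p" for y
  proof -
    obtain s where s: "\<And>i t. i < p \<Longrightarrow> poly_act (f i) (\<lambda>t. s t i) t = y t i"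
      using solve_diagonal[of p f y] f by blast
    define z where "z = act Z (act V3 s)"
    define x where "x = act V2 z"
    have z: "z \<in> trajectories k" unfolding z_def using Z by simp
    have x: "x \<in> trajectories k" unfolding x_def using c2 by simp
    have "act V2' x = z" unfolding x_def by (rule act_inverse(2)[OF UV2(2) z])
    then have Mx: "act M x = (\<lambda>t i. 0)" unfolding M_iff[OF x] by (simp add: z_def Zact)
    have "act Q x = y"
      unfolding Qact x_def z_def N2act[symmetric] D3 using s y
      by (auto simp: fun_eq_iff trajectories_iff)
    then have Kx: "act K x = y" unfolding Kact using y by (auto simp: fun_eq_iff trajectories_iff)
    obtain v where v: "v \<in> trajectories r"
      "\<And>i t. i < r \<Longrightarrow> poly_act (d i) (\<lambda>t. v t i) t = - act N1 x t i"
      using solve_diagonal[of r d "\<lambda>t i. - act N1 x t i"] d by blast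
    have w: "act V v \<in> trajectories r" using c by simp
    have "act N1 x = (\<lambda>t i. - act D1 (act V v) t i)"
      unfolding D1act[OF w] act_inverse(2)[OF UV(2) v(1)]
      using v(2) by (auto simp: fun_eq_iff N1act)
    then have "sys (act V v) x" unfolding sys_iff using w x Mx by blast
    then show ?thesis using Kx by blast
  qed

  \<comment> \<open>one polynomial that annihilates all autonomous coordinates of \<open>c\<close>\<close>
  define \<delta> where "\<delta> = (\<Prod>j<a. e j)"
  have \<delta>0: "\<delta> \<noteq> 0" unfolding \<delta>_def using e by simp
  have autonomous: "poly_act \<delta> (\<lambda>t. act Q x t i) = (\<lambda>t. 0)"
    if x: "x \<in> trajectories k" "act M x = (\<lambda>t i. 0)" and i: "p \<le> i" for x i
  proof -
    define z where "z = act V2' x"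
    have z: "z \<in> trajectories k" unfolding z_def using c2 by simp
    define za where "za = (\<lambda>t i. z t i - act Z z t i)"
    have za: "poly_act \<delta> (\<lambda>t. za t j) = (\<lambda>t. 0)" for j
    proof (cases "j < a")
      case True
      then have "\<delta> = (\<Prod>j\<in>{..<a} - {j}. e j) * e j"
        unfolding \<delta>_def by (subst prod.remove[of _ j]) (auto simp: mult.commute)
      moreover have "(\<lambda>t. za t j) = (\<lambda>t. act V2' x t j)" using True by (simp add: za_def Zact z_def)
      moreover have "poly_act (e j) (\<lambda>t. act V2' x t j) = (\<lambda>t. 0)" using x True M_iff by blast
      ultimately have "poly_act \<delta> (\<lambda>t. za t j) t = 0" for t
        by (simp only: poly_act_mult poly_act_zero)
      then show ?thesis by (rule ext)
    next
      case False
      then have "(\<lambda>t. za t j) = (\<lambda>t. 0)" using z by (auto simp: za_def Zact trajectories_iff)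
      then show ?thesis by simp
    qed
    have "x = act V2 z" unfolding z_def act_inverse(1)[OF UV2(2) x(1)] ..
    also have "z = (\<lambda>t i. za t i + act Z z t i)" by (simp add: za_def)
    finally have x_eq: "x = (\<lambda>t i. act V2 za t i + act V2 (act Z z) t i)" by (simp only: act_add)
    have "act Q x t i = act (Q * V2) za t i + act U3 (act N2 z) t i" for t
      by (subst x_eq) (simp only: act_add act_mult[OF Q c2(1)] Qact N2act)
    then have "act Q x t i = act (Q * V2) za t i" for t using i by (simp add: D3'[OF z])
    moreover have "poly_act \<delta> (\<lambda>t. act (Q * V2) za t i) t = 0" for t
    proof (cases "i < r")
      case True
      have "poly_act \<delta> (\<lambda>t. act (Q * V2) za t i) t =
          (\<Sum>j<k. poly_act (\<delta> * (Q * V2) $$ (i, j)) (\<lambda>t. za t j) t)"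
        using True Q c2 by (simp add: act_def poly_act_sum poly_act_mult)
      also have "\<dots> = 0"
        unfolding mult.commute[of \<delta>] poly_act_mult za by simp
      finally show ?thesis .
    next
      case False
      then have "act (Q * V2) za t i = 0" for t using Q by (simp add: act_def)
      then show ?thesis by simp
    qed
    ultimately show ?thesis by (auto simp: fun_eq_iff)
  qed

  have stable: "(w \<longlongrightarrow> (\<lambda>i. 0)) at_top" if wx: "sys w x" and Kx: "act K x = (\<lambda>t i. 0)" for w x
  proof -
    obtain w' x' where wx': "sys w' x'" "\<forall>t\<le>0. w' t = w t" "(w' \<longlongrightarrow> (\<lambda>i. 0)) at_top"
      using stab[OF wx] by blast
    have y_eq: "act Q x t i = - act U3 (act D1 w) t i" if "sys w x" for w x t i
    proof -
      have "act N1 x = (\<lambda>t i. (-1) * act D1 w t i)" using that by (simp add: sys_iff)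
      then show ?thesis unfolding Qact by (simp only: act_scale)
    qed
    from act_cong_before[of "U3 * D1"] obtain N where N: "N \<ge> 0"
      "\<And>T v w t. \<forall>t\<le>T. v t = w t \<Longrightarrow> t \<le> T - N \<Longrightarrow> act (U3 * D1) v t = act (U3 * D1) w t" by metis
    \<comment> \<open>by the system equations \<open>Q c\<close> is a function of \<open>w\<close>, hence has the same past for both trajectories\<close>
    have past: "act Q x t i = act Q x' t i" if "t \<le> - N" for t i
      using N(2)[of 0 w w' t] wx'(2) that unfolding y_eq[OF wx] y_eq[OF wx'(1)] act_mult[OF c3(1) D1] by simp
    have y'0: "((\<lambda>t. act Q x' t i) \<longlongrightarrow> 0) at_top" for i
    proof -
      have "(act U3 (act D1 w') \<longlongrightarrow> (\<lambda>i. 0)) at_top" by (intro act_tendsto_0 wx'(3))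
      then have "((\<lambda>t. act U3 (act D1 w') t i) \<longlongrightarrow> 0) at_top" unfolding tendsto_fun_iff by blast
      from tendsto_minus[OF this] show ?thesis unfolding y_eq[OF wx'(1)] by simp
    qed
    have y0: "((\<lambda>t. act Q x t i) \<longlongrightarrow> 0) at_top" for i
    proof (cases "i < p")
      case True
      have "act Q x t i = 0" for t using fun_cong[OF fun_cong[OF Kx], of t i] True by (simp add: Kact)
      then show ?thesis by simp
    next
      case False
      have "poly_act \<delta> (\<lambda>t. act Q x t i - act Q x' t i) = (\<lambda>t. 0)"
        using autonomous[of x i] autonomous[of x' i] False wx wx'(1)
        by (auto simp: fun_eq_iff poly_act_minus sys_iff)
      from poly_act_autonomous[OF \<delta>0 this, of "- N"] past
      have "act Q x t i - act Q x' t i = 0" for t by simp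
      then have "(\<lambda>t. act Q x t i) = (\<lambda>t. act Q x' t i)" by auto
      then show ?thesis using y'0 by simp
    qed
    then have "(act Q x \<longlongrightarrow> (\<lambda>i. 0)) at_top" unfolding tendsto_fun_iff by blast
    then have "(act U3' (act Q x) \<longlongrightarrow> (\<lambda>i. 0)) at_top" by (rule act_tendsto_0)
    then have "(act N1 x \<longlongrightarrow> (\<lambda>i. 0)) at_top"
      unfolding Qact act_inverse(2)[OF UV3(1) act_trajectories[OF N1]] .
    then have N1x: "((\<lambda>t. act N1 x t i) \<longlongrightarrow> 0) at_top" for i unfolding tendsto_fun_iff by blast
    have w: "w \<in> trajectories r" using wx by (simp add: sys_iff)
    have "((\<lambda>t. act V' w t i) \<longlongrightarrow> 0) at_top" for i
    proof (cases "i < r")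
      case True
      have "act N1 x t i = - act D1 w t i" for t using wx by (simp add: sys_iff)
      then have "poly_act (d i) (\<lambda>t. act V' w t i) = (\<lambda>t. - act N1 x t i)"
        using True by (simp add: D1act[OF w])
      moreover have "((\<lambda>t. - act N1 x t i) \<longlongrightarrow> 0) at_top" using tendsto_minus[OF N1x] by simp
      ultimately have "(poly_act (d i) (\<lambda>t. act V' w t i) \<longlongrightarrow> 0) at_top" by (simp only:)
      then show ?thesis by (rule stable_poly_filter[OF d(2)[OF True] d(1)[OF True]])
    next
      case False
      then have "act V' w t i = 0" for t using c by (simp add: act_def)
      then show ?thesis by simp
    qed
    then have "(act V' w \<longlongrightarrow> (\<lambda>i. 0)) at_top" unfolding tendsto_fun_iff by blast
    then have "(act V (act V' w) \<longlongrightarrow> (\<lambda>i. 0)) at_top" by (rule act_tendsto_0)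
    then show ?thesis unfolding act_inverse(1)[OF UV(2) w] .
  qed
  show ?thesis using K onto stable by blast
qed

section \<open>Interconnection with a controller\<close>

definition w_matrix :: "nat \<Rightarrow> nat \<Rightarrow> real poly mat" where
  "w_matrix q k = diagonal (ref_dim q k) (q + k) (ref_dim q k) (\<lambda>_. 1)"

definition c_matrix :: "nat \<Rightarrow> nat \<Rightarrow> real poly mat" where
  "c_matrix q k = mat k (q + k) (\<lambda>(i, j). if j = q + i then 1 else 0)"

lemma w_matrix_carrier: "w_matrix q k \<in> carrier_mat (ref_dim q k) (q + k)"
  by (simp add: w_matrix_def diagonal_def)

lemma c_matrix_carrier: "c_matrix q k \<in> carrier_mat k (q + k)"
  by (simp add: c_matrix_def)

lemma ref_dim_le: "ref_dim q k \<le> q + k"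
  by (simp add: ref_dim_def)

lemma act_w_matrix:
  assumes "b \<in> trajectories (q + k)"
  shows "act (w_matrix q k) b = w_part q b"
  unfolding w_matrix_def act_diagonal[OF order_refl ref_dim_le]
  using assms by (auto simp: w_part_def ref_dim_def first_components_def trajectories_iff fun_eq_iff)

lemma act_c_matrix:
  assumes "b \<in> trajectories (q + k)"
  shows "act (c_matrix q k) b = c_part q b"
proof (intro ext)
  fix t i
  show "act (c_matrix q k) b t i = c_part q b t i"
  proof (cases "i < k")
    case True
    have "act (c_matrix q k) b t i = (\<Sum>j<q + k. poly_act (c_matrix q k $$ (i, j)) (\<lambda>t. b t j) t)"
      using True c_matrix_carrier[of q k] by (simp add: act_def)
    also have "\<dots> = (\<Sum>j<q + k. if j = q + i then b t (q + i) else 0)"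
      by (rule sum.cong) (use True in \<open>auto simp: c_matrix_def\<close>)
    finally show ?thesis using True by (simp add: c_part_def)
  next
    case False
    then show ?thesis using assms c_matrix_carrier[of q k] by (simp add: act_def c_part_def trajectories_iff)
  qed
qed

lemma c_part_trajectories: "b \<in> trajectories (q + k) \<Longrightarrow> c_part q b \<in> trajectories k"
  by (simp add: c_part_def trajectories_iff)

lemma w_part_trajectories: "b \<in> trajectories (q + k) \<Longrightarrow> w_part q b \<in> trajectories (ref_dim q k)"
  by (metis act_w_matrix act_trajectories w_matrix_carrier)

lemma c_part_add: "c_part q (\<lambda>t i. a t i + b t i) = (\<lambda>t i. c_part q a t i + c_part q b t i)"
  by (simp add: c_part_def)

lemma c_part_diff: "c_part q (\<lambda>t i. a t i - b t i) = (\<lambda>t i. c_part q a t i - c_part q b t i)"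
  by (simp add: c_part_def)

lemma w_part_add: "w_part q (\<lambda>t i. a t i + b t i) = (\<lambda>t i. w_part q a t i + w_part q b t i)"
  by (auto simp: w_part_def first_components_def fun_eq_iff)

lemma w_part_diff: "w_part q (\<lambda>t i. a t i - b t i) = (\<lambda>t i. w_part q a t i - w_part q b t i)"
  by (auto simp: w_part_def first_components_def fun_eq_iff)

lemma constant_trajectory_iff: "constant_trajectory w \<longleftrightarrow> (\<forall>t. w t = w 0)"
proof
  assume "constant_trajectory w"
  then have "time_shift t w 0 = w 0" for t by (simp add: constant_trajectory_def)
  then show "\<forall>t. w t = w 0" by (simp add: time_shift_def)
next
  assume *: "\<forall>t. w t = w 0"
  show "constant_trajectory w"
    unfolding constant_trajectory_def
  proof (intro allI ext)
    fix \<tau> t i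
    show "time_shift \<tau> w t i = w t i"
      using *[rule_format, of "t + \<tau>"] *[rule_format, of t] by (simp add: time_shift_def)
  qed
qed

lemma constant_c_part: "constant_trajectory b \<Longrightarrow> constant_trajectory (c_part q b)"
  unfolding constant_trajectory_iff c_part_def by metis

lemma constant_w_part:
  "constant_trajectory b \<Longrightarrow> constant_trajectory (w_part q b)"
  unfolding constant_trajectory_iff
proof
  fix t assume "\<forall>t. b t = b 0"
  then have "b t = b 0" by blast
  then show "w_part q b t = w_part q b 0" by (auto simp: w_part_def first_components_def fun_eq_iff)
qed

lemma tendsto_diff_fun_iff:
  "((\<lambda>t i. w t i - l i) \<longlongrightarrow> (\<lambda>i. 0)) F \<longleftrightarrow> ((w \<longlongrightarrow> l) F)" for w :: "'t \<Rightarrow> nat \<Rightarrow> real"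
  unfolding tendsto_fun_iff by (simp add: Lim_null[symmetric])

lemma tendsto_constant_trajectory:
  assumes "constant_trajectory w0"
  shows "(w \<longlongrightarrow> w0 0) at_top \<longleftrightarrow> ((\<lambda>t i. w t i - w0 t i) \<longlongrightarrow> (\<lambda>i. 0)) at_top"
proof -
  have "(\<lambda>t i. w t i - w0 t i) = (\<lambda>t i. w t i - w0 0 i)"
  proof (intro ext)
    fix t i
    have "w0 t = w0 0" using assms unfolding constant_trajectory_iff by blast
    then show "w t i - w0 t i = w t i - w0 0 i" by (rule arg_cong[where f = "\<lambda>v. w t i - v i"])
  qed
  then show ?thesis by (simp only: tendsto_diff_fun_iff)
qed

text \<open>Regularity makes it possible to follow a given trajectory in the past and to obey the constraint in
  the future.  As the stacked operator is onto, some \<open>x\<close> satisfies \<open>G x = 0\<close> and \<open>K x = K b\<close> up to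
  time \<open>N\<close>, \<open>K x = 0\<close> afterwards.  Up to time \<open>N\<close>, \<open>x - b\<close> satisfies both equations, hence it agrees up to
  time 0 with an element \<open>z\<close> of the kernel of the stacked operator.  Then \<open>x - z\<close> continues the past
  of \<open>b\<close> and satisfies both equations after time \<open>N\<close>, so it eventually agrees with a stable
  trajectory.\<close>

lemma stabilizable_from_onto_constraint:
  assumes G: "G \<in> carrier_mat g n" and K: "K \<in> carrier_mat p n" and P: "P \<in> carrier_mat r n"
    and on: "onto (g + p) n (stack G K)"
    and stable: "\<And>b. b \<in> kernel_behavior n (stack G K) \<Longrightarrow> (act P b \<longlongrightarrow> (\<lambda>i. 0)) at_top"
    and b: "b \<in> kernel_behavior n G"
  shows "\<exists>b'\<in>kernel_behavior n G. (\<forall>t\<le>0. b' t = b t) \<and> (act P b' \<longlongrightarrow> (\<lambda>i. 0)) at_top"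
proof -
  let ?H = "stack G K"
  have H: "?H \<in> carrier_mat (g + p) n" by (rule stack_carrier[OF G K])
  obtain N where N: "N \<ge> 0" "\<And>T x. x \<in> trajectories n \<Longrightarrow> \<forall>t\<le>T. act ?H x t = (\<lambda>i. 0) \<Longrightarrow>
      \<exists>z\<in>kernel_behavior n ?H. \<forall>t\<le>T - N. z t = x t"
    using kernel_extends_past[OF H] by metis
  have ker: "z \<in> kernel_behavior n ?H \<longleftrightarrow> z \<in> kernel_behavior n G \<and> act K z = (\<lambda>t i. 0)" for z
    by (auto simp: kernel_behavior_def act_stack_zero_iff[OF G K])
  \<comment> \<open>switching at time \<open>N\<close> rather than 0 compensates the loss in extending a past solution\<close>
  define y where "y = (\<lambda>t i. if t \<le> N then act K b t i else 0)"
  have "y \<in> trajectories p" using act_trajectories[OF K, of b] by (simp add: y_def trajectories_iff)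
  then obtain x where x: "x \<in> trajectories n" "act G x = (\<lambda>t i. 0)" "act K x = y"
    using on unfolding onto_stack_iff[OF G K] using trajectories_zero by blast
  have xG: "x \<in> kernel_behavior n G" using x by (simp add: kernel_behavior_def)
  have "\<exists>z\<in>kernel_behavior n ?H. \<forall>t\<le>N - N. z t = (\<lambda>t i. x t i - b t i) t"
  proof (rule N(2))
    show "(\<lambda>t i. x t i - b t i) \<in> trajectories n"
      using trajectories_diff[OF x(1) kernelD(1)[OF b]] .
    show "\<forall>t\<le>N. act ?H (\<lambda>t i. x t i - b t i) t = (\<lambda>i. 0)"
      unfolding act_stack[OF G K] act_diff x kernelD(2)[OF b] by (auto simp: y_def fun_eq_iff)
  qed
  then obtain z where z: "z \<in> kernel_behavior n ?H" "\<And>t. t \<le> 0 \<Longrightarrow> z t = (\<lambda>i. x t i - b t i)" by auto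
  define b' where "b' = (\<lambda>t i. x t i - z t i)"
  have b': "b' \<in> kernel_behavior n G" using z(1) xG unfolding b'_def ker by (intro kernel_diff) auto
  have past: "b' t = b t" if "t \<le> 0" for t using z(2)[OF that] by (simp add: b'_def)
  have "act K b' = y" using z(1) unfolding b'_def act_diff x(3) ker by simp
  then have "act ?H b' t = (\<lambda>i. 0)" if "t \<ge> N + 1" for t
    unfolding act_stack[OF G K] kernelD(2)[OF b'] using that by (auto simp: y_def fun_eq_iff)
  then obtain v T where v: "v \<in> kernel_behavior n ?H" "\<And>t. t \<ge> T \<Longrightarrow> v t = b' t"
    using kernel_extends_future[OF H kernelD(1)[OF b'], of "N + 1"] by blast
  have "(act P b' \<longlongrightarrow> (\<lambda>i. 0)) at_top"
  proof (rule tendsto_eventually_eq_int[OF _ stable[OF v(1)]])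
    show "act P b' t = act P v t" if "t \<ge> T" for t
      by (rule act_cong_after[of T, OF _ that]) (simp add: v(2))
  qed
  then show ?thesis using b' past by blast
qed

text \<open>For \<open>q = 0\<close> the variable \<open>w\<close> is a copy of \<open>c\<close>, which is expressed by the additional equations
  \<open>w - c = 0\<close>; this lets one argument cover partial and full interconnection.\<close>

lemma kernel_split:
  assumes G: "G \<in> carrier_mat g (q + k)"
  shows "\<exists>Gw Gc h. Gw \<in> carrier_mat h (ref_dim q k) \<and> Gc \<in> carrier_mat h k \<and>
    (\<forall>w c. (w \<in> trajectories (ref_dim q k) \<and> c \<in> trajectories k \<and>
         (\<forall>t i. act Gw w t i + act Gc c t i = 0)) \<longleftrightarrow>
       (\<exists>b\<in>kernel_behavior (q + k) G. w = w_part q b \<and> c = c_part q b))"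
proof (cases "q = 0")
  case True
  let ?Gw = "stack (1\<^sub>m k) (0\<^sub>m g k) :: real poly mat" and ?Gc = "stack (- 1\<^sub>m k) G"
  have G': "G \<in> carrier_mat g k" using G True by simp
  have Gw: "?Gw \<in> carrier_mat (k + g) k" by (intro stack_carrier) auto
  have Gc: "?Gc \<in> carrier_mat (k + g) k" using G' by (intro stack_carrier) auto
  have zero: "act (0\<^sub>m g k) w = (\<lambda>t i. 0)" for w by (simp add: act_def fun_eq_iff)
  have neg: "act (- 1\<^sub>m k) c = (\<lambda>t i. - c t i)" if "c \<in> trajectories k" for c
  proof -
    have "act (- 1\<^sub>m k) c = (\<lambda>t i. - act (1\<^sub>m k) c t i)"
      by (simp add: act_def fun_eq_iff poly_act_uminus sum_negf)
    then show ?thesis unfolding act_one[OF that] .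
  qed
  have "(\<forall>t i. act ?Gw w t i + act ?Gc c t i = 0) \<longleftrightarrow> w = c \<and> act G c = (\<lambda>t i. 0)"
    if w: "w \<in> trajectories k" and c: "c \<in> trajectories k" for w c
  proof -
    have sum: "act ?Gw w t i + act ?Gc c t i = (if i < k then w t i - c t i else act G c t (i - k))" for t i
      unfolding act_stack[OF one_carrier_mat zero_carrier_mat] act_stack[OF uminus_carrier_mat[OF one_carrier_mat] G']
        act_one[OF w] neg[OF c] zero by simp
    show ?thesis unfolding sum
    proof
      assume *: "\<forall>t i. (if i < k then w t i - c t i else act G c t (i - k)) = 0"
      have "w t i = c t i" for t i
        using *[rule_format, of i t] w c by (cases "i < k") (auto simp: trajectories_iff)
      moreover have "act G c t i = 0" for t i using *[rule_format, of "k + i" t] by simp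
      ultimately show "w = c \<and> act G c = (\<lambda>t i. 0)" by (simp add: fun_eq_iff)
    qed simp
  qed
  then have "(w \<in> trajectories k \<and> c \<in> trajectories k \<and> (\<forall>t i. act ?Gw w t i + act ?Gc c t i = 0)) \<longleftrightarrow>
      (\<exists>b\<in>kernel_behavior k G. w = b \<and> c = b)" for w c
    by (auto simp: kernel_behavior_def)
  moreover have "w_part q b = b" "c_part q b = b" "ref_dim q k = k" "q + k = k" for b
    using True by (auto simp: w_part_def c_part_def ref_dim_def)
  ultimately show ?thesis using Gw Gc by (intro exI[of _ ?Gw] exI[of _ ?Gc] exI[of _ "k + g"]) simp
next
  case False
  define Gw where "Gw = mat g q (\<lambda>(i, j). G $$ (i, j))"
  define Gc where "Gc = mat g k (\<lambda>(i, j). G $$ (i, q + j))"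
  have Gw: "Gw \<in> carrier_mat g q" and Gc: "Gc \<in> carrier_mat g k" by (auto simp: Gw_def Gc_def)
  have split: "(\<Sum>j<q + m. F j) = (\<Sum>j<q. F j) + (\<Sum>j<m. F (q + j))" for F :: "nat \<Rightarrow> real" and m
    by (induction m) (auto simp: add.assoc)
  have sum: "act Gw (w_part q b) t i + act Gc (c_part q b) t i = act G b t i" for b t i
  proof (cases "i < g")
    case True
    have "act G b t i = (\<Sum>j<q + k. poly_act (G $$ (i, j)) (\<lambda>t. b t j) t)"
      using G True by (simp add: act_def)
    also have "\<dots> = (\<Sum>j<q. poly_act (G $$ (i, j)) (\<lambda>t. b t j) t) +
        (\<Sum>j<k. poly_act (G $$ (i, q + j)) (\<lambda>t. b t (q + j)) t)"
      by (rule split)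
    also have "(\<Sum>j<q. poly_act (G $$ (i, j)) (\<lambda>t. b t j) t) = act Gw (w_part q b) t i"
      using True False by (auto simp: act_def Gw_def w_part_def first_components_def intro!: sum.cong)
    also have "(\<Sum>j<k. poly_act (G $$ (i, q + j)) (\<lambda>t. b t (q + j)) t) = act Gc (c_part q b) t i"
      using True by (simp add: act_def Gc_def c_part_def)
    finally show ?thesis by simp
  qed (use G in \<open>simp add: act_def Gw_def Gc_def\<close>)
  have "(w \<in> trajectories q \<and> c \<in> trajectories k \<and> (\<forall>t i. act Gw w t i + act Gc c t i = 0)) \<longleftrightarrow>
      (\<exists>b\<in>kernel_behavior (q + k) G. w = w_part q b \<and> c = c_part q b)" for w c
  proof
    assume *: "w \<in> trajectories q \<and> c \<in> trajectories k \<and> (\<forall>t i. act Gw w t i + act Gc c t i = 0)"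
    define b where "b = (\<lambda>t i. if i < q then w t i else c t (i - q))"
    have b: "b \<in> trajectories (q + k)" using * by (auto simp: b_def trajectories_iff)
    have parts: "w = w_part q b" "c = c_part q b"
      using * False by (auto simp: b_def w_part_def c_part_def first_components_def trajectories_iff fun_eq_iff)
    have "act G b = (\<lambda>t i. 0)" unfolding sum[symmetric] parts[symmetric] using * by simp
    then show "\<exists>b\<in>kernel_behavior (q + k) G. w = w_part q b \<and> c = c_part q b"
      using b parts unfolding kernel_behavior_def by blast
  next
    assume "\<exists>b\<in>kernel_behavior (q + k) G. w = w_part q b \<and> c = c_part q b"
    then obtain b where b: "b \<in> kernel_behavior (q + k) G" "w = w_part q b" "c = c_part q b" by blast
    have "w_part q b \<in> trajectories q" using False by (simp add: w_part_def first_components_def trajectories_iff)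
    moreover have "c_part q b \<in> trajectories k" using kernelD(1)[OF b(1)] by (rule c_part_trajectories)
    moreover have "act Gw w t i + act Gc c t i = 0" for t i
      unfolding b(2,3) sum kernelD(2)[OF b(1)] ..
    ultimately show "w \<in> trajectories q \<and> c \<in> trajectories k \<and> (\<forall>t i. act Gw w t i + act Gc c t i = 0)"
      using b by blast
  qed
  moreover have "ref_dim q k = q" using False by (simp add: ref_dim_def)
  ultimately show ?thesis using Gw Gc by (intro exI[of _ Gw] exI[of _ Gc] exI[of _ g]) simp
qed

lemma regular_stabilizing_constraint:
  assumes G: "G \<in> carrier_mat g (q + k)" and on: "onto g (q + k) G"
    and det: "\<And>b. b \<in> kernel_behavior (q + k) G \<Longrightarrow> c_part q b = (\<lambda>t i. 0) \<Longrightarrow>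
      (w_part q b \<longlongrightarrow> (\<lambda>i. 0)) at_top"
    and stab: "\<And>b. b \<in> kernel_behavior (q + k) G \<Longrightarrow> \<exists>b'\<in>kernel_behavior (q + k) G.
      (\<forall>t\<le>0. w_part q b' t = w_part q b t) \<and> (w_part q b' \<longlongrightarrow> (\<lambda>i. 0)) at_top"
  shows "\<exists>p K. K \<in> carrier_mat p k \<and> onto (g + p) (q + k) (stack G (K * c_matrix q k)) \<and>
    (\<forall>b\<in>kernel_behavior (q + k) (stack G (K * c_matrix q k)). (w_part q b \<longlongrightarrow> (\<lambda>i. 0)) at_top)"
proof -
  obtain Gw Gc h where Gw: "Gw \<in> carrier_mat h (ref_dim q k)" and Gc: "Gc \<in> carrier_mat h k"
    and sys: "\<And>w c. (w \<in> trajectories (ref_dim q k) \<and> c \<in> trajectories k \<and>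
         (\<forall>t i. act Gw w t i + act Gc c t i = 0)) \<longleftrightarrow>
       (\<exists>b\<in>kernel_behavior (q + k) G. w = w_part q b \<and> c = c_part q b)"
    using kernel_split[OF G] by blast
  have "\<exists>p K. K \<in> carrier_mat p k \<and>
      (\<forall>y\<in>trajectories p. \<exists>w c. (w \<in> trajectories (ref_dim q k) \<and> c \<in> trajectories k \<and>
         (\<forall>t i. act Gw w t i + act Gc c t i = 0)) \<and> act K c = y) \<and>
      (\<forall>w c. (w \<in> trajectories (ref_dim q k) \<and> c \<in> trajectories k \<and>
         (\<forall>t i. act Gw w t i + act Gc c t i = 0)) \<and> act K c = (\<lambda>t i. 0) \<longrightarrow> (w \<longlongrightarrow> (\<lambda>i. 0)) at_top)"
  proof (rule stabilizing_constraint[OF Gw Gc])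
    fix w assume w: "w \<in> kernel_behavior (ref_dim q k) Gw"
    have "\<forall>t i. act Gw w t i + act Gc (\<lambda>t i. 0) t i = 0" using kernelD(2)[OF w] by simp
    then obtain b where "b \<in> kernel_behavior (q + k) G" "w = w_part q b" "(\<lambda>t i. 0) = c_part q b"
      using sys[of w "\<lambda>t i. 0"] kernelD(1)[OF w] trajectories_zero by blast
    then show "(w \<longlongrightarrow> (\<lambda>i. 0)) at_top" using det[of b] by simp
  next
    fix w c
    assume "w \<in> trajectories (ref_dim q k) \<and> c \<in> trajectories k \<and> (\<forall>t i. act Gw w t i + act Gc c t i = 0)"
    then obtain b where "b \<in> kernel_behavior (q + k) G" and w: "w = w_part q b" unfolding sys by blast
    from stab[OF this(1)] obtain b' where "b' \<in> kernel_behavior (q + k) G"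
      "\<forall>t\<le>0. w_part q b' t = w_part q b t" "(w_part q b' \<longlongrightarrow> (\<lambda>i. 0)) at_top" by blast
    then show "\<exists>w' c'. (w' \<in> trajectories (ref_dim q k) \<and> c' \<in> trajectories k \<and>
        (\<forall>t i. act Gw w' t i + act Gc c' t i = 0)) \<and> (\<forall>t\<le>0. w' t = w t) \<and> (w' \<longlongrightarrow> (\<lambda>i. 0)) at_top"
      unfolding sys w by blast
  qed
  then obtain p K where K: "K \<in> carrier_mat p k"
    and Kon': "\<forall>y\<in>trajectories p. \<exists>w c.
      (\<exists>b\<in>kernel_behavior (q + k) G. w = w_part q b \<and> c = c_part q b) \<and> act K c = y"
    and Kst': "\<forall>w c. (\<exists>b\<in>kernel_behavior (q + k) G. w = w_part q b \<and> c = c_part q b) \<and>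
      act K c = (\<lambda>t i. 0) \<longrightarrow> (w \<longlongrightarrow> (\<lambda>i. 0)) at_top"
    unfolding sys by (elim exE conjE) (rule that)
  have Kon: "\<exists>b\<in>kernel_behavior (q + k) G. act K (c_part q b) = y" if y: "y \<in> trajectories p" for y
  proof -
    from bspec[OF Kon' y] obtain w c b where
      "b \<in> kernel_behavior (q + k) G" "c = c_part q b" "act K c = y"
      by (elim exE conjE bexE) (rule that)
    then show ?thesis by (intro bexI[of _ b]) simp_all
  qed
  have Kst: "(w_part q b \<longlongrightarrow> (\<lambda>i. 0)) at_top"
    if "b \<in> kernel_behavior (q + k) G" "act K (c_part q b) = (\<lambda>t i. 0)" for b
    using Kst'[rule_format, of "w_part q b" "c_part q b"] that by (metis (no_types))
  let ?K = "K * c_matrix q k"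
  have K': "?K \<in> carrier_mat p (q + k)" using K c_matrix_carrier by (rule mult_carrier_mat)
  have Kact: "act ?K b = act K (c_part q b)" if "b \<in> trajectories (q + k)" for b
    using act_mult[OF K c_matrix_carrier] act_c_matrix[OF that] by simp
  have "onto (g + p) (q + k) (stack G ?K)"
    unfolding onto_stack_iff[OF G K']
  proof (intro ballI)
    fix y z assume y: "y \<in> trajectories g" and z: "z \<in> trajectories p"
    obtain b1 where b1: "b1 \<in> trajectories (q + k)" "act G b1 = y" using on y unfolding onto_def by blast
    have "(\<lambda>t i. z t i - act ?K b1 t i) \<in> trajectories p"
      using z act_trajectories[OF K'] by (rule trajectories_diff)
    then obtain b2 where b2: "b2 \<in> kernel_behavior (q + k) G"
      "act K (c_part q b2) = (\<lambda>t i. z t i - act ?K b1 t i)" by (rule bexE[OF Kon])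
    show "\<exists>b\<in>trajectories (q + k). act G b = y \<and> act ?K b = z"
    proof (intro bexI[of _ "\<lambda>t i. b1 t i + b2 t i"] conjI)
      show "(\<lambda>t i. b1 t i + b2 t i) \<in> trajectories (q + k)"
        using b1(1) kernelD(1)[OF b2(1)] by (rule trajectories_add)
      show "act G (\<lambda>t i. b1 t i + b2 t i) = y"
        unfolding act_add b1(2) kernelD(2)[OF b2(1)] by simp
      show "act ?K (\<lambda>t i. b1 t i + b2 t i) = z"
        unfolding act_add Kact[OF kernelD(1)[OF b2(1)]] b2(2) by simp
    qed
  qed
  moreover have "(w_part q b \<longlongrightarrow> (\<lambda>i. 0)) at_top" if "b \<in> kernel_behavior (q + k) (stack G ?K)" for b
  proof -
    have "b \<in> kernel_behavior (q + k) G" "act ?K b = (\<lambda>t i. 0)"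
      using that unfolding kernel_behavior_def act_stack_zero_iff[OF G K'] by auto
    then show ?thesis using Kst[of b] Kact[OF kernelD(1), of b G] by simp
  qed
  ultimately show ?thesis using K by blast
qed

lemma interconnection_translate:
  assumes G: "G \<in> carrier_mat g (q + k)" and K: "K \<in> carrier_mat p k"
    and b: "b \<in> B" "B = translate b (kernel_behavior (q + k) G)" "B \<subseteq> trajectories (q + k)"
    and C: "C = translate (c_part q b) (kernel_behavior k K)"
  shows "interconnection q B C = translate b (kernel_behavior (q + k) (stack G (K * c_matrix q k)))"
proof (rule Set.set_eqI)
  fix x
  let ?d = "\<lambda>t i. x t i - b t i"
  have K': "K * c_matrix q k \<in> carrier_mat p (q + k)" using K c_matrix_carrier by (rule mult_carrier_mat)
  have "x \<in> interconnection q B C \<longleftrightarrow> ?d \<in> kernel_behavior (q + k) G \<and> c_part q ?d \<in> kernel_behavior k K"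
    unfolding interconnection_def mem_Collect_eq C by (subst b(2)) (simp add: mem_translate c_part_diff)
  also have "\<dots> \<longleftrightarrow> ?d \<in> kernel_behavior (q + k) (stack G (K * c_matrix q k))"
  proof (cases "?d \<in> trajectories (q + k)")
    case True
    then have "act (K * c_matrix q k) ?d = act K (c_part q ?d)"
      using act_mult[OF K c_matrix_carrier] act_c_matrix by simp
    then show ?thesis using True c_part_trajectories[OF True]
      unfolding kernel_behavior_def act_stack_zero_iff[OF G K'] by simp
  qed (simp add: kernel_behavior_def)
  finally show "x \<in> interconnection q B C \<longleftrightarrow> x \<in> translate b (kernel_behavior (q + k) (stack G (K * c_matrix q k)))"
    by (simp add: mem_translate)
qed

text \<open>Regularity means that the equations of the plant and of the controller are independent, because the
  input cardinality counts independent equations.\<close>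

lemma regular_interconnection_iff:
  assumes G: "G \<in> carrier_mat g (q + k)" "onto g (q + k) G" and K: "K \<in> carrier_mat p k" "onto p k K"
    and b: "b \<in> B" "B = translate b (kernel_behavior (q + k) G)" "B \<subseteq> trajectories (q + k)"
    and C: "C = translate (c_part q b) (kernel_behavior k K)"
  shows "regular_interconnection q k B C \<longleftrightarrow> onto (g + p) (q + k) (stack G (K * c_matrix q k))"
proof -
  let ?H = "stack G (K * c_matrix q k)" and ?n = "q + k"
  have H: "?H \<in> carrier_mat (g + p) ?n"
    by (intro stack_carrier[OF G(1)] mult_carrier_mat[OF K(1) c_matrix_carrier])
  have inter: "interconnection q B C = translate b (kernel_behavior ?n ?H)"
    by (rule interconnection_translate[OF G(1) K(1) b C])
  have "b \<in> interconnection q B C" unfolding inter by (simp add: mem_translate)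
  then have ne: "interconnection q B C \<noteq> {}" by blast
  have mB: "int (input_cardinality ?n B) = int ?n - int g"
    using input_cardinality_kernel(1)[OF G] input_cardinality_kernel(2)[OF G, of b] b(2) by simp
  have mC: "output_cardinality k C = p"
    using input_cardinality_kernel(1)[OF K] input_cardinality_kernel(2)[OF K, of "c_part q b"] unfolding C output_cardinality_def by simp
  have "regular_interconnection q k B C \<longleftrightarrow>
      int (input_cardinality ?n (translate b (kernel_behavior ?n ?H))) = int ?n - int (g + p)"
    unfolding regular_interconnection_def mB mC inter[symmetric] using ne by auto
  also have "\<dots> \<longleftrightarrow> onto (g + p) ?n ?H"
    using onto_if_input_cardinality[OF H, of b] input_cardinality_kernel(1)[OF H] input_cardinality_kernel(2)[OF H, of b] by auto
  finally show ?thesis .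
qed

lemma w_part_image_translate:
  assumes "b \<in> trajectories (q + k)" "W \<subseteq> trajectories (q + k)"
  shows "w_part q ` translate b W = translate (w_part q b) (act (w_matrix q k) ` W)"
proof -
  have "act (w_matrix q k) ` W = w_part q ` W"
    by (rule image_cong[OF refl]) (use assms act_w_matrix in blast)
  then show ?thesis by (simp add: translate_def image_image w_part_add)
qed

lemma stable_at_translate:
  assumes w0: "constant_trajectory w0" and Q: "\<And>w. w \<in> kernel_behavior r Q \<Longrightarrow> (w \<longlongrightarrow> (\<lambda>i. 0)) at_top"
  shows "stable_at w0 (translate w0 (kernel_behavior r Q))"
  unfolding stable_at_def tendsto_constant_trajectory[OF w0]
  using w0 Q by (simp add: mem_translate)

text \<open>Offsets cancel in differences: steering two trajectories to the same point steers their difference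
  to 0.\<close>

lemma linear_part_conditions:
  assumes B: "B \<subseteq> trajectories (q + k)" "b0 \<in> B" "B = translate b0 (kernel_behavior (q + k) G)"
    and det: "detectable q B" and stab: "offset_stabilizable (ref_dim q k) (proj_w q B)"
  shows "\<And>b. b \<in> kernel_behavior (q + k) G \<Longrightarrow> c_part q b = (\<lambda>t i. 0) \<Longrightarrow>
      (w_part q b \<longlongrightarrow> (\<lambda>i. 0)) at_top"
    and "\<And>b. b \<in> kernel_behavior (q + k) G \<Longrightarrow> \<exists>b'\<in>kernel_behavior (q + k) G.
      (\<forall>t\<le>0. w_part q b' t = w_part q b t) \<and> (w_part q b' \<longlongrightarrow> (\<lambda>i. 0)) at_top"
proof -
  fix b assume b: "b \<in> kernel_behavior (q + k) G"
  let ?b1 = "\<lambda>t i. b0 t i + b t i"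
  have b1: "?b1 \<in> B" unfolding B(3) mem_translate using b by simp
  show "(w_part q b \<longlongrightarrow> (\<lambda>i. 0)) at_top" if "c_part q b = (\<lambda>t i. 0)"
  proof -
    have "c_part q ?b1 = c_part q b0" unfolding c_part_add that by simp
    then have "((\<lambda>t i. w_part q ?b1 t i - w_part q b0 t i) \<longlongrightarrow> (\<lambda>i. 0)) at_top"
      using det b1 B(2) unfolding detectable_def by blast
    then show ?thesis by (simp add: w_part_add)
  qed
  obtain w0 where w0: "stabilizable_at (ref_dim q k) w0 (proj_w q B)"
    using stab unfolding offset_stabilizable_def by blast
  have steer: "\<exists>b'\<in>B. (\<forall>t\<le>0. w_part q b' t = w_part q x t) \<and> (w_part q b' \<longlongrightarrow> w0 0) at_top" if "x \<in> B" for x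
    using w0 that unfolding stabilizable_at_def proj_w_def by blast
  obtain x y where x: "x \<in> B" "\<And>t. t \<le> 0 \<Longrightarrow> w_part q x t = w_part q ?b1 t" "(w_part q x \<longlongrightarrow> w0 0) at_top"
    and y: "y \<in> B" "\<And>t. t \<le> 0 \<Longrightarrow> w_part q y t = w_part q b0 t" "(w_part q y \<longlongrightarrow> w0 0) at_top"
    using steer[OF b1] steer[OF B(2)] by blast
  have "(\<lambda>t i. x t i - y t i) \<in> kernel_behavior (q + k) G"
    using kernel_diff[of "\<lambda>t i. x t i - b0 t i" "q + k" G "\<lambda>t i. y t i - b0 t i"] x(1) y(1)
    unfolding B(3) mem_translate by simp
  moreover have "w_part q (\<lambda>t i. x t i - y t i) t = w_part q b t" if "t \<le> 0" for t
    unfolding w_part_diff using x(2)[OF that] y(2)[OF that] by (simp add: w_part_add)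
  moreover have "(w_part q (\<lambda>t i. x t i - y t i) \<longlongrightarrow> (\<lambda>i. 0)) at_top"
  proof (unfold w_part_diff tendsto_fun_iff, rule allI)
    fix i
    have "((\<lambda>t. w_part q x t i) \<longlongrightarrow> w0 0 i) at_top" "((\<lambda>t. w_part q y t i) \<longlongrightarrow> w0 0 i) at_top"
      using x(3) y(3) unfolding tendsto_fun_iff by blast+
    from tendsto_diff[OF this] show "((\<lambda>t. w_part q x t i - w_part q y t i) \<longlongrightarrow> 0) at_top" by simp
  qed
  ultimately show "\<exists>b'\<in>kernel_behavior (q + k) G.
      (\<forall>t\<le>0. w_part q b' t = w_part q b t) \<and> (w_part q b' \<longlongrightarrow> (\<lambda>i. 0)) at_top" by blast
qed

text \<open>Two trajectories with the same control variables differ by an element of the kernel of the stacked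
  operator, on which \<open>w\<close> tends to 0 by stability of the reference.\<close>

lemma conditions_from_implementation:
  assumes B: "B \<subseteq> trajectories (q + k)" "\<And>b. b \<in> B \<Longrightarrow> B = translate b (kernel_behavior (q + k) G)"
    and G: "G \<in> carrier_mat g (q + k)" "onto g (q + k) G"
    and C: "C \<in> linear_behaviors k" and reg: "regular_interconnection q k B C"
    and stable: "offset_stable (controlled_behavior q B C)"
  shows "detectable q B" "offset_stabilizable (ref_dim q k) (proj_w q B)"
proof -
  let ?n = "q + k"
  obtain w0 where w0: "constant_trajectory w0" "w0 \<in> controlled_behavior q B C"
    and w0_lim: "\<And>w. w \<in> controlled_behavior q B C \<Longrightarrow> (w \<longlongrightarrow> w0 0) at_top"
    using stable unfolding offset_stable_def stable_at_def by blast
  obtain b where b: "b \<in> B" "c_part q b \<in> C" "w_part q b = w0"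
    using w0(2) unfolding controlled_behavior_def proj_w_def interconnection_def by blast
  obtain p0 K0 where "K0 \<in> carrier_mat p0 k" "C = kernel_behavior k K0"
    using linear_behavior_kernel_representation[OF C] by blast
  then obtain p K where K: "K \<in> carrier_mat p k" "onto p k K" and CK: "C = kernel_behavior k K"
    using kernel_behavior_onto_representation by metis
  have C': "C = translate (c_part q b) (kernel_behavior k K)"
    using translate_kernel_eq[of "c_part q b" "\<lambda>t i. 0" k K] b(2) unfolding CK by (simp add: translate_def)
  let ?K = "K * c_matrix q k" and ?H = "stack G (K * c_matrix q k)"
  have K': "?K \<in> carrier_mat p ?n" using K(1) c_matrix_carrier by (rule mult_carrier_mat)
  have inter: "interconnection q B C = translate b (kernel_behavior ?n ?H)"
    by (rule interconnection_translate[OF G(1) K(1) b(1) B(2)[OF b(1)] B(1) C'])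
  have onH: "onto (g + p) ?n ?H"
    using reg regular_interconnection_iff[OF G K b(1) B(2)[OF b(1)] B(1) C'] by blast
  have lim: "(w_part q x \<longlongrightarrow> (\<lambda>i. 0)) at_top" if x: "x \<in> kernel_behavior ?n ?H" for x
  proof -
    have "(\<lambda>t i. b t i + x t i) \<in> interconnection q B C" unfolding inter mem_translate using x by simp
    then have "w_part q (\<lambda>t i. b t i + x t i) \<in> controlled_behavior q B C"
      unfolding controlled_behavior_def proj_w_def by blast
    from w0_lim[OF this] show ?thesis
      unfolding tendsto_constant_trajectory[OF w0(1)] w_part_add b(3) by simp
  qed
  show "detectable q B"
    unfolding detectable_def
  proof (intro ballI impI)
    fix b1 b2 assume b12: "b1 \<in> B" "b2 \<in> B" "c_part q b1 = c_part q b2"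
    let ?d = "\<lambda>t i. b1 t i - b2 t i"
    have d: "?d \<in> kernel_behavior ?n G" using b12(1) B(2)[OF b12(2)] by (metis mem_translate)
    have "act ?K ?d = act K (c_part q ?d)"
      using act_mult[OF K(1) c_matrix_carrier] act_c_matrix[OF kernelD(1)[OF d]] by simp
    also have "c_part q ?d = (\<lambda>t i. 0)" unfolding c_part_diff b12(3) by simp
    finally have "?d \<in> kernel_behavior ?n ?H"
      using d unfolding kernel_behavior_def act_stack_zero_iff[OF G(1) K'] by simp
    from lim[OF this] show "((\<lambda>t i. w_part q b1 t i - w_part q b2 t i) \<longlongrightarrow> (\<lambda>i. 0)) at_top"
      unfolding w_part_diff .
  qed
  have w0B: "w0 \<in> proj_w q B" using b unfolding proj_w_def by blast
  have "stabilizable_at (ref_dim q k) w0 (proj_w q B)"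
    unfolding stabilizable_at_def
  proof (intro conjI ballI)
    show "constant_trajectory w0" by (rule w0(1))
    show "w0 \<in> trajectories (ref_dim q k)"
      unfolding b(3)[symmetric] using B(1) b(1) by (intro w_part_trajectories) blast
    fix w assume "w \<in> proj_w q B"
    then obtain x where x: "x \<in> B" "w = w_part q x" unfolding proj_w_def by blast
    let ?d = "\<lambda>t i. x t i - b t i"
    have d: "?d \<in> kernel_behavior ?n G" using x(1) B(2)[OF b(1)] by (metis mem_translate)
    have "\<exists>d'\<in>kernel_behavior ?n G. (\<forall>t\<le>0. d' t = ?d t) \<and> (act (w_matrix q k) d' \<longlongrightarrow> (\<lambda>i. 0)) at_top"
    proof (rule stabilizable_from_onto_constraint[OF G(1) K' w_matrix_carrier onH _ d])
      fix y assume y: "y \<in> kernel_behavior ?n ?H"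
      show "(act (w_matrix q k) y \<longlongrightarrow> (\<lambda>i. 0)) at_top"
        unfolding act_w_matrix[OF kernelD(1)[OF y]] by (rule lim[OF y])
    qed
    then obtain d' where d': "d' \<in> kernel_behavior ?n G" "\<And>t. t \<le> 0 \<Longrightarrow> d' t = ?d t"
      "(act (w_matrix q k) d' \<longlongrightarrow> (\<lambda>i. 0)) at_top" by auto
    let ?x = "\<lambda>t i. b t i + d' t i"
    have "?x \<in> B" by (subst B(2)[OF b(1)]) (simp add: mem_translate d'(1))
    moreover have "w_part q ?x t = w t" if "t \<le> 0" for t
    proof -
      have "?x t = x t" using d'(2)[OF that] by auto
      then show ?thesis unfolding x(2) by (auto simp: w_part_def first_components_def fun_eq_iff)
    qed
    moreover have "(w_part q ?x \<longlongrightarrow> w0 0) at_top"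
      using d'(3) unfolding tendsto_constant_trajectory[OF w0(1)] w_part_add b(3) act_w_matrix[OF kernelD(1)[OF d'(1)]]
      by simp
    ultimately show "\<exists>w'\<in>proj_w q B. (\<forall>t\<le>0. w' t = w t) \<and> (w' \<longlongrightarrow> w0 0) at_top"
      unfolding proj_w_def by blast
  qed
  then show "offset_stabilizable (ref_dim q k) (proj_w q B)"
    unfolding offset_stabilizable_def using w0B by blast
qed

theorem theoremV6:
  fixes q k :: nat and B :: "trajectory set"
  assumes "B \<in> affine_behaviors (q + k)"
  shows "((detectable q B \<and> offset_stabilizable (ref_dim q k) (proj_w q B)) \<longleftrightarrow>
           (\<exists>R\<in>affine_behaviors (ref_dim q k).
              regularly_implementable q k (linear_behaviors k) B R \<and> offset_stable R))
       \<and> (detectable q B \<and> offset_stabilizable (ref_dim q k) (proj_w q B) \<longrightarrow>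
           (\<forall>b\<in>B. constant_trajectory b \<longrightarrow>
              (\<exists>R\<in>affine_behaviors (ref_dim q k).
                 regularly_implementable q k (affine_behaviors k) B R \<and>
                 stable_at (w_part q b) R)))"
proof -
  let ?n = "q + k" and ?r = "ref_dim q k"
  have B: "B \<subseteq> trajectories ?n" "B \<noteq> {}" "time_invariant_behavior B"
    using assms by (auto simp: affine_behaviors_def)
  obtain g0 G0 where G0: "G0 \<in> carrier_mat g0 ?n" "\<forall>b\<in>B. B = translate b (kernel_behavior ?n G0)"
    using affine_behavior_kernel_representation[OF assms] by blast
  obtain g G where G: "G \<in> carrier_mat g ?n" "onto g ?n G" "kernel_behavior ?n G = kernel_behavior ?n G0"
    using kernel_behavior_onto_representation[OF G0(1)] by blast
  have rep: "B = translate b (kernel_behavior ?n G)" if "b \<in> B" for b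
    using G0(2) that G(3) by auto
  have backward: "detectable q B \<and> offset_stabilizable ?r (proj_w q B)"
    if R: "regularly_implementable q k (linear_behaviors k) B R" "offset_stable R" for R
  proof -
    obtain C where "C \<in> linear_behaviors k" "regular_interconnection q k B C" "controlled_behavior q B C = R"
      using R(1) unfolding regularly_implementable_def by blast
    then show ?thesis using conditions_from_implementation[OF B(1) rep G(1,2)] R(2) by blast
  qed
  have forward: "(\<exists>R\<in>affine_behaviors ?r. regularly_implementable q k (linear_behaviors k) B R \<and> offset_stable R) \<and>
      (\<forall>b\<in>B. constant_trajectory b \<longrightarrow> (\<exists>R\<in>affine_behaviors ?r.
         regularly_implementable q k (affine_behaviors k) B R \<and> stable_at (w_part q b) R))"
    if det: "detectable q B" and stab: "offset_stabilizable ?r (proj_w q B)"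
  proof -
    obtain b0 where b0: "b0 \<in> B" using B(2) by blast
    note lin = linear_part_conditions[OF B(1) b0 rep[OF b0] det stab]
    obtain p K where K: "K \<in> carrier_mat p k" and onH: "onto (g + p) ?n (stack G (K * c_matrix q k))"
      and lim: "\<And>b. b \<in> kernel_behavior ?n (stack G (K * c_matrix q k)) \<Longrightarrow> (w_part q b \<longlongrightarrow> (\<lambda>i. 0)) at_top"
      using regular_stabilizing_constraint[OF G(1,2) lin] by metis
    let ?K = "K * c_matrix q k" and ?H = "stack G (K * c_matrix q k)"
    have K': "?K \<in> carrier_mat p ?n" using K c_matrix_carrier by (rule mult_carrier_mat)
    have H: "?H \<in> carrier_mat (g + p) ?n" by (rule stack_carrier[OF G(1) K'])
    have Kact: "act ?K b = act K (c_part q b)" if "b \<in> trajectories ?n" for b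
      using act_mult[OF K c_matrix_carrier] act_c_matrix[OF that] by simp
    have onK: "onto p k K"
      unfolding onto_def
    proof
      fix y assume "y \<in> trajectories p"
      then obtain b where b: "b \<in> trajectories ?n" "act ?K b = y"
        using onH unfolding onto_stack_iff[OF G(1) K'] using trajectories_zero by blast
      then show "\<exists>c\<in>trajectories k. act K c = y" using Kact c_part_trajectories by metis
    qed
    obtain s Q where Q: "Q \<in> carrier_mat s ?r" "act (w_matrix q k) ` kernel_behavior ?n ?H = kernel_behavior ?r Q"
      using projection_is_kernel[OF H w_matrix_carrier] by blast
    have Qlim: "(w \<longlongrightarrow> (\<lambda>i. 0)) at_top" if w: "w \<in> kernel_behavior ?r Q" for w
    proof -
      obtain b where b: "b \<in> kernel_behavior ?n ?H" "w = act (w_matrix q k) b"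
        using w unfolding Q(2)[symmetric] by blast
      show ?thesis unfolding b(2) act_w_matrix[OF kernelD(1)[OF b(1)]] by (rule lim[OF b(1)])
    qed
    have controlled: "regular_interconnection q k B C"
        "controlled_behavior q B C = translate (w_part q b) (kernel_behavior ?r Q)"
      if b: "b \<in> B" and C: "C = translate (c_part q b) (kernel_behavior k K)" for b C
    proof -
      show "regular_interconnection q k B C"
        using regular_interconnection_iff[OF G(1,2) K onK b rep[OF b] B(1) C] onH by blast
      have "b \<in> trajectories ?n" using b B(1) by blast
      moreover have "kernel_behavior ?n ?H \<subseteq> trajectories ?n" using kernelD(1) by blast
      ultimately show "controlled_behavior q B C = translate (w_part q b) (kernel_behavior ?r Q)"
        unfolding controlled_behavior_def proj_w_def Q(2)[symmetric]
          interconnection_translate[OF G(1) K b rep[OF b] B(1) C]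
        by (rule w_part_image_translate)
    qed
    have "\<exists>R\<in>affine_behaviors ?r. regularly_implementable q k (linear_behaviors k) B R \<and> offset_stable R"
    proof -
      have "act ?K b0 \<in> trajectories p" by (rule act_trajectories[OF K'])
      then obtain x where x: "x \<in> trajectories ?n" "act G x = (\<lambda>t i. 0)" "act ?K x = act ?K b0"
        using onH unfolding onto_stack_iff[OF G(1) K'] using trajectories_zero by blast
      define b where "b = (\<lambda>t i. b0 t i - x t i)"
      have "(\<lambda>t i. (-1) * x t i) \<in> kernel_behavior ?n G"
        using x by (intro kernel_scale) (simp add: kernel_behavior_def)
      then have b: "b \<in> B" unfolding b_def by (subst rep[OF b0]) (simp add: mem_translate)
      have bt: "b \<in> trajectories ?n" using b B(1) by blast
      have Kb: "act ?K b = (\<lambda>t i. 0)" unfolding b_def act_diff x(3) by simp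
      have "c_part q b \<in> kernel_behavior k K"
        using Kb Kact[OF bt] c_part_trajectories[OF bt] by (simp add: kernel_behavior_def)
      then have C: "kernel_behavior k K = translate (c_part q b) (kernel_behavior k K)"
        using translate_kernel_eq[of "c_part q b" "\<lambda>t i. 0" k K] by (simp add: translate_def)
      let ?R = "controlled_behavior q B (kernel_behavior k K)"
      have R: "?R = translate (w_part q b) (kernel_behavior ?r Q)" by (rule controlled(2)[OF b C])
      \<comment> \<open>time-invariance of the plant and of the linear controller\<close>
      have shift: "(\<lambda>t i. b (t + 1) i - b t i) \<in> kernel_behavior ?n ?H"
      proof -
        have "time_shift 1 b \<in> B" using B(3) b unfolding time_invariant_behavior_def by blast
        then have "(\<lambda>t i. time_shift 1 b t i - b t i) \<in> kernel_behavior ?n G"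
          using rep[OF b] by (metis mem_translate)
        moreover have "act ?K (\<lambda>t i. time_shift 1 b t i - b t i) = (\<lambda>t i. 0)"
          unfolding act_diff act_shift Kb by (simp add: time_shift_def)
        ultimately show ?thesis
          unfolding kernel_behavior_def act_stack_zero_iff[OF G(1) K'] by (simp add: time_shift_def)
      qed
      have "act (w_matrix q k) (\<lambda>t i. b (t + 1) i - b t i) = (\<lambda>t i. w_part q b (t + 1) i - w_part q b t i)"
        unfolding act_w_matrix[OF kernelD(1)[OF shift]]
        by (auto simp: w_part_def first_components_def fun_eq_iff)
      then have "(\<lambda>t i. w_part q b (t + 1) i - w_part q b t i) \<in> kernel_behavior ?r Q"
        using imageI[OF shift, of "act (w_matrix q k)"] unfolding Q(2) by (simp only:)
      from stable_translate_contains_constant[OF Q(1) Qlim w_part_trajectories[OF bt] this]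
      obtain w0 where w0: "w0 \<in> translate (w_part q b) (kernel_behavior ?r Q)" "constant_trajectory w0"
        by blast
      have Rw0: "?R = translate w0 (kernel_behavior ?r Q)"
        unfolding R using translate_kernel_eq[OF w0(1)] by simp
      have w0t: "w0 \<in> trajectories ?r"
      proof -
        have "(\<lambda>t i. w0 t i - w_part q b t i) \<in> trajectories ?r" using w0(1) kernelD(1) by (simp add: mem_translate)
        from trajectories_add[OF this w_part_trajectories[OF bt]] show ?thesis by simp
      qed
      have "?R \<in> affine_behaviors ?r"
        unfolding Rw0 by (rule affine_behavior_translate[OF Q(1) w0(2) w0t])
      moreover have "stable_at w0 ?R" unfolding Rw0 by (rule stable_at_translate[OF w0(2) Qlim])
      moreover have "regularly_implementable q k (linear_behaviors k) B ?R"
        unfolding regularly_implementable_def using linear_behavior_kernel[OF K] controlled(1)[OF b C] by blast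
      ultimately show ?thesis unfolding offset_stable_def stable_at_def by blast
    qed
    moreover have "\<exists>R\<in>affine_behaviors ?r. regularly_implementable q k (affine_behaviors k) B R \<and>
        stable_at (w_part q b) R" if b: "b \<in> B" "constant_trajectory b" for b
    proof -
      let ?C = "translate (c_part q b) (kernel_behavior k K)"
      have bt: "b \<in> trajectories ?n" using b B(1) by blast
      have "?C \<in> affine_behaviors k"
        by (rule affine_behavior_translate[OF K constant_c_part[OF b(2)] c_part_trajectories[OF bt]])
      then have "regularly_implementable q k (affine_behaviors k) B (controlled_behavior q B ?C)"
        unfolding regularly_implementable_def using controlled(1)[OF b(1) refl] by blast
      moreover have "controlled_behavior q B ?C \<in> affine_behaviors ?r"
        unfolding controlled(2)[OF b(1) refl]
        by (rule affine_behavior_translate[OF Q(1) constant_w_part[OF b(2)] w_part_trajectories[OF bt]])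
      moreover have "stable_at (w_part q b) (controlled_behavior q B ?C)"
        unfolding controlled(2)[OF b(1) refl] by (rule stable_at_translate[OF constant_w_part[OF b(2)] Qlim])
      ultimately show ?thesis by blast
    qed
    ultimately show ?thesis by blast
  qed
  show ?thesis using backward forward by blast
qed

end
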